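(* Let $\mu$ be a Borel probability measure on the unit circle $\partial\mathbb{D}$ whose support is not a finite set, with Verblunsky coefficients $\alpha=\{\alpha_n\}_{n=0}^\infty\in\mathbb{D}^\infty$ and Lebesgue decomposition $d\mu = w(\theta)\frac{d\theta}{2\pi}+d\mu_{\mathrm s}$. Assume that $\delta\alpha\in\ell^2$. Then for any $m\in\mathbb{N}_0=\{0,1,2,\dots\}$, the condition \[ \int (1-\cos\theta)^m\log w(\theta)\,\frac{d\theta}{2\pi} > -\infty \] is equivalent to $\alpha\in\ell^{2m+2}$.
   Context: $\mathbb{D}=\{z\in\mathbb{C}:|z|<1\}$ and $\partial\mathbb{D}$ is the unit circle, parametrized by $z=e^{i\theta}$; integrals in $\theta$ are over one period, $\theta\in[0,2\pi)$. Verblunsky coefficients: let $\mu$ be a Borel probability measure on $\partial\mathbb{D}$ whose support is not a finite set. Let $\varphi_n(z)$, $\deg\varphi_n=n$, be the orthonormal polynomials obtained by orthonormalizing (Gram--Schmidt, positive leading coefficients) the sequence $1,z,z^2,\dots$ in $L^2(\partial\mathbb{D},d\mu)$. They obey the recursion \[ \varphi_{n+1}(z)=\frac{1}{\sqrt{1-|\alpha_n|^2}}\left(z\varphi_n(z)-\bar\alpha_n z^n\overline{\varphi_n(1/\bar z)}\right),\qquad n\ge 0, \] for uniquely determined $\alpha_n\in\mathbb{D}$, the Verblunsky coefficients of $\mu$. The map $\mu\mapsto\alpha=\{\alpha_n\}_{n=0}^\infty$ is a bijection from such measures onto $\mathbb{D}^\infty$. In the Lebesgue decomposition $d\mu=w(\theta)\frac{d\theta}{2\pi}+d\mu_{\mathrm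 s}$, $w\ge 0$ is the density of the absolutely continuous part and $\mu_{\mathrm s}$ is singular with respect to Lebesgue measure. $\delta$ is the forward difference: $(\delta\alpha)_n=\alpha_{n+1}-\alpha_n$ for $n\ge0$. The integral in the claim (with $\log 0=-\infty$) is always well defined with values in $[-\infty,\infty)$, since the positive part of the integrand is integrable. *)

theory Defs
  imports "HOL-Probability.Probability" "HOL-Computational_Algebra.Polynomial"
begin

definition circle_borel :: "complex measure" where
  "circle_borel = restrict_space borel (sphere 0 1)"

text \<open>The normalized measure $d\theta/2\pi$ on the period $[0,2\pi)$, and its image on the circle.\<close>

definition angle_measure :: "real measure" where
  "angle_measure = scale_measure (ennreal (1 / (2 * pi))) (restrict_space lborel {0..<2 * pi})"

definition circle_lebesgue :: "complex measure" where
  "circle_lebesgue = distr angle_measure circle_borel cis"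

definition circle_support :: "complex measure \<Rightarrow> complex set" where
  "circle_support \<mu> = {z \<in> sphere 0 1. \<forall>U. open U \<longrightarrow> z \<in> U \<longrightarrow> emeasure \<mu> (U \<inter> sphere 0 1) > 0}"

definition nontrivial_circle_prob :: "complex measure \<Rightarrow> bool" where
  "nontrivial_circle_prob \<mu> \<longleftrightarrow>
     prob_space \<mu> \<and> sets \<mu> = sets circle_borel \<and> infinite (circle_support \<mu>)"

text \<open>The inner product of $L^2(\mu)$ (on polynomials), antilinear in the first argument.\<close>

definition poly_inner :: "complex measure \<Rightarrow> complex poly \<Rightarrow> complex poly \<Rightarrow> complex" where
  "poly_inner \<mu> p q = (\<integral>z. cnj (poly p z) * poly q z \<partial>\<mu>)"

definition poly_norm :: "complex measure \<Rightarrow> complex poly \<Rightarrow> real" where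
  "poly_norm \<mu> p = sqrt (Re (poly_inner \<mu> p p))"

text \<open>Gram--Schmidt applied to $1, z, z^2, \dots$; dividing the monic orthogonal polynomial by its
  norm makes the leading coefficient positive.\<close>

fun orthonormal_poly :: "complex measure \<Rightarrow> nat \<Rightarrow> complex poly" where
  "orthonormal_poly \<mu> n =
     (let P = monom 1 n
            - (\<Sum>k<n. smult (poly_inner \<mu> (orthonormal_poly \<mu> k) (monom 1 n)) (orthonormal_poly \<mu> k))
      in smult (complex_of_real (1 / poly_norm \<mu> P)) P)"

declare orthonormal_poly.simps [simp del]

text \<open>The case $z = 0$ is left out because of the term $1/\bar z$; both sides are polynomials in $z$,
  so the recursion for $z \neq 0$ is the polynomial identity.\<close>

definition verblunsky_coefficients :: "complex measure \<Rightarrow> (nat \<Rightarrow> complex) \<Rightarrow> bool" where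
  "verblunsky_coefficients \<mu> \<alpha> \<longleftrightarrow>
     (\<forall>n. norm (\<alpha> n) < 1 \<and>
        (\<forall>z. z \<noteq> 0 \<longrightarrow>
           poly (orthonormal_poly \<mu> (Suc n)) z =
             complex_of_real (1 / sqrt (1 - (norm (\<alpha> n))\<^sup>2)) *
             (z * poly (orthonormal_poly \<mu> n) z
              - cnj (\<alpha> n) * z ^ n * cnj (poly (orthonormal_poly \<mu> n) (1 / cnj z)))))"

definition lebesgue_decomposition ::
    "complex measure \<Rightarrow> (real \<Rightarrow> real) \<Rightarrow> complex measure \<Rightarrow> bool" where
  "lebesgue_decomposition \<mu> w \<mu>s \<longleftrightarrow>
     w \<in> borel_measurable angle_measure \<and> (\<forall>\<theta>\<in>{0..<2 * pi}. 0 \<le> w \<theta>) \<and>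
     sets \<mu>s = sets circle_borel \<and>
     (\<exists>N \<in> sets circle_borel. emeasure circle_lebesgue N = 0 \<and> emeasure \<mu>s (sphere 0 1 - N) = 0) \<and>
     (\<forall>A \<in> sets circle_borel. emeasure \<mu> A =
        emeasure (distr (density angle_measure (\<lambda>\<theta>. ennreal (w \<theta>))) circle_borel cis) A
        + emeasure \<mu>s A)"

text \<open>Logarithm with $\log 0 = -\infty$, to be used for nonnegative arguments.\<close>

definition log_ereal :: "real \<Rightarrow> ereal" where
  "log_ereal x = (if x \<le> 0 then -\<infinity> else ereal (ln x))"

text \<open>Integral of the positive part minus integral of the negative part; \<^const>\<open>e2ennreal\<close> sends
  negative values to 0. Meaningful if one of the two is finite.\<close>

definition ereal_integral :: "'a measure \<Rightarrow> ('a \<Rightarrow> ereal) \<Rightarrow> ereal" where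
  "ereal_integral M f =
     enn2ereal (\<integral>\<^sup>+ x. e2ennreal (f x) \<partial>M) - enn2ereal (\<integral>\<^sup>+ x. e2ennreal (- f x) \<partial>M)"

definition forward_diff :: "(nat \<Rightarrow> complex) \<Rightarrow> nat \<Rightarrow> complex" where
  "forward_diff \<alpha> n = \<alpha> (Suc n) - \<alpha> n"

definition little_l :: "nat \<Rightarrow> (nat \<Rightarrow> complex) set" where
  "little_l p = {a. summable (\<lambda>n. norm (a n) ^ p)}"

end

(*
  Let $\Phi_n$, $\Phi_n^*$ be the monic orthogonal polynomials and their reversals and
  $P(\theta) = (1 - \cos\theta)^m$. Since $\Phi_n^*$ has no zeros in the closed disc,
  $\int P \log|\varphi_N|^2$ is a finite combination of Taylor coefficients of $\log\Phi_N^*$ at 0, and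
  $\log\Phi_N^* = \sum_{n<N} \log(1 - \alpha_n b_n)$, where the coefficients of
  $b_n = z\Phi_n/\Phi_n^*$ are polynomials in shifts of $\alpha$ and its conjugate. For square summable
  variation such a sum depends, up to a bounded error, only on the values of the summands on constant
  sequences; there $1 - \alpha b$ solves $\lambda^2 - (1+z)\lambda + z(1-|a|^2) = 0$, which yields
  $\int P \log|\varphi_N|^2 \frac{d\theta}{2\pi}
     = c \sum_{n<N} \bigl(-\log(1-|\alpha_n|^2) - \sum_{k\le m} |\alpha_n|^{2k}/k\bigr) + O(1)$ with $c > 0$.
  The right-hand side is bounded in $N$ iff $\alpha \in \ell^{2m+2}$.

  It remains to see that it is bounded iff $\int P \log w > -\infty$. If the integral is finite, use
  $\log(w|\varphi_N|^2) \le w|\varphi_N|^2$ and $\int|\varphi_N|^2 d\mu = 1$. Conversely, the measures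
  $d\theta/(2\pi|\varphi_N|^2)$ have the same moments up to order $N$ as $\mu$, so that
  $\int P \log f \le 2^m \int f d\mu + C$ for $f = |q|^2$ with a polynomial $q$, hence for continuous
  positive $f$, hence for bounded measurable $f$; take $f$ close to $\max(1, 1/w)$ off a set
  supporting $\mu_s$, and $f = 1$ on that set.
*)

theory Submission
  imports Defs "HOL-Complex_Analysis.Complex_Analysis"
begin

unbundle no vec_syntax

section \<open>Shift-invariant polynomials in a sequence of square summable variation\<close>

text \<open>As the variation is only square summable, terms of first order in the differences need
  not be summable: they have to telescope. They do so for the real part of \<alpha>_n
  conj(\<alpha>_(n-x)), but in general not for its imaginary part. Hence the insistence on real
  coefficients, on equally many factors \<alpha> and conj(\<alpha>) in every monomial, and on real
  parts.

  The truncation of -log(1 - |a|^2) at order m comes from an exact cancellation: the Fourier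
  coefficients of the weight are summed against Taylor coefficients of an inverse square root, and a
  binomial identity collapses the double sum. The remainder starts at |a|^(2m+2) and is nonnegative,
  so an upper bound on its partial sums is already summability.

  In the converse no limit of measures is taken: each polynomial q is tested against the one
  approximation with N = deg q, where the moments agree exactly. The square root of the test
  function is what gets approximated, by a real trigonometric polynomial g; then g^2 = |q|^2 on the
  circle with q = z^n g, and no factorization of nonnegative trigonometric polynomials is
  required.\<close>

definition shift_monomial :: "(nat \<Rightarrow> complex) \<Rightarrow> nat \<Rightarrow> nat list \<Rightarrow> nat list \<Rightarrow> complex" where
  "shift_monomial \<alpha> n xs ys = prod_list (map (\<lambda>x. \<alpha> (n - x)) xs) * prod_list (map (\<lambda>y. cnj (\<alpha> (n - y))) ys)"

definition eval_shift :: "(real \<times> nat list \<times> nat list) list \<Rightarrow> (nat \<Rightarrow> complex) \<Rightarrow> nat \<Rightarrow> complex" where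
  "eval_shift L \<alpha> n = (\<Sum>(c, xs, ys)\<leftarrow>L. of_real c * shift_monomial \<alpha> n xs ys)"

text \<open>The equation is only required from some index on, so that the truncation in \<^term>\<open>n - x\<close> is
  harmless; \<^term>\<open>n0\<close> and the coefficients do not depend on the sequence, which allows to read
  off the latter from constant sequences. The integer \<^term>\<open>d\<close> is the charge under
  $\alpha \mapsto \lambda\alpha$, $|\lambda| = 1$.\<close>

definition shift_poly :: "int \<Rightarrow> ((nat \<Rightarrow> complex) \<Rightarrow> nat \<Rightarrow> complex) \<Rightarrow> bool" where
  "shift_poly d S \<longleftrightarrow> (\<exists>L n0. (\<forall>c xs ys. (c, xs, ys) \<in> set L \<longrightarrow> int (length xs) - int (length ys) = d) \<and>
     (\<forall>\<alpha> n. n \<ge> n0 \<longrightarrow> S \<alpha> n = eval_shift L \<alpha> n))"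

lemma shift_polyI:
  assumes "\<And>c xs ys. (c, xs, ys) \<in> set L \<Longrightarrow> int (length xs) - int (length ys) = d"
    and "\<And>\<alpha> n. n \<ge> n0 \<Longrightarrow> S \<alpha> n = eval_shift L \<alpha> n"
  shows "shift_poly d S"
  unfolding shift_poly_def using assms by blast

lemma shift_poly_const: "shift_poly 0 (\<lambda>_ _. of_real c)"
  by (rule shift_polyI[of "[(c, [], [])]" _ 0]) (auto simp: eval_shift_def shift_monomial_def)

lemma shift_poly_zero: "shift_poly d (\<lambda>_ _. 0)"
  by (rule shift_polyI[of "[]" _ 0]) (auto simp: eval_shift_def)

lemma shift_poly_var: "shift_poly 1 (\<lambda>\<alpha> n. \<alpha> n)"
  by (rule shift_polyI[of "[(1, [0], [])]" _ 0]) (auto simp: eval_shift_def shift_monomial_def)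

lemma shift_poly_cnj_var: "shift_poly (-1) (\<lambda>\<alpha> n. cnj (\<alpha> n))"
  by (rule shift_polyI[of "[(1, [], [0])]" _ 0]) (auto simp: eval_shift_def shift_monomial_def)

lemma shift_poly_add:
  assumes "shift_poly d S" "shift_poly d T"
  shows "shift_poly d (\<lambda>\<alpha> n. S \<alpha> n + T \<alpha> n)"
proof -
  obtain L n0 where L': "\<forall>c xs ys. (c, xs, ys) \<in> set L \<longrightarrow> int (length xs) - int (length ys) = d"
     "\<forall>\<alpha> n. n \<ge> n0 \<longrightarrow> S \<alpha> n = eval_shift L \<alpha> n" using assms(1) unfolding shift_poly_def by blast
  note L = L'[rule_format]
  obtain K m0 where K': "\<forall>c xs ys. (c, xs, ys) \<in> set K \<longrightarrow> int (length xs) - int (length ys) = d"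
     "\<forall>\<alpha> n. n \<ge> m0 \<longrightarrow> T \<alpha> n = eval_shift K \<alpha> n" using assms(2) unfolding shift_poly_def by blast
  note K = K'[rule_format]
  show ?thesis
    by (rule shift_polyI[of "L @ K" _ "max n0 m0"]) (auto simp: L K eval_shift_def)
qed

lemma eval_shift_mult:
  "eval_shift [(c * c', xs @ xs', ys @ ys'). (c, xs, ys) \<leftarrow> L, (c', xs', ys') \<leftarrow> K] \<alpha> n = eval_shift L \<alpha> n * eval_shift K \<alpha> n"
proof (induction L)
  case Nil
  then show ?case by (simp add: eval_shift_def)
next
  case (Cons t L)
  obtain c xs ys where t: "t = (c, xs, ys)" by (cases t)
  have "eval_shift (map (\<lambda>(c', xs', ys'). (c * c', xs @ xs', ys @ ys')) K) \<alpha> n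
      = of_real c * shift_monomial \<alpha> n xs ys * eval_shift K \<alpha> n"
    by (induction K) (auto simp: eval_shift_def shift_monomial_def algebra_simps)
  with Cons show ?case
    by (simp add: t eval_shift_def algebra_simps)
qed

lemma shift_poly_mult:
  assumes "shift_poly d S" "shift_poly e T"
  shows "shift_poly (d + e) (\<lambda>\<alpha> n. S \<alpha> n * T \<alpha> n)"
proof -
  obtain L n0 where L': "\<forall>c xs ys. (c, xs, ys) \<in> set L \<longrightarrow> int (length xs) - int (length ys) = d"
     "\<forall>\<alpha> n. n \<ge> n0 \<longrightarrow> S \<alpha> n = eval_shift L \<alpha> n" using assms(1) unfolding shift_poly_def by blast
  note L = L'[rule_format]
  obtain K m0 where K': "\<forall>c xs ys. (c, xs, ys) \<in> set K \<longrightarrow> int (length xs) - int (length ys) = e"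
     "\<forall>\<alpha> n. n \<ge> m0 \<longrightarrow> T \<alpha> n = eval_shift K \<alpha> n" using assms(2) unfolding shift_poly_def by blast
  note K = K'[rule_format]
  show ?thesis
  proof (rule shift_polyI[of "[(c * c', xs @ xs', ys @ ys'). (c, xs, ys) \<leftarrow> L, (c', xs', ys') \<leftarrow> K]" _ "max n0 m0"])
    fix c xs ys assume "(c, xs, ys) \<in> set [(c * c', xs @ xs', ys @ ys'). (c, xs, ys) \<leftarrow> L, (c', xs', ys') \<leftarrow> K]"
    then obtain c1 xs1 ys1 c2 xs2 ys2 where "(c1, xs1, ys1) \<in> set L" "(c2, xs2, ys2) \<in> set K"
      "xs = xs1 @ xs2" "ys = ys1 @ ys2" by auto
    with L(1)[of c1 xs1 ys1] K(1)[of c2 xs2 ys2]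
    show "int (length xs) - int (length ys) = d + e" by auto
  next
    fix \<alpha> n assume "max n0 m0 \<le> n"
    then have "S \<alpha> n = eval_shift L \<alpha> n" "T \<alpha> n = eval_shift K \<alpha> n" using L(2) K(2) by auto
    then show "S \<alpha> n * T \<alpha> n = eval_shift [(c * c', xs @ xs', ys @ ys'). (c, xs, ys) \<leftarrow> L, (c', xs', ys') \<leftarrow> K] \<alpha> n"
      by (simp only: eval_shift_mult)
  qed
qed

lemma shift_poly_sum:
  assumes "finite I" "\<And>i. i \<in> I \<Longrightarrow> shift_poly d (S i)"
  shows "shift_poly d (\<lambda>\<alpha> n. \<Sum>i\<in>I. S i \<alpha> n)"
  using assms by (induction I rule: finite_induct) (auto intro: shift_poly_add shift_poly_zero)

lemma shift_poly_scale:
  assumes "shift_poly d S"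
  shows "shift_poly d (\<lambda>\<alpha> n. of_real c * S \<alpha> n)"
  using shift_poly_mult[OF shift_poly_const assms] by simp

text \<open>This is how a recursion from n to n + 1 enters. The value of \<open>T\<close> at 0 is
  unconstrained, so the threshold moves to \<open>Suc n0\<close>.\<close>

lemma shift_poly_shift:
  assumes "shift_poly d S" "\<And>\<alpha> n. T \<alpha> (Suc n) = S \<alpha> n"
  shows "shift_poly d T"
proof -
  obtain L n0 where L': "\<forall>c xs ys. (c, xs, ys) \<in> set L \<longrightarrow> int (length xs) - int (length ys) = d"
     "\<forall>\<alpha> n. n \<ge> n0 \<longrightarrow> S \<alpha> n = eval_shift L \<alpha> n" using assms(1) unfolding shift_poly_def by blast
  note L = L'[rule_format]
  show ?thesis
  proof (rule shift_polyI[of "map (\<lambda>(c, xs, ys). (c, map Suc xs, map Suc ys)) L" _ "Suc n0"])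
    fix \<alpha> n assume "Suc n0 \<le> n"
    then obtain k where k: "n = Suc k" "n0 \<le> k" by (cases n) auto
    show "T \<alpha> n = eval_shift (map (\<lambda>(c, xs, ys). (c, map Suc xs, map Suc ys)) L) \<alpha> n"
      unfolding k(1) assms(2) L(2)[OF k(2)]
      by (induction L) (auto simp: eval_shift_def shift_monomial_def o_def)
  next
    fix c xs ys assume "(c, xs, ys) \<in> set (map (\<lambda>(c, xs, ys). (c, map Suc xs, map Suc ys)) L)"
    then show "int (length xs) - int (length ys) = d" using L(1) by auto
  qed
qed

section \<open>First-order expansion and telescoping of sums of shift monomials\<close>

definition diag_poly :: "(real \<times> nat list \<times> nat list) list \<Rightarrow> real \<Rightarrow> real" where
  "diag_poly L x = (\<Sum>(c, xs, ys)\<leftarrow>L. c * x ^ length xs)"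

text \<open>Splitting off a factor p leaves p times the old error, at most r^2 d^2, and the cross
  term of p - s with the linear part, at most r d^2. Together this is at most (r + 1)^2 d^2.\<close>

lemma prod_list_first_order:
  fixes ps :: "complex list" and s :: real
  assumes "\<And>p. p \<in> set ps \<Longrightarrow> norm p \<le> 1" "\<And>p. p \<in> set ps \<Longrightarrow> norm (p - of_real s) \<le> d" "0 \<le> s" "s \<le> 1" 
  shows "norm (prod_list ps - of_real s ^ length ps - of_real s ^ (length ps - 1) * (\<Sum>p\<leftarrow>ps. p - of_real s))
     \<le> real (length ps) ^ 2 * d\<^sup>2"
  using assms(1,2)
proof (induction ps)
  case Nil
  then show ?case by simp
next
  case (Cons p ps)
  let ?r = "length ps" and ?s = "of_real s :: complex"
  let ?\<Sigma> = "\<Sum>p\<leftarrow>ps. p - ?s"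
  let ?e = "prod_list ps - ?s ^ ?r - ?s ^ (?r - 1) * ?\<Sigma>"
  have d: "d \<ge> 0" using order_trans[OF norm_ge_zero Cons.prems(2)[of p]] by simp
  have IH: "norm ?e \<le> real ?r ^ 2 * d\<^sup>2" using Cons by auto
  have sg: "norm ?\<Sigma> \<le> real ?r * d"
    using Cons.prems(2)
  proof (induction ps)
    case (Cons q ps)
    have "norm ((q - ?s) + (\<Sum>p\<leftarrow>ps. p - ?s)) \<le> norm (q - ?s) + norm (\<Sum>p\<leftarrow>ps. p - ?s)"
      by (rule norm_triangle_ineq)
    also have "\<dots> \<le> d + real (length ps) * d" using Cons by (intro add_mono) auto
    finally show ?case by (simp add: algebra_simps)
  qed simp
  have spow: "norm (?s ^ k) \<le> 1" for k
    using assms(3,4) by (simp add: norm_power power_le_one)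
  \<comment> \<open>The empty list needs its own case: \<open>?r - 1\<close> truncates to 0 there,
    and the sum of deviations is 0.\<close>
  have eq: "prod_list (p # ps) - ?s ^ length (p # ps) - ?s ^ (length (p # ps) - 1) * (\<Sum>p\<leftarrow>p # ps. p - ?s)
    = (p - ?s) * (?s ^ (?r - 1) * ?\<Sigma>) + p * ?e"
    by (cases ps) (simp_all add: algebra_simps)
  have "norm ((p - ?s) * (?s ^ (?r - 1) * ?\<Sigma>)) \<le> d * (1 * (real ?r * d))"
    unfolding norm_mult using Cons.prems sg spow d by (intro mult_mono) auto
  moreover have "norm (p * ?e) \<le> 1 * (real ?r ^ 2 * d\<^sup>2)"
    unfolding norm_mult using Cons.prems(1) IH by (intro mult_mono) auto
  ultimately have "norm ((p - ?s) * (?s ^ (?r - 1) * ?\<Sigma>) + p * ?e) \<le> real ?r * d\<^sup>2 + real ?r ^ 2 * d\<^sup>2"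
    by (intro norm_triangle_mono) (auto simp: power2_eq_square algebra_simps)
  also have "\<dots> \<le> real (length (p # ps)) ^ 2 * d\<^sup>2"
  proof -
    have "real ?r * d\<^sup>2 + real ?r ^ 2 * d\<^sup>2 = (real ?r + real ?r ^ 2) * d\<^sup>2" by (simp add: algebra_simps)
    also have "\<dots> \<le> (real (length (p # ps)) ^ 2) * d\<^sup>2"
      by (intro mult_right_mono) (auto simp: power2_eq_square algebra_simps)
    finally show ?thesis .
  qed
  finally show ?case unfolding eq .
qed

lemma power_first_order:
  fixes s t :: real
  assumes "0 \<le> s" "s \<le> 1" "0 \<le> t" "t \<le> 1"
  shows "\<bar>t ^ r - s ^ r - real r * s ^ (r - 1) * (t - s)\<bar> \<le> real r ^ 2 * (t - s)\<^sup>2"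
proof -
  have "norm (of_real t - of_real s :: complex) = \<bar>t - s\<bar>"
    by (metis norm_of_real of_real_diff)
  moreover have "norm (prod_list (replicate r (of_real t :: complex)) - of_real s ^ r
      - of_real s ^ (r - 1) * (\<Sum>p\<leftarrow>replicate r (of_real t :: complex). p - of_real s))
     \<le> real r ^ 2 * \<bar>t - s\<bar>\<^sup>2"
    using prod_list_first_order[of "replicate r (of_real t)" s "\<bar>t - s\<bar>"] assms calculation
    by (simp split: if_splits)
  moreover have "prod_list (replicate r (of_real t :: complex)) - of_real s ^ r
      - of_real s ^ (r - 1) * (\<Sum>p\<leftarrow>replicate r (of_real t :: complex). p - of_real s)
      = of_real (t ^ r - s ^ r - real r * s ^ (r - 1) * (t - s))"
    by (simp add: sum_list_replicate)
  ultimately show ?thesis by (metis norm_of_real power2_abs)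
qed

text \<open>A shift by x consists of x unit shifts, each of which telescopes to a difference of two
  values in [0, 1]. Truncated subtraction makes the term n = 0 of a unit shift vanish.\<close>

lemma shift_telescope_bounded:
  fixes f :: "nat \<Rightarrow> real"
  assumes "\<And>n. 0 \<le> f n" "\<And>n. f n \<le> 1"
  shows "\<bar>\<Sum>n<N. f (n - x) - f n\<bar> \<le> real x"
proof (induction x)
  case (Suc x)
  define g where "g n = f (n - x)" for n
  have g: "0 \<le> g n" "g n \<le> 1" for n using assms by (auto simp: g_def)
  have "(\<Sum>n<N. g (n - 1) - g n) = g 0 - g (N - 1)"
    by (induction N) (auto)
  then have "\<bar>\<Sum>n<N. g (n - 1) - g n\<bar> \<le> 1"
    using g[of 0] g[of "N - 1"] by auto
  moreover have "(\<Sum>n<N. f (n - Suc x) - f n) = (\<Sum>n<N. g (n - 1) - g n) + (\<Sum>n<N. f (n - x) - f n)"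
    by (simp add: sum.distrib[symmetric] g_def)
  ultimately show ?case using Suc by auto
qed simp

lemma summable_shift_diff:
  fixes \<alpha> :: "nat \<Rightarrow> complex"
  assumes "summable (\<lambda>n. (norm (\<alpha> (Suc n) - \<alpha> n))\<^sup>2)"
  shows "summable (\<lambda>n. (norm (\<alpha> (n - x) - \<alpha> n))\<^sup>2)"
proof (induction x)
  case (Suc x)
  have "summable (\<lambda>n. (norm (\<alpha> (n - Suc x) - \<alpha> (n - x)))\<^sup>2)"
  proof (rule summable_iff_shift[of _ "Suc x", THEN iffD1])
    show "summable (\<lambda>n. (norm (\<alpha> (n + Suc x - Suc x) - \<alpha> (n + Suc x - x)))\<^sup>2)"
      using assms by (simp add: norm_minus_commute)
  qed
  then have "summable (\<lambda>n. 2 * (norm (\<alpha> (n - Suc x) - \<alpha> (n - x)))\<^sup>2 + 2 * (norm (\<alpha> (n - x) - \<alpha> n))\<^sup>2)"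
    by (intro summable_add summable_mult Suc)
  then show ?case
  proof (rule summable_comparison_test'[where N = 0])
    fix n
    have *: "(a + b)\<^sup>2 \<le> 2 * a\<^sup>2 + 2 * b\<^sup>2" for a b :: real
      using sum_squares_bound[of a b] by (simp add: power2_sum)
    have "norm (\<alpha> (n - Suc x) - \<alpha> n) \<le> norm (\<alpha> (n - Suc x) - \<alpha> (n - x)) + norm (\<alpha> (n - x) - \<alpha> n)"
      using norm_triangle_ineq[of "\<alpha> (n - Suc x) - \<alpha> (n - x)" "\<alpha> (n - x) - \<alpha> n"] by simp
    then have "(norm (\<alpha> (n - Suc x) - \<alpha> n))\<^sup>2 \<le> (norm (\<alpha> (n - Suc x) - \<alpha> (n - x)) + norm (\<alpha> (n - x) - \<alpha> n))\<^sup>2"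
      by (intro power_mono) auto
    also note *
    finally show "norm ((norm (\<alpha> (n - Suc x) - \<alpha> n))\<^sup>2) \<le> 2 * (norm (\<alpha> (n - Suc x) - \<alpha> (n - x)))\<^sup>2 + 2 * (norm (\<alpha> (n - x) - \<alpha> n))\<^sup>2"
      by simp
  qed
qed simp


lemma shift_linear_term_bounded:
  fixes s :: "nat \<Rightarrow> real"
  assumes s: "\<And>n. 0 \<le> s n" "\<And>n. s n \<le> 1" and r: "r > 0"
    and sm: "summable (\<lambda>n. (s (n - x) - s n)\<^sup>2)"
  shows "\<exists>C. \<forall>N. \<bar>\<Sum>n<N. s n ^ (r - 1) * (s (n - x) - s n)\<bar> \<le> C"
proof (intro exI allI)
  fix N
  let ?e = "\<lambda>n. s (n - x) ^ r - s n ^ r - real r * s n ^ (r - 1) * (s (n - x) - s n)"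
  have "\<bar>\<Sum>n<N. ?e n\<bar> \<le> (\<Sum>n<N. real r ^ 2 * (s (n - x) - s n)\<^sup>2)"
    by (rule order_trans[OF sum_abs]) (intro sum_mono power_first_order s)
  also have "\<dots> \<le> (\<Sum>n. real r ^ 2 * (s (n - x) - s n)\<^sup>2)"
    by (intro sum_le_suminf summable_mult sm) auto
  finally have 1: "\<bar>\<Sum>n<N. ?e n\<bar> \<le> (\<Sum>n. real r ^ 2 * (s (n - x) - s n)\<^sup>2)" .
  have 2: "\<bar>\<Sum>n<N. s (n - x) ^ r - s n ^ r\<bar> \<le> real x"
    by (rule shift_telescope_bounded) (use s in \<open>auto simp: power_le_one\<close>)
  have "real r * (\<Sum>n<N. s n ^ (r - 1) * (s (n - x) - s n)) = (\<Sum>n<N. s (n - x) ^ r - s n ^ r) - (\<Sum>n<N. ?e n)"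
    unfolding sum_distrib_left sum_subtractf[symmetric] by (intro sum.cong) (auto simp: mult.assoc)
  with 1 2 have "real r * \<bar>\<Sum>n<N. s n ^ (r - 1) * (s (n - x) - s n)\<bar> \<le> real x + (\<Sum>n. real r ^ 2 * (s (n - x) - s n)\<^sup>2)"
    by (simp add: abs_mult[of "real r", simplified, symmetric])
  then show "\<bar>\<Sum>n<N. s n ^ (r - 1) * (s (n - x) - s n)\<bar> \<le> (real x + (\<Sum>n. real r ^ 2 * (s (n - x) - s n)\<^sup>2)) / real r"
    using r by (simp add: pos_le_divide_eq mult.commute)
qed

lemma Re_mult_cnj: "Re (u * cnj v) = ((norm u)\<^sup>2 + (norm v)\<^sup>2 - (norm (u - v))\<^sup>2) / 2"
  unfolding cmod_power2 by (simp add: power2_eq_square algebra_simps)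

lemma shift_monomial_zip:
  "length xs = length ys \<Longrightarrow>
    shift_monomial \<alpha> n xs ys = prod_list (map (\<lambda>(x, y). \<alpha> (n - x) * cnj (\<alpha> (n - y))) (zip xs ys))"
  unfolding shift_monomial_def by (induction xs ys rule: list_induct2) (auto simp: algebra_simps)

lemma bounded_sums_add:
  fixes f g :: "nat \<Rightarrow> real"
  assumes "\<exists>C. \<forall>N. \<bar>\<Sum>n<N. f n\<bar> \<le> C" "\<exists>C. \<forall>N. \<bar>\<Sum>n<N. g n\<bar> \<le> C"
  shows "\<exists>C. \<forall>N. \<bar>\<Sum>n<N. f n + g n\<bar> \<le> C"
proof -
  obtain C D where "\<And>N. \<bar>\<Sum>n<N. f n\<bar> \<le> C" "\<And>N. \<bar>\<Sum>n<N. g n\<bar> \<le> D" using assms by metis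
  then show ?thesis
    by (intro exI[of _ "C + D"] allI) (simp add: sum.distrib abs_triangle_ineq[THEN order_trans] add_mono)
qed

lemma bounded_sums_scale:
  fixes f :: "nat \<Rightarrow> real"
  assumes "\<exists>C. \<forall>N. \<bar>\<Sum>n<N. f n\<bar> \<le> C"
  shows "\<exists>C. \<forall>N. \<bar>\<Sum>n<N. c * f n\<bar> \<le> C"
proof -
  obtain C where "\<And>N. \<bar>\<Sum>n<N. f n\<bar> \<le> C" using assms by metis
  then show ?thesis
    by (intro exI[of _ "\<bar>c\<bar> * C"] allI) (simp add: sum_distrib_left[symmetric] abs_mult mult_left_mono)
qed

lemma bounded_sums_summable:
  fixes f g :: "nat \<Rightarrow> real"
  assumes "\<And>n. \<bar>f n\<bar> \<le> g n" "summable g"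
  shows "\<exists>C. \<forall>N. \<bar>\<Sum>n<N. f n\<bar> \<le> C"
proof (intro exI allI)
  fix N
  have "\<bar>\<Sum>n<N. f n\<bar> \<le> (\<Sum>n<N. g n)" by (rule order_trans[OF sum_abs]) (intro sum_mono assms)
  also have "\<dots> \<le> suminf g" 
    using assms by (intro sum_le_suminf) (auto intro: order_trans[OF abs_ge_zero])
  finally show "\<bar>\<Sum>n<N. f n\<bar> \<le> suminf g" .
qed

text \<open>Pair each $\alpha_{n-x}$ with some $\bar\alpha_{n-y}$. As
  $2\,\mathrm{Re}(u \bar v) = |u|^2 + |v|^2 - |u - v|^2$, the terms of first order in the differences
  are of the form $s_n^{r-1} (s_{n-x} - s_n)$ with $s_n = |\alpha_n|^2$; up to second order these are
  differences of $s^r / r$, which telescope.\<close>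

lemma shift_monomial_sums:
  fixes \<alpha> :: "nat \<Rightarrow> complex"
  assumes \<alpha>: "\<And>n. norm (\<alpha> n) \<le> 1" and sm: "summable (\<lambda>n. (norm (\<alpha> (Suc n) - \<alpha> n))\<^sup>2)"
    and len: "length xs = length ys"
  shows "\<exists>C. \<forall>N. \<bar>\<Sum>n<N. Re (shift_monomial \<alpha> n xs ys) - (norm (\<alpha> n))\<^sup>2 ^ length xs\<bar> \<le> C"
proof (cases "xs = []")
  case True
  with len show ?thesis by (auto simp: shift_monomial_def)
next
  case False
  define r where "r = length xs"
  have r: "r > 0" using False by (simp add: r_def)
  define s where "s n = (norm (\<alpha> n))\<^sup>2" for n
  \<comment> \<open>One summable quantity dominating all squared differences in the monomial; every
    second-order error below is bounded by a multiple of it.\<close>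
  define D where "D n = (\<Sum>x\<in>set xs \<union> set ys. (norm (\<alpha> (n - x) - \<alpha> n))\<^sup>2)" for n
  have s01: "0 \<le> s n" "s n \<le> 1" for n using \<alpha> by (auto simp: s_def power_le_one)
  have smD: "summable D" unfolding D_def by (intro summable_sum summable_shift_diff sm)
  have D0: "D n \<ge> 0" for n unfolding D_def by (intro sum_nonneg) auto
  have D_ge: "(norm (\<alpha> (n - x) - \<alpha> n))\<^sup>2 \<le> D n" if "x \<in> set xs \<union> set ys" for x n
    unfolding D_def by (rule member_le_sum) (use that in auto)
  have D_ge': "norm (\<alpha> (n - x) - \<alpha> n) \<le> sqrt (D n)" if "x \<in> set xs \<union> set ys" for x n
    using D_ge[OF that] real_le_rsqrt by blast
  define l where "l x n = s n ^ (r - 1) * (s (n - x) - s n)" for x n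
  have s_diff: "\<bar>s (n - x) - s n\<bar> \<le> 2 * norm (\<alpha> (n - x) - \<alpha> n)" for n x
  proof -
    have "\<bar>s (n - x) - s n\<bar> = \<bar>norm (\<alpha> (n - x)) - norm (\<alpha> n)\<bar> * (norm (\<alpha> (n - x)) + norm (\<alpha> n))"
      by (simp add: s_def power2_eq_square square_diff_square_factored abs_mult mult.commute)
    also have "\<dots> \<le> norm (\<alpha> (n - x) - \<alpha> n) * 2"
      using \<alpha>[of n] \<alpha>[of "n - x"] norm_triangle_ineq3[of "\<alpha> (n - x)" "\<alpha> n"] by (intro mult_mono) auto
    finally show ?thesis by simp
  qed
  have l_bd: "\<exists>C. \<forall>N. \<bar>\<Sum>n<N. l x n\<bar> \<le> C" for x
    unfolding l_def
  proof (rule shift_linear_term_bounded[OF s01 r])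
    have "summable (\<lambda>n. 4 * (norm (\<alpha> (n - x) - \<alpha> n))\<^sup>2)"
      by (intro summable_mult summable_shift_diff sm)
    then show "summable (\<lambda>n. (s (n - x) - s n)\<^sup>2)"
    proof (rule summable_comparison_test'[where N = 0])
      fix n
      have "(s (n - x) - s n)\<^sup>2 \<le> (2 * norm (\<alpha> (n - x) - \<alpha> n))\<^sup>2"
        by (rule abs_le_square_iff[THEN iffD1]) (use s_diff in auto)
      then show "norm ((s (n - x) - s n)\<^sup>2) \<le> 4 * (norm (\<alpha> (n - x) - \<alpha> n))\<^sup>2"
        by (simp add: power_mult_distrib)
    qed
  qed
  define Z where "Z = zip xs ys"
  define p where "p n = (\<lambda>(x, y). \<alpha> (n - x) * cnj (\<alpha> (n - y)))" for n
  have lenZ: "length Z = r" using len by (simp add: Z_def r_def)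
  have Zin: "x \<in> set xs \<union> set ys" "y \<in> set xs \<union> set ys" if "(x, y) \<in> set Z" for x y
    using that by (auto simp: Z_def dest: set_zip_leftD set_zip_rightD)
  define lin where "lin n = (\<Sum>(x, y)\<leftarrow>Z. (l x n + l y n) / 2)" for n
  define rest where "rest n = (\<Sum>(x, y)\<leftarrow>Z. s n ^ (r - 1) * ((norm (\<alpha> (n - x) - \<alpha> (n - y)))\<^sup>2 / 2))" for n
  \<comment> \<open>Each paired factor is moved to index n in two moves, one for \<alpha> and one
    for its conjugate, at a cost of \<open>sqrt (D n)\<close> each. This explains the deviation
    \<open>2 * sqrt (D n)\<close>.\<close>
  have err: "\<bar>Re (shift_monomial \<alpha> n xs ys) - s n ^ r - (lin n - rest n)\<bar> \<le> real r ^ 2 * (4 * D n)" for n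
  proof -
    have "norm (prod_list (map (p n) Z) - of_real (s n) ^ length (map (p n) Z)
       - of_real (s n) ^ (length (map (p n) Z) - 1) * (\<Sum>q\<leftarrow>map (p n) Z. q - of_real (s n)))
       \<le> real (length (map (p n) Z)) ^ 2 * (2 * sqrt (D n))\<^sup>2"
    proof (rule prod_list_first_order)
      fix q assume "q \<in> set (map (p n) Z)"
      then obtain x y where xy: "(x, y) \<in> set Z" "q = \<alpha> (n - x) * cnj (\<alpha> (n - y))"
        by (auto simp: p_def)
      show "norm q \<le> 1" unfolding xy norm_mult using \<alpha> by (auto intro: mult_le_one)
      have "q - of_real (s n) = \<alpha> (n - x) * cnj (\<alpha> (n - y) - \<alpha> n) + (\<alpha> (n - x) - \<alpha> n) * cnj (\<alpha> n)"
        unfolding xy s_def by (simp add: algebra_simps complex_norm_square of_real_power[symmetric] del: of_real_power)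
      also have "norm \<dots> \<le> 1 * sqrt (D n) + sqrt (D n) * 1"
      proof (rule norm_triangle_mono)
        show "norm (\<alpha> (n - x) * cnj (\<alpha> (n - y) - \<alpha> n)) \<le> 1 * sqrt (D n)"
          unfolding norm_mult complex_mod_cnj using \<alpha> D_ge'[OF Zin(2)[OF xy(1)]] by (intro mult_mono) auto
        show "norm ((\<alpha> (n - x) - \<alpha> n) * cnj (\<alpha> n)) \<le> sqrt (D n) * 1"
          unfolding norm_mult complex_mod_cnj using \<alpha> D_ge'[OF Zin(1)[OF xy(1)]] D0 by (intro mult_mono) auto
      qed
      finally show "norm (q - of_real (s n)) \<le> 2 * sqrt (D n)" by simp
    qed (use s01 in auto)
    moreover have "prod_list (map (p n) Z) = shift_monomial \<alpha> n xs ys"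
      using shift_monomial_zip[OF len] by (simp add: Z_def p_def)
    moreover have "(2 * sqrt (D n))\<^sup>2 = 4 * D n" using D0 by (simp add: power_mult_distrib)
    ultimately have "norm (shift_monomial \<alpha> n xs ys - of_real (s n) ^ r
       - of_real (s n) ^ (r - 1) * (\<Sum>q\<leftarrow>map (p n) Z. q - of_real (s n))) \<le> real r ^ 2 * (4 * D n)"
      by (simp add: lenZ)
    from order_trans[OF abs_Re_le_cmod this]
    have "\<bar>Re (shift_monomial \<alpha> n xs ys) - s n ^ r
       - s n ^ (r - 1) * Re (\<Sum>q\<leftarrow>map (p n) Z. q - of_real (s n))\<bar> \<le> real r ^ 2 * (4 * D n)"
      by (simp add: of_real_power[symmetric] del: of_real_power)
    moreover have "s n ^ (r - 1) * Re (\<Sum>q\<leftarrow>map (p n) Z. q - of_real (s n)) = lin n - rest n"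
      unfolding lin_def rest_def
    proof (induction Z)
      case (Cons z Z)
      obtain x y where z: "z = (x, y)" by (cases z)
      have "s n ^ (r - 1) * Re (p n z - of_real (s n)) = (l x n + l y n) / 2 - s n ^ (r - 1) * ((norm (\<alpha> (n - x) - \<alpha> (n - y)))\<^sup>2 / 2)"
        by (simp add: z p_def Re_mult_cnj l_def s_def field_simps del: times_complex.sel)
      with Cons show ?case
        by (simp only: list.map sum_list.Cons plus_complex.sel distrib_left z prod.case)
    qed simp
    ultimately show ?thesis by simp
  qed
  have rest_bd: "\<bar>rest n\<bar> \<le> real r * (2 * D n)" for n
  proof -
    have "\<bar>rest n\<bar> \<le> (\<Sum>z\<leftarrow>Z. 2 * D n)"
      unfolding rest_def
    proof (rule order_trans[OF sum_list_abs], unfold map_map, rule sum_list_mono)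
      fix z assume "z \<in> set Z"
      then obtain x y where z: "z = (x, y)" "(x, y) \<in> set Z" by (metis surj_pair)
      have "norm (\<alpha> (n - x) - \<alpha> (n - y)) \<le> norm (\<alpha> (n - x) - \<alpha> n) + norm (\<alpha> (n - y) - \<alpha> n)"
        using norm_triangle_ineq4[of "\<alpha> (n - x) - \<alpha> n" "\<alpha> (n - y) - \<alpha> n"] by simp
      also have "\<dots> \<le> 2 * sqrt (D n)" using D_ge'[of x n] D_ge'[of y n] Zin[OF z(2)] by simp
      finally have "(norm (\<alpha> (n - x) - \<alpha> (n - y)))\<^sup>2 \<le> (2 * sqrt (D n))\<^sup>2" by (intro power_mono) auto
      also have "\<dots> = 4 * D n" using D0 by (simp add: power_mult_distrib)
      finally have "s n ^ (r - 1) * ((norm (\<alpha> (n - x) - \<alpha> (n - y)))\<^sup>2 / 2) \<le> 1 * (2 * D n)"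
        using s01 D0[of n] by (intro mult_mono) (auto simp: power_le_one)
      then show "(abs \<circ> (\<lambda>(x, y). s n ^ (r - 1) * ((norm (\<alpha> (n - x) - \<alpha> (n - y)))\<^sup>2 / 2))) z \<le> 2 * D n"
        using s01 by (simp add: z)
    qed
    also have "\<dots> = real r * (2 * D n)" by (simp add: sum_list_triv lenZ)
    finally show ?thesis .
  qed
  have lin_bd: "\<exists>C. \<forall>N. \<bar>\<Sum>n<N. lin n\<bar> \<le> C"
    unfolding lin_def
  proof (induction Z)
    case (Cons z Z)
    obtain x y where z: "z = (x, y)" by (cases z)
    have "\<exists>C. \<forall>N. \<bar>\<Sum>n<N. (1/2) * (l x n + l y n)\<bar> \<le> C"
      by (intro bounded_sums_scale bounded_sums_add l_bd)
    from bounded_sums_add[OF this Cons] show ?case by (simp add: z)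
  qed (auto intro: exI[of _ 0])
  have "\<exists>C. \<forall>N. \<bar>\<Sum>n<N. Re (shift_monomial \<alpha> n xs ys) - s n ^ r - lin n\<bar> \<le> C"
  proof (rule bounded_sums_summable)
    show "\<bar>Re (shift_monomial \<alpha> n xs ys) - s n ^ r - lin n\<bar> \<le> (real r ^ 2 * 4 + real r * 2) * D n" for n
      using err[of n] rest_bd[of n] by (simp add: algebra_simps)
    show "summable (\<lambda>n. (real r ^ 2 * 4 + real r * 2) * D n)" by (intro summable_mult smD)
  qed
  from bounded_sums_add[OF this lin_bd] show ?thesis by (simp add: s_def r_def)
qed

text \<open>The same \<open>L\<close> serves both conclusions, so values on constant sequences
  determine the sums for every \<alpha> of square summable variation up to a bounded error. Charge 0
  makes every monomial balanced, hence comparable with a power of |\<alpha>_n|^2; the finitely many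
  indices below the threshold only change the bound.\<close>

lemma shift_poly_sums:
  assumes "shift_poly 0 S"
  obtains L n0 where
    "\<And>a n. n \<ge> n0 \<Longrightarrow> S (\<lambda>_. a) n = of_real (diag_poly L ((norm a)\<^sup>2))"
    "\<And>\<alpha>. (\<And>n. norm (\<alpha> n) \<le> 1) \<Longrightarrow> summable (\<lambda>n. (norm (\<alpha> (Suc n) - \<alpha> n))\<^sup>2) \<Longrightarrow>
       \<exists>C. \<forall>N. \<bar>\<Sum>n<N. Re (S \<alpha> n) - diag_poly L ((norm (\<alpha> n))\<^sup>2)\<bar> \<le> C"
proof -
  obtain L n0 where L': "\<forall>c xs ys. (c, xs, ys) \<in> set L \<longrightarrow> int (length xs) - int (length ys) = 0"
     "\<forall>\<alpha> n. n \<ge> n0 \<longrightarrow> S \<alpha> n = eval_shift L \<alpha> n" using assms unfolding shift_poly_def by blast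
  note L = L'[rule_format]
  show thesis
  proof (rule that)
    fix a :: complex and n assume "n \<ge> n0"
    then have "S (\<lambda>_. a) n = eval_shift L (\<lambda>_. a) n" by (rule L)
    also have "\<dots> = of_real (diag_poly L ((norm a)\<^sup>2))"
      using L(1)
    proof (induction L)
      case (Cons t L)
      obtain c xs ys where t: "t = (c, xs, ys)" by (cases t)
      have "length xs = length ys" using Cons.prems[of c xs ys] by (simp add: t)
      then have "shift_monomial (\<lambda>_. a) n xs ys = of_real (((norm a)\<^sup>2) ^ length xs)"
        unfolding of_real_power[of "(norm a)\<^sup>2"] complex_norm_square
        by (simp add: shift_monomial_def map_replicate_const power_mult_distrib)
      moreover have "eval_shift L (\<lambda>_. a) n = of_real (diag_poly L ((norm a)\<^sup>2))"
        by (rule Cons.IH) (blast intro: Cons.prems list.set_intros(2))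
      ultimately show ?case by (simp add: t eval_shift_def diag_poly_def)
    qed (simp add: eval_shift_def diag_poly_def)
    finally show "S (\<lambda>_. a) n = of_real (diag_poly L ((norm a)\<^sup>2))" .
  next
    fix \<alpha> :: "nat \<Rightarrow> complex"
    assume \<alpha>: "\<And>n. norm (\<alpha> n) \<le> 1" "summable (\<lambda>n. (norm (\<alpha> (Suc n) - \<alpha> n))\<^sup>2)"
    have "\<exists>C. \<forall>N. \<bar>\<Sum>n<N. Re (eval_shift L \<alpha> n) - diag_poly L ((norm (\<alpha> n))\<^sup>2)\<bar> \<le> C"
      using L(1)
    proof (induction L)
      case (Cons t L)
      obtain c xs ys where t: "t = (c, xs, ys)" by (cases t)
      have "length xs = length ys" using Cons.prems[of c xs ys] by (simp add: t)
      from bounded_sums_scale[OF shift_monomial_sums[OF \<alpha> this], of c]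
      have 1: "\<exists>C. \<forall>N. \<bar>\<Sum>n<N. c * (Re (shift_monomial \<alpha> n xs ys) - (norm (\<alpha> n))\<^sup>2 ^ length xs)\<bar> \<le> C" .
      have 2: "\<exists>C. \<forall>N. \<bar>\<Sum>n<N. Re (eval_shift L \<alpha> n) - diag_poly L ((norm (\<alpha> n))\<^sup>2)\<bar> \<le> C"
        by (rule Cons.IH) (blast intro: Cons.prems list.set_intros(2))
      show ?case using bounded_sums_add[OF 1 2]
        by (simp add: t eval_shift_def diag_poly_def algebra_simps)
    qed (auto simp: eval_shift_def diag_poly_def intro: exI[of _ 0])
    moreover have "\<exists>C. \<forall>N. \<bar>\<Sum>n<N. Re (S \<alpha> n) - Re (eval_shift L \<alpha> n)\<bar> \<le> C"
    proof (rule bounded_sums_summable)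
      show "summable (\<lambda>n. \<bar>Re (S \<alpha> n) - Re (eval_shift L \<alpha> n)\<bar>)"
        by (rule summable_finite[of "{..<n0}"]) (auto simp: L(2) not_less)
    qed simp
    ultimately show "\<exists>C. \<forall>N. \<bar>\<Sum>n<N. Re (S \<alpha> n) - diag_poly L ((norm (\<alpha> n))\<^sup>2)\<bar> \<le> C"
      using bounded_sums_add by (fastforce simp: algebra_simps)
  qed
qed

section \<open>A binomial identity\<close>

text \<open>\<open>T\<close> is an antidifference of the kind found by Gosper summation. The factors
  m + k and k - i allow absorption to bring both binomials from k + 1 back to k; then (m - k)(k + i)
  + (m + k)(k - i) = 2 k (m - i).\<close>

lemma alternating_binomial_sum_step:
  fixes m i k :: nat
  assumes "i \<ge> 1"
  defines "T \<equiv> (\<lambda>k. (-1) ^ k * (real m + real k) * (real k - real i) * real ((2 * m) choose (m + k)) * real ((k + i - 1) choose (2 * i - 1)))"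
  assumes "k \<ge> 1"
  shows "T (Suc k) - T k = - 2 * (real m - real i) * ((-1) ^ k * real k * real ((2 * m) choose (m + k)) * real ((k + i - 1) choose (2 * i - 1)))"
proof -
  let ?C = "real ((2 * m) choose (m + k))" and ?G = "real ((k + i - 1) choose (2 * i - 1))"
  \<comment> \<open>Here and in the next fact, the range in which natural subtraction would truncate
    is the one where both binomials vanish.\<close>
  have 1: "(real m + real (Suc k)) * real ((2 * m) choose (m + Suc k)) = (real m - real k) * ?C"
  proof (cases "k \<le> m")
    case True
    have "Suc (m + k) * ((2 * m) choose Suc (m + k)) = (2 * m - (m + k)) * ((2 * m) choose (m + k))"
      by (metis binomial_absorption binomial_absorb_comp)
    then have "real (Suc (m + k)) * real ((2 * m) choose Suc (m + k)) = real (2 * m - (m + k)) * ?C"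
      by (metis of_nat_mult)
    with True show ?thesis by (simp add: of_nat_diff add.left_commute)
  qed (simp add: binomial_eq_0)
  have 2: "(real (Suc k) - real i) * real ((Suc k + i - 1) choose (2 * i - 1)) = (real k + real i) * ?G"
  proof (cases "i \<le> Suc k")
    case True
    have "(k + i - (2 * i - 1)) * ((k + i) choose (2 * i - 1)) = (k + i) * ((k + i - 1) choose (2 * i - 1))"
      by (rule binomial_absorb_comp)
    then have "real (k + i - (2 * i - 1)) * real ((k + i) choose (2 * i - 1)) = real (k + i) * ?G"
      by (metis of_nat_mult)
    with True assms show ?thesis by (simp add: of_nat_diff)
  qed (use assms in \<open>simp add: binomial_eq_0\<close>)
  have "T (Suc k) = - ((-1) ^ k) * ((real m + real (Suc k)) * real ((2 * m) choose (m + Suc k)))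
      * ((real (Suc k) - real i) * real ((Suc k + i - 1) choose (2 * i - 1)))"
    by (simp add: T_def)
  also have "\<dots> = - ((-1) ^ k) * ((real m - real k) * ?C) * ((real k + real i) * ?G)"
    unfolding 1 2 ..
  finally show ?thesis by (simp add: T_def algebra_simps)
qed

text \<open>The sum telescopes and both ends vanish: at m + 1 the first binomial is 0, and at 1
  either i = 1 kills the factor k - i or 2i - 1 > i kills the second binomial. As i < m, the factor
  m - i can be cancelled.\<close>

lemma alternating_binomial_sum_zero:
  assumes "1 \<le> i" "i < m"
  shows "(\<Sum>k=1..m. (-1) ^ k * real k * real ((2 * m) choose (m + k)) * real ((k + i - 1) choose (2 * i - 1))) = 0"
proof -
  define T where "T k = (-1) ^ k * (real m + real k) * (real k - real i) * real ((2 * m) choose (m + k)) * real ((k + i - 1) choose (2 * i - 1))" for k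
  have "- 2 * (real m - real i) * (\<Sum>k=1..m. (-1) ^ k * real k * real ((2 * m) choose (m + k)) * real ((k + i - 1) choose (2 * i - 1)))
      = (\<Sum>k=1..m. T (Suc k) - T k)"
    unfolding sum_distrib_left T_def by (intro sum.cong refl alternating_binomial_sum_step[symmetric]) (use assms in auto)
  also have "\<dots> = T (Suc m) - T 1"
    using assms by (subst sum_Suc_diff) auto
  also have "T 1 = 0" using assms by (cases "i = 1") (auto simp: T_def binomial_eq_0)
  also have "T (Suc m) = 0" by (simp add: T_def binomial_eq_0)
  finally show ?thesis using assms by simp
qed

text \<open>The coefficient of y^i in (1 + 4 y)^(-1/2), that is, (-1)^i times the central binomial
  coefficient.\<close>

definition inverse_sqrt_coeff :: "nat \<Rightarrow> real" where
  "inverse_sqrt_coeff i = 4 ^ i * ((- 1 / 2) gchoose i)"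

lemma inverse_sqrt_coeff_Suc: "real (Suc i) * inverse_sqrt_coeff (Suc i) = - 2 * (2 * real i + 1) * inverse_sqrt_coeff i"
proof -
  have "real (Suc i) * ((- 1 / 2 :: real) gchoose (Suc i)) = (- 1 / 2 - real i) * ((- 1 / 2) gchoose i)"
    using gbinomial_absorb_comp[of "-1/2::real" i] gbinomial_absorption[of i "-1/2 :: real"] by simp
  then have "4 * 4 ^ i * (real (Suc i) * ((- 1 / 2 :: real) gchoose (Suc i))) = 4 * 4 ^ i * ((- 1 / 2 - real i) * ((- 1 / 2) gchoose i))"
    by simp
  then show ?thesis unfolding inverse_sqrt_coeff_def by (simp add: algebra_simps)
qed

text \<open>Times \<^term>\<open>i\<close>, the left-hand side does not depend on \<^term>\<open>i\<close>: consecutive values differ by a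
  multiple of the sum in the lemma \<open>alternating_binomial_sum_zero\<close>.\<close>

lemma alternating_binomial_sum:
  assumes "1 \<le> i" "i \<le> m"
  shows "(\<Sum>k=1..m. (-1) ^ k * real ((2 * m) choose (m + k)) / real k * (inverse_sqrt_coeff i * real ((k + i - 1) choose (2 * i - 1))))
    = real ((2 * m) choose m) / real i"
proof -
  define A where "A i = (\<Sum>k=1..m. (-1) ^ k * real ((2 * m) choose (m + k)) / real k * (inverse_sqrt_coeff i * real ((k + i - 1) choose (2 * i - 1))))" for i
  have "1 \<le> i \<Longrightarrow> i \<le> m \<Longrightarrow> real i * A i = real ((2 * m) choose m)" for i
  proof (induction i rule: nat_induct_at_least)
    case base
    have c1: "inverse_sqrt_coeff 1 = - 2" by (simp add: inverse_sqrt_coeff_def)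
    \<comment> \<open>For i = 1 the second binomial equals k and cancels 1/k. What remains is one
      half of the alternating row sum of 2m; the whole row sums to 0 and its two halves around the
      middle term agree by symmetry.\<close>
    have "0 = (\<Sum>j\<le>2 * m. (-1) ^ j * real ((2 * m) choose j))"
      using choose_alternating_sum[of "2 * m", where ?'a = real] base by simp
    also have "{..2 * m} = {..<m} \<union> {m} \<union> {m<..2 * m}" using base by auto
    also have "(\<Sum>j\<in>\<dots>. (-1) ^ j * real ((2 * m) choose j)) =
      (\<Sum>j<m. (-1) ^ j * real ((2 * m) choose j)) + (-1) ^ m * real ((2 * m) choose m) + (\<Sum>j\<in>{m<..2 * m}. (-1) ^ j * real ((2 * m) choose j))"
      by (subst sum.union_disjoint; (subst sum.union_disjoint)?) auto
    also have "(\<Sum>j<m. (-1) ^ j * real ((2 * m) choose j)) = (\<Sum>k=1..m. (-1) ^ m * ((-1) ^ k * real ((2 * m) choose (m + k))))"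
    proof (rule sum.reindex_bij_witness[of _ "\<lambda>k. m - k" "\<lambda>j. m - j"])
      fix j assume j: "j \<in> {..<m}"
      then have "(2 * m) choose j = (2 * m) choose (m + (m - j))"
        by (subst binomial_symmetric) (auto simp: algebra_simps intro: arg_cong2[where f = binomial])
      moreover have "(-1 :: real) ^ j = (-1) ^ m * (-1) ^ (m - j)"
        using j by (auto simp: minus_one_power_iff)
      ultimately show "(-1) ^ m * ((-1) ^ (m - j) * real ((2 * m) choose (m + (m - j)))) = (-1) ^ j * real ((2 * m) choose j)"
        by simp
    qed auto
    also have "(\<Sum>j\<in>{m<..2 * m}. (-1) ^ j * real ((2 * m) choose j)) = (\<Sum>k=1..m. (-1) ^ m * ((-1) ^ k * real ((2 * m) choose (m + k))))"
      by (rule sum.reindex_bij_witness[of _ "\<lambda>k. m + k" "\<lambda>j. j - m"]) (auto simp: power_add[symmetric])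
    finally have "(-1) ^ m * (real ((2 * m) choose m) + 2 * (\<Sum>k=1..m. (-1) ^ k * real ((2 * m) choose (m + k)))) = 0"
      unfolding sum_distrib_left[symmetric] by (simp only: algebra_simps)
    then have "real ((2 * m) choose m) = - 2 * (\<Sum>k=1..m. (-1) ^ k * real ((2 * m) choose (m + k)))" by simp
    also have "\<dots> = A 1" unfolding A_def c1 sum_distrib_left by (intro sum.cong) auto
    finally show ?case by simp
  next
    case (Suc i)
    have "real (Suc i) * A (Suc i) - real i * A i =
      (\<Sum>k=1..m. - inverse_sqrt_coeff i / real i * ((-1) ^ k * real k * real ((2 * m) choose (m + k)) * real ((k + i - 1) choose (2 * i - 1))))"
      unfolding A_def sum_distrib_left sum_subtractf[symmetric]
    proof (intro sum.cong refl)
      fix k assume k: "k \<in> {1..m}"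
      let ?G = "real ((k + i - 1) choose (2 * i - 1))" and ?P = "(-1) ^ k * real ((2 * m) choose (m + k))"
      \<comment> \<open>With the recursion for \<open>inverse_sqrt_coeff\<close>, this turns the
        term at i + 1 into a multiple of k^2 - i^2. Subtracting the term at i cancels i^2, and the
        surviving k^2 against 1/k leaves the summand of the vanishing sum.\<close>
      have G: "(2 * real i) * (2 * real i + 1) * real ((k + Suc i - 1) choose (2 * Suc i - 1)) = (real k * real k - real i * real i) * ?G"
      proof (cases "i \<le> k")
        case True
        have "Suc (2 * i) * ((k + i) choose Suc (2 * i)) = (k + i) * ((k + i - 1) choose (2 * i))"
          using binomial_absorption[of "2 * i" "k + i"] by simp
        then have a: "(2 * real i + 1) * real ((k + i) choose Suc (2 * i)) = (real k + real i) * real ((k + i - 1) choose (2 * i))"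
          by (metis (no_types, lifting) of_nat_mult of_nat_add of_nat_Suc of_nat_numeral add.commute)
        have "Suc (2 * i - 1) * ((k + i - 1) choose Suc (2 * i - 1)) = (k + i - 1 - (2 * i - 1)) * ((k + i - 1) choose (2 * i - 1))"
          by (metis binomial_absorption binomial_absorb_comp)
        moreover have "Suc (2 * i - 1) = 2 * i" "k + i - 1 - (2 * i - 1) = k - i" using Suc by auto
        ultimately have "(2 * i) * ((k + i - 1) choose (2 * i)) = (k - i) * ((k + i - 1) choose (2 * i - 1))" by simp
        then have "real ((2 * i) * ((k + i - 1) choose (2 * i))) = real ((k - i) * ((k + i - 1) choose (2 * i - 1)))" by simp
        then have b: "(2 * real i) * real ((k + i - 1) choose (2 * i)) = (real k - real i) * ?G"
          using True by (simp add: of_nat_diff)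
        have "(2 * real i) * (2 * real i + 1) * real ((k + Suc i - 1) choose (2 * Suc i - 1)) = 
          2 * real i * ((2 * real i + 1) * real ((k + i) choose Suc (2 * i)))" by simp
        also have "\<dots> = (real k + real i) * ((2 * real i) * real ((k + i - 1) choose (2 * i)))" unfolding a by simp
        finally show ?thesis unfolding b by (simp add: algebra_simps)
      next
        case False
        then show ?thesis using k by (simp add: binomial_eq_0)
      qed
      have i: "real i > 0" using Suc by simp
      have k0: "real k > 0" using k by simp
      have "real (Suc i) * (inverse_sqrt_coeff (Suc i) * real ((k + Suc i - 1) choose (2 * Suc i - 1)))
         = - inverse_sqrt_coeff i / real i * ((2 * real i) * (2 * real i + 1) * real ((k + Suc i - 1) choose (2 * Suc i - 1)))"
        unfolding mult.assoc[symmetric, of "real (Suc i)"] inverse_sqrt_coeff_Suc using i by (simp add: field_simps)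
      also have "\<dots> = - inverse_sqrt_coeff i / real i * ((real k * real k - real i * real i) * ?G)" unfolding G ..
      finally have e: "real (Suc i) * (inverse_sqrt_coeff (Suc i) * real ((k + Suc i - 1) choose (2 * Suc i - 1))) = - inverse_sqrt_coeff i / real i * ((real k * real k - real i * real i) * ?G)" .
      have "real (Suc i) * (?P / real k * (inverse_sqrt_coeff (Suc i) * real ((k + Suc i - 1) choose (2 * Suc i - 1)))) -
            real i * (?P / real k * (inverse_sqrt_coeff i * ?G))
          = ?P / real k * (real (Suc i) * (inverse_sqrt_coeff (Suc i) * real ((k + Suc i - 1) choose (2 * Suc i - 1)))) -
            real i * (?P / real k * (inverse_sqrt_coeff i * ?G))" by (simp only: mult.left_commute)
      also have "\<dots> = - inverse_sqrt_coeff i / real i * ((-1) ^ k * real k * real ((2 * m) choose (m + k)) * ?G)"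
        unfolding e using i k0 by (simp add: field_simps)
      finally show "real (Suc i) * (?P / real k * (inverse_sqrt_coeff (Suc i) * real ((k + Suc i - 1) choose (2 * Suc i - 1)))) -
            real i * (?P / real k * (inverse_sqrt_coeff i * ?G)) = - inverse_sqrt_coeff i / real i * ((-1) ^ k * real k * real ((2 * m) choose (m + k)) * ?G)" .
    qed
    also have "\<dots> = 0" unfolding sum_distrib_left[symmetric] using Suc by (subst alternating_binomial_sum_zero) auto
    finally show ?case using Suc by simp
  qed
  from this[OF assms] assms have "A i = real ((2 * m) choose m) / real i" by (simp add: field_simps)
  then show ?thesis unfolding A_def .
qed

section \<open>The Szego recursion in power series\<close>

text \<open>A joint recursion, as each polynomial needs the other. No measure enters, so the pair is
  available for arbitrary \<alpha>, in particular for the constant sequences at which the universal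
  coefficients are evaluated.\<close>

primrec szego_pair :: "(nat \<Rightarrow> complex) \<Rightarrow> nat \<Rightarrow> complex poly \<times> complex poly" where
  "szego_pair \<alpha> 0 = (1, 1)"
| "szego_pair \<alpha> (Suc n) =
    (pCons 0 (fst (szego_pair \<alpha> n)) - smult (cnj (\<alpha> n)) (snd (szego_pair \<alpha> n)),
     snd (szego_pair \<alpha> n) - smult (\<alpha> n) (pCons 0 (fst (szego_pair \<alpha> n))))"

definition monic_poly :: "(nat \<Rightarrow> complex) \<Rightarrow> nat \<Rightarrow> complex poly" where
  "monic_poly \<alpha> n = fst (szego_pair \<alpha> n)"

definition rev_poly :: "(nat \<Rightarrow> complex) \<Rightarrow> nat \<Rightarrow> complex poly" where
  "rev_poly \<alpha> n = snd (szego_pair \<alpha> n)"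

lemma monic_poly_0 [simp]: "monic_poly \<alpha> 0 = 1"
  and rev_poly_0 [simp]: "rev_poly \<alpha> 0 = 1"
  and monic_poly_Suc: "monic_poly \<alpha> (Suc n) = pCons 0 (monic_poly \<alpha> n) - smult (cnj (\<alpha> n)) (rev_poly \<alpha> n)"
  and rev_poly_Suc: "rev_poly \<alpha> (Suc n) = rev_poly \<alpha> n - smult (\<alpha> n) (pCons 0 (monic_poly \<alpha> n))"
  by (simp_all add: monic_poly_def rev_poly_def)

lemma coeff_0_rev_poly [simp]: "coeff (rev_poly \<alpha> n) 0 = 1"
  by (induction n) (simp_all add: rev_poly_Suc)

definition schur_fps :: "(nat \<Rightarrow> complex) \<Rightarrow> nat \<Rightarrow> complex fps" where
  "schur_fps \<alpha> n = fps_X * fps_of_poly (monic_poly \<alpha> n) * inverse (fps_of_poly (rev_poly \<alpha> n))"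

definition step_fps :: "(nat \<Rightarrow> complex) \<Rightarrow> nat \<Rightarrow> complex fps" where
  "step_fps \<alpha> n = 1 - fps_const (\<alpha> n) * schur_fps \<alpha> n"

text \<open>Logarithmic derivatives turn the product of the steps into a sum without a formal
  logarithm. Coefficient k - 1 here is k times coefficient k of the logarithm of the step.\<close>

definition log_deriv_fps :: "(nat \<Rightarrow> complex) \<Rightarrow> nat \<Rightarrow> complex fps" where
  "log_deriv_fps \<alpha> n = fps_deriv (step_fps \<alpha> n) * inverse (step_fps \<alpha> n)"

lemma schur_fps_0 [simp]: "schur_fps \<alpha> n $ 0 = 0"
  by (simp add: schur_fps_def)

lemma step_fps_0 [simp]: "step_fps \<alpha> n $ 0 = 1"
  by (simp add: step_fps_def)

lemma rev_fps_0 [simp]: "fps_of_poly (rev_poly \<alpha> n) $ 0 = 1"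
  by simp

lemma monic_fps: "fps_X * fps_of_poly (monic_poly \<alpha> n) = schur_fps \<alpha> n * fps_of_poly (rev_poly \<alpha> n)"
proof -
  have "inverse (fps_of_poly (rev_poly \<alpha> n)) * fps_of_poly (rev_poly \<alpha> n) = 1"
    by (rule inverse_mult_eq_1) simp
  then show ?thesis by (simp add: schur_fps_def mult.assoc)
qed

lemma fps_of_poly_pCons_0: "fps_of_poly (pCons 0 p) = fps_X * fps_of_poly p"
  for p :: "complex poly"
  by (simp add: fps_of_poly_pCons mult.commute)

lemma rev_fps_Suc: "fps_of_poly (rev_poly \<alpha> (Suc n)) = fps_of_poly (rev_poly \<alpha> n) * step_fps \<alpha> n"
  unfolding rev_poly_Suc fps_of_poly_diff fps_of_poly_smult fps_of_poly_pCons_0 monic_fps step_fps_def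
  by (simp add: algebra_simps)

lemma monic_fps_Suc: "fps_of_poly (monic_poly \<alpha> (Suc n)) = fps_of_poly (rev_poly \<alpha> n) * (schur_fps \<alpha> n - fps_const (cnj (\<alpha> n)))"
  unfolding monic_poly_Suc fps_of_poly_diff fps_of_poly_smult fps_of_poly_pCons_0 monic_fps
  by (simp add: algebra_simps)

text \<open>A step of the Schur algorithm, b to z (b - conj(a)) / (1 - a b), stated without
  division: b at n + 1 depends only on b at n and \<alpha>_n. The common factor
  \<open>rev_poly\<close> can be cancelled since its constant coefficient is 1.\<close>

lemma schur_fps_Suc: "schur_fps \<alpha> (Suc n) * step_fps \<alpha> n = fps_X * (schur_fps \<alpha> n - fps_const (cnj (\<alpha> n)))"
proof -
  have "fps_of_poly (rev_poly \<alpha> n) * (schur_fps \<alpha> (Suc n) * step_fps \<alpha> n) = schur_fps \<alpha> (Suc n) * fps_of_poly (rev_poly \<alpha> (Suc n))"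
    by (simp add: rev_fps_Suc algebra_simps)
  also have "\<dots> = fps_of_poly (rev_poly \<alpha> n) * (fps_X * (schur_fps \<alpha> n - fps_const (cnj (\<alpha> n))))"
    by (simp add: monic_fps[symmetric] monic_fps_Suc algebra_simps)
  finally show ?thesis
    by (metis mult_cancel_left rev_fps_0 fps_zero_nth zero_neq_one)
qed

lemma log_deriv_fps_mult: "log_deriv_fps \<alpha> n * step_fps \<alpha> n = fps_deriv (step_fps \<alpha> n)"
  using inverse_mult_eq_1[of "step_fps \<alpha> n"] by (simp add: log_deriv_fps_def mult.assoc)

lemma deriv_rev_fps:
  "fps_deriv (fps_of_poly (rev_poly \<alpha> N)) = fps_of_poly (rev_poly \<alpha> N) * (\<Sum>n<N. log_deriv_fps \<alpha> n)"
proof (induction N)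
  case (Suc N)
  show ?case
    by (simp add: rev_fps_Suc Suc log_deriv_fps_mult[symmetric] algebra_simps)
qed simp

text \<open>The factor X in the Schur step expresses coefficient k at n + 1 by coefficients below k
  at n. Unfolding therefore ends after at most k steps, however large n is, and involves finitely
  many shifts. The two claims need each other: the inverse in degree k uses b up to degree k, while
  b in degree k uses the inverse only below k.\<close>

lemma shift_poly_schur_inverse:
  "shift_poly (-1) (\<lambda>\<alpha> n. schur_fps \<alpha> n $ k) \<and> shift_poly 0 (\<lambda>\<alpha> n. inverse (step_fps \<alpha> n) $ k)"
proof (induction k rule: less_induct)
  case (less k)
  have 1: "shift_poly (-1) (\<lambda>\<alpha> n. schur_fps \<alpha> n $ k)"
  proof (cases k)
    case 0
    then show ?thesis by (simp add: shift_poly_zero)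
  next
    case (Suc l)
    \<comment> \<open>The conditional coefficient encodes the subtraction of the constant series
      \<open>cnj (\<alpha> n)\<close>, which only affects degree 0.\<close>
    have *: "schur_fps \<alpha> (Suc n) $ k = (\<Sum>i=0..l. (schur_fps \<alpha> n $ i + of_real (if i = 0 then -1 else 0) * cnj (\<alpha> n)) * inverse (step_fps \<alpha> n) $ (l - i))" for \<alpha> n
    proof -
      have "schur_fps \<alpha> (Suc n) = schur_fps \<alpha> (Suc n) * (step_fps \<alpha> n * inverse (step_fps \<alpha> n))"
        by (simp add: inverse_mult_eq_1')
      also have "\<dots> = fps_X * ((schur_fps \<alpha> n - fps_const (cnj (\<alpha> n))) * inverse (step_fps \<alpha> n))"
        by (simp add: mult.assoc[symmetric] schur_fps_Suc)
      finally have "schur_fps \<alpha> (Suc n) $ k = ((schur_fps \<alpha> n - fps_const (cnj (\<alpha> n))) * inverse (step_fps \<alpha> n)) $ l"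
        by (simp add: Suc)
      then show ?thesis by (simp add: fps_mult_nth Suc) (intro sum.cong, auto)
    qed
    have "shift_poly (-1) (\<lambda>\<alpha> n. \<Sum>i=0..l. (schur_fps \<alpha> n $ i + of_real (if i = 0 then -1 else 0) * cnj (\<alpha> n)) * inverse (step_fps \<alpha> n) $ (l - i))"
    proof (rule shift_poly_sum)
      fix i assume "i \<in> {0..l}"
      then have "i < k" "l - i < k" using Suc by auto
      then have a: "shift_poly (-1) (\<lambda>\<alpha> n. schur_fps \<alpha> n $ i)" and b: "shift_poly 0 (\<lambda>\<alpha> n. inverse (step_fps \<alpha> n) $ (l - i))"
        using less.IH by blast+
      from shift_poly_mult[OF shift_poly_add[OF a shift_poly_scale[OF shift_poly_cnj_var, of "if i = 0 then -1 else 0"]] b]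
      show "shift_poly (-1) (\<lambda>\<alpha> n. (schur_fps \<alpha> n $ i + of_real (if i = 0 then -1 else 0) * cnj (\<alpha> n)) * inverse (step_fps \<alpha> n) $ (l - i))"
        unfolding add_0_right .
    qed simp
    then show ?thesis by (rule shift_poly_shift) (rule *)
  qed
  \<comment> \<open>From 1/l = 1 + a b / l with l = 1 - a b. As b has no constant term, the sum
    starts at i = 1 and the inverse on the right is needed only below degree k.\<close>
  have "inverse (step_fps \<alpha> n) $ k = of_real (if k = 0 then 1 else 0) + (\<Sum>i=1..k. \<alpha> n * schur_fps \<alpha> n $ i * inverse (step_fps \<alpha> n) $ (k - i))" for \<alpha> n
  proof -
    have "inverse (step_fps \<alpha> n) = step_fps \<alpha> n * inverse (step_fps \<alpha> n) + fps_const (\<alpha> n) * schur_fps \<alpha> n * inverse (step_fps \<alpha> n)"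
      by (simp add: step_fps_def algebra_simps)
    also have "step_fps \<alpha> n * inverse (step_fps \<alpha> n) = 1" by (simp add: inverse_mult_eq_1')
    finally have "inverse (step_fps \<alpha> n) $ k = (1 + fps_const (\<alpha> n) * schur_fps \<alpha> n * inverse (step_fps \<alpha> n)) $ k" by metis
    then show ?thesis by (simp add: fps_mult_nth[of "fps_const (\<alpha> n) * schur_fps \<alpha> n"] sum.atLeast_Suc_atMost[of 0])
  qed
  moreover have "shift_poly 0 (\<lambda>\<alpha> n. of_real (if k = 0 then 1 else 0) + (\<Sum>i=1..k. \<alpha> n * schur_fps \<alpha> n $ i * inverse (step_fps \<alpha> n) $ (k - i)))"
  proof (intro shift_poly_add shift_poly_const shift_poly_sum)
    fix i assume i: "i \<in> {1..k}"
    have "shift_poly (-1) (\<lambda>\<alpha> n. schur_fps \<alpha> n $ i)" "shift_poly 0 (\<lambda>\<alpha> n. inverse (step_fps \<alpha> n) $ (k - i))"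
      using i 1 less.IH[of i] less.IH[of "k - i"] by (cases "i = k"; force)+
    from shift_poly_mult[OF shift_poly_mult[OF shift_poly_var this(1)] this(2)]
    show "shift_poly 0 (\<lambda>\<alpha> n. \<alpha> n * schur_fps \<alpha> n $ i * inverse (step_fps \<alpha> n) $ (k - i))" by simp
  qed simp
  ultimately show ?case using 1 by simp
qed

lemma shift_poly_log_deriv: "shift_poly 0 (\<lambda>\<alpha> n. log_deriv_fps \<alpha> n $ k)"
proof -
  have "log_deriv_fps \<alpha> n $ k = (\<Sum>i=0..k. (of_real (- real (Suc i)) * (\<alpha> n * schur_fps \<alpha> n $ Suc i)) * inverse (step_fps \<alpha> n) $ (k - i))" for \<alpha> n
  proof -
    have "fps_deriv (step_fps \<alpha> n) $ i = of_real (- real (Suc i)) * (\<alpha> n * schur_fps \<alpha> n $ Suc i)" for i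
      by (simp add: step_fps_def algebra_simps)
    then show ?thesis unfolding log_deriv_fps_def fps_mult_nth by simp
  qed
  moreover have "shift_poly 0 (\<lambda>\<alpha> n. \<Sum>i=0..k. (of_real (- real (Suc i)) * (\<alpha> n * schur_fps \<alpha> n $ Suc i)) * inverse (step_fps \<alpha> n) $ (k - i))"
  proof (rule shift_poly_sum)
    fix i
    have "shift_poly (-1) (\<lambda>\<alpha> n. schur_fps \<alpha> n $ Suc i)" "shift_poly 0 (\<lambda>\<alpha> n. inverse (step_fps \<alpha> n) $ (k - i))"
      using shift_poly_schur_inverse by blast+
    from shift_poly_mult[OF shift_poly_scale[OF shift_poly_mult[OF shift_poly_var this(1)], of "- real (Suc i)"] this(2)]
    show "shift_poly 0 (\<lambda>\<alpha> n. (of_real (- real (Suc i)) * (\<alpha> n * schur_fps \<alpha> n $ Suc i)) * inverse (step_fps \<alpha> n) $ (k - i))"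
      unfolding add_uminus_conv_diff diff_self add_0_right by simp
  qed simp
  ultimately show ?thesis by simp
qed

section \<open>Limits of power series, coefficient by coefficient, along constant sequences\<close>

definition fps_stabilizes :: "(nat \<Rightarrow> complex fps) \<Rightarrow> complex fps \<Rightarrow> bool" where
  "fps_stabilizes F G \<longleftrightarrow> (\<forall>k. \<forall>\<^sub>F n in sequentially. F n $ k = G $ k)"

lemma fps_stabilizes_unique:
  assumes "fps_stabilizes F G" "fps_stabilizes F H"
  shows "G = H"
proof (rule fps_ext)
  fix k
  have "\<forall>\<^sub>F n in sequentially. F n $ k = G $ k" "\<forall>\<^sub>F n in sequentially. F n $ k = H $ k"
    using assms by (auto simp: fps_stabilizes_def)
  then have "\<forall>\<^sub>F n in sequentially. G $ k = H $ k"
    by eventually_elim simp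
  then show "G $ k = H $ k" by simp
qed

lemma fps_stabilizes_const: "fps_stabilizes (\<lambda>_. F) F"
  by (simp add: fps_stabilizes_def)

lemma fps_stabilizes_diff:
  assumes "fps_stabilizes F F'" "fps_stabilizes G G'"
  shows "fps_stabilizes (\<lambda>n. F n - G n) (F' - G')"
  unfolding fps_stabilizes_def
proof
  fix k
  have "\<forall>\<^sub>F n in sequentially. F n $ k = F' $ k" "\<forall>\<^sub>F n in sequentially. G n $ k = G' $ k"
    using assms by (auto simp: fps_stabilizes_def)
  then show "\<forall>\<^sub>F n in sequentially. (F n - G n) $ k = (F' - G') $ k"
    by eventually_elim simp
qed

lemma fps_stabilizes_mult:
  assumes "fps_stabilizes F F'" "fps_stabilizes G G'" 
  shows "fps_stabilizes (\<lambda>n. F n * G n) (F' * G')"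
  unfolding fps_stabilizes_def
proof
  fix k
  have "\<forall>\<^sub>F n in sequentially. \<forall>i\<in>{..k}. F n $ i = F' $ i"
    by (rule eventually_ball_finite) (use assms in \<open>simp_all add: fps_stabilizes_def\<close>)
  moreover have "\<forall>\<^sub>F n in sequentially. \<forall>i\<in>{..k}. G n $ i = G' $ i"
    by (rule eventually_ball_finite) (use assms in \<open>simp_all add: fps_stabilizes_def\<close>)
  ultimately show "\<forall>\<^sub>F n in sequentially. (F n * G n) $ k = (F' * G') $ k"
    by eventually_elim (auto simp: fps_mult_nth)
qed

lemma fps_stabilizes_deriv:
  assumes "fps_stabilizes F G"
  shows "fps_stabilizes (\<lambda>n. fps_deriv (F n)) (fps_deriv G)"
  unfolding fps_stabilizes_def
proof
  fix k
  have "\<forall>\<^sub>F n in sequentially. F n $ Suc k = G $ Suc k"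
    using assms by (auto simp: fps_stabilizes_def)
  then show "\<forall>\<^sub>F n in sequentially. fps_deriv (F n) $ k = fps_deriv G $ k"
    by eventually_elim simp
qed

lemma fps_stabilizes_Suc:
  assumes "fps_stabilizes F G"
  shows "fps_stabilizes (\<lambda>n. F (Suc n)) G"
  unfolding fps_stabilizes_def
proof
  fix k
  show "\<forall>\<^sub>F n in sequentially. F (Suc n) $ k = G $ k"
    using assms eventually_sequentially_Suc[of "\<lambda>n. F n $ k = G $ k"] by (simp add: fps_stabilizes_def)
qed

text \<open>A shift monomial of a constant sequence does not depend on n, so every coefficient is
  eventually constant. The limits then satisfy the same algebraic and differential
  identities.\<close>

lemma shift_poly_const_stabilizes:
  assumes "\<And>k. shift_poly d (\<lambda>\<alpha> n. F \<alpha> n $ k)"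
  shows "\<exists>G. fps_stabilizes (F (\<lambda>_. a)) G"
proof -
  have "\<exists>c. \<forall>\<^sub>F n in sequentially. F (\<lambda>_. a) n $ k = c" for k
  proof -
    obtain L n0 where "\<forall>\<alpha> n. n \<ge> n0 \<longrightarrow> F \<alpha> n $ k = eval_shift L \<alpha> n"
      using assms[of k] unfolding shift_poly_def by blast
    moreover define c where "c = eval_shift L (\<lambda>_. a) 0"
    have "eval_shift L (\<lambda>_. a) n = c" for n
      by (simp add: c_def eval_shift_def shift_monomial_def)
    ultimately have "\<forall>n\<ge>n0. F (\<lambda>_. a) n $ k = c" by simp
    then show ?thesis unfolding eventually_sequentially by blast
  qed
  then obtain c where "\<And>k. \<forall>\<^sub>F n in sequentially. F (\<lambda>_. a) n $ k = c k" by metis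
  then show ?thesis by (intro exI[of _ "Abs_fps c"]) (simp add: fps_stabilizes_def)
qed

text \<open>The hypothesis says V = (1 + U)^(-1/2) with U = 4 x X / (1 - X)^2: a square root is
  unique up to sign, and the constant coefficient decides the sign. In the binomial series, (X / (1
  - X)^2)^i contributes (k + i - 1) choose (2i - 1) in degree k.\<close>

lemma fps_nth_inverse_sqrt:
  fixes V :: "complex fps" and x :: real
  assumes V: "V\<^sup>2 * ((1 - fps_X)\<^sup>2 + fps_const (of_real (4 * x)) * fps_X) = (1 - fps_X)\<^sup>2" "V $ 0 = 1" and k: "k \<ge> 1"
  shows "V $ k = of_real (\<Sum>i=1..k. inverse_sqrt_coeff i * x ^ i * real ((k + i - 1) choose (2 * i - 1)))"
proof -
  define I where "I = inverse ((1 - fps_X :: complex fps)\<^sup>2)"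
  define U where "U = fps_const (of_real (4 * x)) * fps_X * I"
  define W where "W = fps_binomial (- 1 / 2) oo U"
  have U0: "U $ 0 = 0" by (simp add: U_def)
  have I: "I * (1 - fps_X)\<^sup>2 = 1" unfolding I_def by (rule inverse_mult_eq_1) (simp add: power2_eq_square)
  have "W\<^sup>2 = fps_binomial (- 1) oo U"
    unfolding W_def power2_eq_square using fps_binomial_add_mult[of "-1/2 :: complex" "-1/2"]
    by (simp add: fps_compose_mult_distrib[OF U0, symmetric])
  also have "\<dots> = inverse (1 + U)"
    unfolding fps_binomial_minus_one using U0 by (simp add: fps_inverse_compose fps_compose_add_distrib)
  finally have "W\<^sup>2 * (1 + U) = 1" using inverse_mult_eq_1[of "1 + U"] U0 by simp
  then have "W\<^sup>2 * ((1 + U) * (1 - fps_X)\<^sup>2) = (1 - fps_X)\<^sup>2" by (simp add: mult.assoc[symmetric])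
  moreover have "(1 + U) * (1 - fps_X)\<^sup>2 = (1 - fps_X)\<^sup>2 + fps_const (of_real (4 * x)) * fps_X * (I * (1 - fps_X)\<^sup>2)"
    by (simp add: U_def algebra_simps)
  ultimately have "W\<^sup>2 * ((1 - fps_X)\<^sup>2 + fps_const (of_real (4 * x)) * fps_X) = (1 - fps_X)\<^sup>2"
    by (simp add: I)
  with V(1) have "W\<^sup>2 * ((1 - fps_X)\<^sup>2 + fps_const (of_real (4 * x)) * fps_X) = V\<^sup>2 * ((1 - fps_X)\<^sup>2 + fps_const (of_real (4 * x)) * fps_X)"
    by simp
  moreover have "((1 - fps_X)\<^sup>2 + fps_const (of_real (4 * x)) * fps_X :: complex fps) $ 0 = 1"
    by (simp add: power2_eq_square)
  then have "((1 - fps_X)\<^sup>2 + fps_const (of_real (4 * x)) * fps_X :: complex fps) \<noteq> 0"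
    by (metis fps_zero_nth zero_neq_one)
  ultimately have "W\<^sup>2 = V\<^sup>2" by simp
  then have "W = V \<or> W = - V" by (simp add: power2_eq_iff)
  moreover have "W $ 0 = 1" by (simp add: W_def)
  then have "W \<noteq> - V" using V(2) by (metis fps_neg_nth one_neq_neg_one)
  ultimately have "V = W" by simp
  have Unth: "(U ^ i) $ k = of_real (4 ^ i * x ^ i * real ((k + i - 1) choose (2 * i - 1)))" if i: "i \<ge> 1" "i \<le> k" for i
  proof -
    have "I ^ i = inverse ((1 - fps_const 1 * fps_X) ^ (2 * i))"
      unfolding I_def fps_inverse_power[symmetric] by (simp add: power_mult)
    also have "\<dots> = Abs_fps (\<lambda>k. of_nat ((2 * i + k - 1) choose k) * 1 ^ k)"
      by (rule one_minus_const_fps_X_neg_power') (use i in simp)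
    finally have Ii: "I ^ i $ j = of_nat ((2 * i + j - 1) choose j)" for j by simp
    have "U ^ i = fps_const (of_real (4 * x) ^ i) * (fps_X ^ i * I ^ i)"
      by (simp add: U_def power_mult_distrib mult.assoc fps_const_power)
    then have "(U ^ i) $ k = of_real (4 * x) ^ i * of_nat ((2 * i + (k - i) - 1) choose (k - i))"
      using i by (simp add: fps_X_power_mult_nth Ii)
    moreover have "(2 * i + (k - i) - 1) choose (k - i) = (k + i - 1) choose (2 * i - 1)"
      using i by (subst binomial_symmetric) (auto intro: arg_cong2[where f = binomial])
    ultimately show ?thesis by (simp add: power_mult_distrib)
  qed
  have "V $ k = (\<Sum>i=0..k. ((- 1 / 2) gchoose i) * (U ^ i) $ k)"
    by (simp add: \<open>V = W\<close> W_def fps_compose_nth)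
  also have "\<dots> = (\<Sum>i=1..k. ((- 1 / 2) gchoose i) * (U ^ i) $ k)"
    using k by (simp add: sum.atLeast_Suc_atMost[of 0])
  also have "\<dots> = (\<Sum>i=1..k. of_real (inverse_sqrt_coeff i * x ^ i * real ((k + i - 1) choose (2 * i - 1))))"
  proof (intro sum.cong refl)
    fix i assume "i \<in> {1..k}"
    moreover have "(- 1 / 2 :: complex) gchoose i = of_real ((- 1 / 2) gchoose i)"
      by (simp add: gbinomial_prod_rev)
    ultimately show "((- 1 / 2) gchoose i) * (U ^ i) $ k = of_real (inverse_sqrt_coeff i * x ^ i * real ((k + i - 1) choose (2 * i - 1)))"
      by (simp add: Unth inverse_sqrt_coeff_def)
  qed
  finally show ?thesis by simp
qed

text \<open>In the limit the Schur step becomes a fixed point equation, so l = 1 - a b is algebraic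
  of degree 2. Its logarithmic derivative \<eta> satisfies 2 X \<eta> = 1 - (1 - X) / s, with s the
  square root of the discriminant.\<close>

lemma log_deriv_const_limit:
  assumes "fps_stabilizes (log_deriv_fps (\<lambda>_. a)) \<eta>" and k: "k \<ge> 1"
  shows "2 * \<eta> $ (k - 1) = - of_real (\<Sum>i=1..k. inverse_sqrt_coeff i * ((norm a)\<^sup>2) ^ i * real ((k + i - 1) choose (2 * i - 1)))"
proof -
  define x where "x = (norm a)\<^sup>2"
  obtain \<beta> where \<beta>: "fps_stabilizes (schur_fps (\<lambda>_. a)) \<beta>"
    using shift_poly_const_stabilizes[of "-1" schur_fps a, OF conjunct1[OF shift_poly_schur_inverse]] by blast
  define l where "l = 1 - fps_const a * \<beta>"
  have l: "fps_stabilizes (step_fps (\<lambda>_. a)) l"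
    unfolding l_def step_fps_def by (intro fps_stabilizes_diff fps_stabilizes_mult fps_stabilizes_const \<beta>)
  have "fps_stabilizes (\<lambda>n. schur_fps (\<lambda>_. a) (Suc n) * step_fps (\<lambda>_. a) n) (\<beta> * l)"
    by (intro fps_stabilizes_mult fps_stabilizes_Suc l \<beta>)
  moreover have "fps_stabilizes (\<lambda>n. fps_X * (schur_fps (\<lambda>_. a) n - fps_const (cnj a))) (fps_X * (\<beta> - fps_const (cnj a)))"
    by (intro fps_stabilizes_mult fps_stabilizes_const fps_stabilizes_diff \<beta>)
  ultimately have fixpt: "\<beta> * l = fps_X * (\<beta> - fps_const (cnj a))"
    unfolding schur_fps_Suc by (rule fps_stabilizes_unique)
  have "fps_stabilizes (\<lambda>n. log_deriv_fps (\<lambda>_. a) n * step_fps (\<lambda>_. a) n) (\<eta> * l)"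
    by (intro fps_stabilizes_mult assms l)
  moreover have "fps_stabilizes (\<lambda>n. fps_deriv (step_fps (\<lambda>_. a) n)) (fps_deriv l)"
    by (intro fps_stabilizes_deriv l)
  ultimately have \<eta>: "\<eta> * l = fps_deriv l"
    unfolding log_deriv_fps_mult by (rule fps_stabilizes_unique)
  have "\<forall>\<^sub>F n in sequentially. schur_fps (\<lambda>_. a) n $ 0 = \<beta> $ 0"
    using \<beta> unfolding fps_stabilizes_def by blast
  then have \<beta>0: "\<beta> $ 0 = 0" by simp
  have l0: "l $ 0 = 1" by (simp add: l_def \<beta>0)
  have ax: "fps_const a * fps_const (cnj a) = fps_const (of_real x)"
    unfolding x_def complex_norm_square by simp
  \<comment> \<open>Multiplying the fixed point equation by a gives a quadratic equation for l in
    which a occurs only through x.\<close>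
  have "(1 - l) * l = fps_const a * (\<beta> * l)" by (simp add: l_def algebra_simps)
  also have "\<dots> = fps_X * ((1 - l) - fps_const a * fps_const (cnj a))"
    unfolding fixpt by (simp add: l_def algebra_simps)
  finally have quad: "l * l = l + fps_X * l - fps_X + fps_X * fps_const (of_real x)"
    unfolding ax by (simp add: algebra_simps)
  \<comment> \<open>The square root of the discriminant, and also the factor of l' when the
    quadratic equation is differentiated.\<close>
  define s where "s = 2 * l - 1 - fps_X"
  have s2: "s\<^sup>2 = (1 - fps_X)\<^sup>2 + fps_const (of_real (4 * x)) * fps_X"
  proof -
    have "s\<^sup>2 = 4 * (l * l) - 4 * l * (1 + fps_X) + (1 + fps_X)\<^sup>2"
      by (simp add: s_def power2_eq_square algebra_simps)
    also have "\<dots> = (1 + fps_X)\<^sup>2 - 4 * fps_X + 4 * fps_X * fps_const (of_real x)"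
      unfolding quad by (simp add: algebra_simps)
    also have "4 * fps_X * fps_const (of_real x) = fps_const (of_real (4 * x)) * (fps_X :: complex fps)"
      by (simp add: numeral_fps_const mult_ac)
    finally show ?thesis by (simp add: power2_eq_square algebra_simps)
  qed
  have "fps_deriv (l * l) = fps_deriv (l + fps_X * l - fps_X + fps_X * fps_const (of_real x))"
    unfolding quad ..
  then have dl: "s * fps_deriv l = l - 1 + fps_const (of_real x)"
    by (simp add: s_def algebra_simps)
  \<comment> \<open>By the quadratic equation X (l - 1 + x) = l (l - 1), so that l cancels and only
    s is left.\<close>
  have "l * (2 * fps_X * \<eta> * s) = 2 * fps_X * (s * (\<eta> * l))" by (simp add: algebra_simps)
  also have "\<dots> = 2 * fps_X * (l - 1 + fps_const (of_real x))" unfolding \<eta> dl ..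
  also have "\<dots> = 2 * (l + fps_X * l - fps_X + fps_X * fps_const (of_real x)) - 2 * l"
    by (simp add: algebra_simps)
  also have "\<dots> = l * (s - (1 - fps_X))"
    unfolding quad[symmetric] by (simp add: s_def algebra_simps)
  finally have sq: "2 * fps_X * \<eta> * s = s - (1 - fps_X)"
    using l0 by (metis mult_cancel_left fps_zero_nth zero_neq_one)
  define V where "V = (1 - fps_X) * inverse s"
  have s0: "s $ 0 = 1" by (simp add: s_def l0 fps_numeral_nth)
  have Vs: "V * s = 1 - fps_X"
    using inverse_mult_eq_1[of s] s0 by (simp add: V_def mult.assoc)
  have "(2 * fps_X * \<eta>) * s = (1 - V) * s" unfolding sq left_diff_distrib Vs by simp
  then have XV: "2 * fps_X * \<eta> = 1 - V" using s0 by (metis mult_cancel_right fps_zero_nth zero_neq_one)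
  have "V\<^sup>2 * s\<^sup>2 = (1 - fps_X)\<^sup>2" unfolding Vs[symmetric] by (simp add: power_mult_distrib)
  then have "V $ k = of_real (\<Sum>i=1..k. inverse_sqrt_coeff i * x ^ i * real ((k + i - 1) choose (2 * i - 1)))"
    unfolding s2 by (rule fps_nth_inverse_sqrt) (use k s0 in \<open>auto simp: V_def\<close>)
  moreover have "(2 * fps_X * \<eta>) $ k = 2 * \<eta> $ (k - 1)"
    using k by (simp add: numeral_fps_const mult.assoc)
  ultimately show ?thesis using XV k unfolding x_def by simp
qed

text \<open>The Fourier coefficients of $(1 - \cos\theta)^m$.\<close>

definition sum_rule_coeff :: "nat \<Rightarrow> nat \<Rightarrow> real" where
  "sum_rule_coeff m k = (-1) ^ k * real ((2 * m) choose (m + k)) / 2 ^ m"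

text \<open>The contribution of one step to the weighted integral of log|Phi_N^*|^2. The factor 2
  comes from log|f|^2 = 2 Re log f, and 1/k from passing from the logarithmic derivative to the
  logarithm; k = 0 is absent because the logarithm vanishes at 0.\<close>

definition sum_rule_term :: "nat \<Rightarrow> (nat \<Rightarrow> complex) \<Rightarrow> nat \<Rightarrow> complex" where
  "sum_rule_term m \<alpha> n = (\<Sum>k=1..m. of_real (2 * sum_rule_coeff m k / real k) * log_deriv_fps \<alpha> n $ (k - 1))"

text \<open>Only the diagonal polynomial has to be found, and for each a one late index of the
  constant sequence suffices. There the coefficients are those of the inverse square root, and after
  swapping sums \<open>alternating_binomial_sum\<close> evaluates the sum over k to a multiple of
  1/i.\<close>

lemma sum_rule_term_bounded:
  assumes "\<And>n. norm (\<alpha> n) < 1" "summable (\<lambda>n. (norm (\<alpha> (Suc n) - \<alpha> n))\<^sup>2)"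
  shows "\<exists>C. \<forall>N. \<bar>\<Sum>n<N. Re (sum_rule_term m \<alpha> n) + sum_rule_coeff m 0 * (\<Sum>i=1..m. ((norm (\<alpha> n))\<^sup>2) ^ i / real i)\<bar> \<le> C"
proof -
  have "shift_poly 0 (sum_rule_term m)"
    unfolding sum_rule_term_def by (intro shift_poly_sum shift_poly_scale shift_poly_log_deriv) simp
  then obtain L n0 where L1: "\<And>a n. n \<ge> n0 \<Longrightarrow> sum_rule_term m (\<lambda>_. a) n = of_real (diag_poly L ((norm a)\<^sup>2))"
    and L2: "\<And>\<alpha>. (\<And>n. norm (\<alpha> n) \<le> 1) \<Longrightarrow> summable (\<lambda>n. (norm (\<alpha> (Suc n) - \<alpha> n))\<^sup>2) \<Longrightarrow>
       \<exists>C. \<forall>N. \<bar>\<Sum>n<N. Re (sum_rule_term m \<alpha> n) - diag_poly L ((norm (\<alpha> n))\<^sup>2)\<bar> \<le> C"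
    by (rule shift_poly_sums) blast
  have "diag_poly L ((norm a)\<^sup>2) = - sum_rule_coeff m 0 * (\<Sum>i=1..m. ((norm a)\<^sup>2) ^ i / real i)" for a :: complex
  proof -
    define x where "x = (norm a)\<^sup>2"
    obtain \<eta> where \<eta>: "fps_stabilizes (log_deriv_fps (\<lambda>_. a)) \<eta>"
      using shift_poly_const_stabilizes[of 0 log_deriv_fps a, OF shift_poly_log_deriv] by blast
    then have "\<forall>\<^sub>F n in sequentially. \<forall>k\<in>{1..m}. log_deriv_fps (\<lambda>_. a) n $ (k - 1) = \<eta> $ (k - 1)"
      by (intro eventually_ball_finite) (auto simp: fps_stabilizes_def)
    then obtain n where n: "n \<ge> n0" "\<And>k. k \<in> {1..m} \<Longrightarrow> log_deriv_fps (\<lambda>_. a) n $ (k - 1) = \<eta> $ (k - 1)"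
      unfolding eventually_sequentially by (metis nle_le)
    have "complex_of_real (diag_poly L x) = sum_rule_term m (\<lambda>_. a) n" using L1[OF n(1)] by (simp add: x_def)
    also have "\<dots> = (\<Sum>k=1..m. of_real (sum_rule_coeff m k / real k) * (2 * \<eta> $ (k - 1)))"
      unfolding sum_rule_term_def by (intro sum.cong refl) (simp add: n del: One_nat_def)
    also have "\<dots> = (\<Sum>k=1..m. of_real (sum_rule_coeff m k / real k * - (\<Sum>i=1..k. inverse_sqrt_coeff i * x ^ i * real ((k + i - 1) choose (2 * i - 1)))))"
      by (intro sum.cong refl) (simp add: log_deriv_const_limit[OF \<eta>] x_def del: of_real_sum One_nat_def)
    finally have "diag_poly L x = (\<Sum>k=1..m. sum_rule_coeff m k / real k * - (\<Sum>i=1..k. inverse_sqrt_coeff i * x ^ i * real ((k + i - 1) choose (2 * i - 1))))"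
      unfolding of_real_sum[symmetric] of_real_eq_iff .
    \<comment> \<open>The binomial vanishes for i > k. Extending the range to m makes it independent
      of k, so that the sums can be swapped.\<close>
    also have "\<dots> = (\<Sum>k=1..m. sum_rule_coeff m k / real k * - (\<Sum>i=1..m. inverse_sqrt_coeff i * x ^ i * real ((k + i - 1) choose (2 * i - 1))))"
      by (intro sum.cong refl arg_cong2[where f = times] arg_cong[where f = uminus] sum.mono_neutral_left) (auto simp: binomial_eq_0)
    also have "\<dots> = (\<Sum>k=1..m. \<Sum>i=1..m. - (x ^ i) / 2 ^ m * ((-1) ^ k * real ((2 * m) choose (m + k)) / real k * (inverse_sqrt_coeff i * real ((k + i - 1) choose (2 * i - 1)))))"
      unfolding sum_negf[symmetric] sum_distrib_left sum_rule_coeff_def by (intro sum.cong refl) (simp add: field_simps)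
    also have "\<dots> = (\<Sum>i=1..m. - (x ^ i) / 2 ^ m * (\<Sum>k=1..m. (-1) ^ k * real ((2 * m) choose (m + k)) / real k * (inverse_sqrt_coeff i * real ((k + i - 1) choose (2 * i - 1)))))"
      unfolding sum_distrib_left by (rule sum.swap)
    also have "\<dots> = (\<Sum>i=1..m. - (x ^ i) / 2 ^ m * (real ((2 * m) choose m) / real i))"
      by (intro sum.cong refl) (subst alternating_binomial_sum; simp)
    also have "\<dots> = - sum_rule_coeff m 0 * (\<Sum>i=1..m. x ^ i / real i)"
      unfolding sum_distrib_left sum_rule_coeff_def by (intro sum.cong refl) simp
    finally show ?thesis by (simp add: x_def)
  qed
  with L2[of \<alpha>] assms show ?thesis by (simp add: less_imp_le)
qed

section \<open>Integrals of logarithms of polynomials\<close>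

lemma angle_measure_density: "angle_measure = density (restrict_space lborel {0..<2 * pi}) (\<lambda>_. ennreal (1 / (2 * pi)))"
proof (rule measure_eqI)
  fix A assume "A \<in> sets angle_measure"
  then have A: "A \<in> sets (restrict_space lborel {0..<2 * pi})" by (simp add: angle_measure_def)
  then have "emeasure (density (restrict_space lborel {0..<2 * pi}) (\<lambda>_. ennreal (1 / (2 * pi)))) A
     = ennreal (1 / (2 * pi)) * emeasure (restrict_space lborel {0..<2 * pi}) A"
    by (rule emeasure_density_const)
  then show "emeasure angle_measure A = emeasure (density (restrict_space lborel {0..<2 * pi}) (\<lambda>_. ennreal (1 / (2 * pi)))) A"
    by (simp add: angle_measure_def)
qed (simp add: angle_measure_def)

lemma space_angle_measure [simp]: "space angle_measure = {0..<2 * pi}"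
  by (simp add: angle_measure_def space_scale_measure space_restrict_space)

lemma sets_angle_measure: "sets angle_measure = sets (restrict_space borel {0..<2 * pi})"
  by (simp add: angle_measure_def sets_restrict_space)

interpretation angle: prob_space angle_measure
proof
  have "emeasure (restrict_space lborel {0..<2 * pi}) {0..<2 * pi} = ennreal (2 * pi)"
    by (subst emeasure_restrict_space) auto
  then have "emeasure angle_measure (space angle_measure) = ennreal (1 / (2 * pi)) * ennreal (2 * pi)"
    by (simp add: angle_measure_def space_restrict_space space_scale_measure)
  also have "\<dots> = 1" by (simp add: ennreal_mult[symmetric])
  finally show "emeasure angle_measure (space angle_measure) = 1" .
qed

lemma measurable_angle_measure: "f \<in> borel_measurable borel \<Longrightarrow> f \<in> borel_measurable angle_measure"
  using measurable_restrict_space1[of f borel borel "{0..<2 * pi}"] measurable_cong_sets[OF sets_angle_measure refl] by blast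

lemma integral_angle_measure:
  fixes g :: "real \<Rightarrow> complex"
  assumes g: "continuous_on UNIV g"
  shows "integral\<^sup>L angle_measure g = (1 / (2 * pi)) *\<^sub>R integral {0..2 * pi} g"
proof -
  have gm: "g \<in> borel_measurable borel" using g by (rule borel_measurable_continuous_onI)
  have "integral\<^sup>L angle_measure g = (1 / (2 * pi)) *\<^sub>R integral\<^sup>L (restrict_space lborel {0..<2 * pi}) g"
    unfolding angle_measure_density
    by (subst integral_density) (use gm in \<open>auto intro!: measurable_restrict_space1\<close>)
  also have "integral\<^sup>L (restrict_space lborel {0..<2 * pi}) g = (LINT x:{0..<2 * pi}|lborel. g x)"
    unfolding set_lebesgue_integral_def by (rule integral_restrict_space) simp
  \<comment> \<open>The half-open and the closed period differ by the null set
    \<open>{2 * pi}\<close>.\<close>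
  also have "\<dots> = (LINT x:{0..2 * pi}|lborel. g x)"
    unfolding set_lebesgue_integral_def
    by (rule integral_cong_AE) (use gm in \<open>auto intro!: AE_I'[of "{2 * pi}"] simp: indicator_def split: if_splits\<close>)
  also have "\<dots> = integral {0..2 * pi} g"
    by (rule set_borel_integral_eq_integral) (rule borel_integrable_atLeastAtMost', rule continuous_on_subset[OF g], simp)
  finally show ?thesis .
qed

lemma integrable_angle_bounded:
  fixes g :: "real \<Rightarrow> 'a :: {banach, second_countable_topology}"
  assumes "g \<in> borel_measurable angle_measure" "\<And>t. norm (g t) \<le> B"
  shows "integrable angle_measure g"
  by (rule angle.integrable_const_bound[of _ B]) (use assms in auto)

text \<open>Cauchy's formula for derivatives at 0; \<open>R > 1\<close> puts the closed unit disc
  inside the domain of holomorphy.\<close>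

lemma circle_coefficient:
  assumes h: "h holomorphic_on ball 0 R" and R: "R > 1" and H: "h has_fps_expansion H"
  shows "(\<integral>t. h (cis t) / cis t ^ k \<partial>angle_measure) = H $ k"
proof -
  have sub: "cball 0 1 \<subseteq> ball (0::complex) R" using R by auto
  have ch: "continuous_on (cball 0 1) h"
    using h sub by (meson continuous_on_subset holomorphic_on_imp_continuous_on)
  have cont: "continuous_on UNIV (\<lambda>t. h (cis t) / cis t ^ k)"
    by (intro continuous_intros continuous_on_compose2[OF ch]) auto
  have "contour_integral (circlepath 0 1) (\<lambda>u. h u / (u - 0) ^ Suc k) = 2 * pi * \<i> * (deriv ^^ k) h 0 / fact k"
    by (rule Cauchy_contour_integral_circlepath) (use ch holomorphic_on_subset[OF h subset_ball[of 1 R 0]] R in auto)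
  also have "\<dots> = 2 * pi * \<i> * H $ k" using fps_nth_fps_expansion[OF H, of k] by simp
  also have "contour_integral (circlepath 0 1) (\<lambda>u. h u / (u - 0) ^ Suc k)
    = integral {0..2 * pi} (\<lambda>t. h (cis t) / cis t ^ Suc k * \<i> * cis t)"
    unfolding circlepath_def by (subst contour_integral_part_circlepath_eq) simp_all
  also have "(\<lambda>t. h (cis t) / cis t ^ Suc k * \<i> * cis t) = (\<lambda>t. \<i> * (h (cis t) / cis t ^ k))"
    by (rule ext) (simp add: field_simps)
  also have "integral {0..2 * pi} (\<lambda>t. \<i> * (h (cis t) / cis t ^ k)) = \<i> * integral {0..2 * pi} (\<lambda>t. h (cis t) / cis t ^ k)"
    by (rule integral_mult_right)
  finally have "integral {0..2 * pi} (\<lambda>t. h (cis t) / cis t ^ k) = 2 * pi * H $ k"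
    by (simp add: field_simps)
  then show ?thesis by (simp add: integral_angle_measure[OF cont] scaleR_conv_of_real)
qed

lemma poly_has_fps_expansion: "poly p has_fps_expansion fps_of_poly p" for p :: "complex poly"
  by (simp add: has_fps_expansion_def)

lemma one_minus_cos_cis: "complex_of_real (1 - cos t) = (- 1 / 2) * (1 - cis t)\<^sup>2 / cis t"
proof -
  have "complex_of_real (2 * cos t) = cis t + inverse (cis t)"
    by (simp add: complex_eq_iff)
  then show ?thesis by (simp add: field_simps power2_eq_square)
qed

lemma one_minus_fps_X_power_nth: "((1 - fps_X :: complex fps) ^ n) $ k = (-1) ^ k * of_nat (n choose k)"
proof -
  have "(1 - fps_X :: complex fps) ^ n = (1 - fps_const 1 * fps_X) ^ n" by simp
  also have "\<dots> = fps_binomial (of_nat n) oo (- fps_const 1 * fps_X)" by (rule one_minus_const_fps_X_power) simp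
  also have "\<dots> $ k = (-1) ^ k * (of_nat n gchoose k)"
    by (simp only: fps_const_neg fps_nth_compose_linear fps_binomial_nth)
  finally show ?thesis by (simp add: binomial_gbinomial)
qed

text \<open>The zero-free set is open and contains the compact closed disc, hence a uniform
  neighbourhood of it. This gives room for a holomorphic logarithm, or a reciprocal, across the unit
  circle.\<close>

lemma nonvanishing_larger_ball:
  fixes p :: "complex poly"
  assumes nz: "\<And>z. norm z \<le> 1 \<Longrightarrow> poly p z \<noteq> 0"
  obtains R where "R > 1" "\<And>z. z \<in> ball 0 R \<Longrightarrow> poly p z \<noteq> 0"
proof -
  have "compact (cball (0::complex) 1)" "cball 0 1 \<subseteq> {z. poly p z \<noteq> 0}" "open {z. poly p z \<noteq> 0}"
    using nz by (auto intro!: open_Collect_neq continuous_intros)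
  then obtain e where e: "e > 0" "(\<Union>x\<in>cball 0 1. ball x e) \<subseteq> {z. poly p z \<noteq> 0}"
    by (elim compact_subset_open_imp_ball_epsilon_subset)
  define R where "R = 1 + e"
  have R: "R > 1" using e by (simp add: R_def)
  have nzR: "poly p z \<noteq> 0" if "z \<in> ball 0 R" for z
  proof (cases "norm z \<le> 1")
    case False
    \<comment> \<open>The radial projection to the circle is a point of the closed disc at distance
      |z| - 1 < e.\<close>
    have "dist (z / of_real (norm z)) z < e"
    proof -
      have "complex_of_real (norm z) \<noteq> 0" using False by auto
      then have "z / of_real (norm z) - z = (z / of_real (norm z)) * of_real (1 - norm z)"
        by (simp add: right_diff_distrib)
      moreover have "z \<noteq> 0" using False by auto
      ultimately have "dist (z / of_real (norm z)) z = \<bar>1 - norm z\<bar>"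
        using False by (simp add: dist_norm norm_mult norm_divide del: of_real_diff)
      then show ?thesis using that False by (simp add: R_def)
    qed
    moreover have "z / of_real (norm z) \<in> cball 0 1" using False by (simp add: norm_divide)
    ultimately have "z \<in> (\<Union>x\<in>cball 0 1. ball x e)" by (intro UN_I[of "z / of_real (norm z)"]) auto
    then show ?thesis using e(2) by blast
  qed (use nz in auto)
  from R nzR show thesis by (rule that)
qed

text \<open>With a logarithm g of p on a larger disc, log|p|^2 = 2 Re g. The weight is a
  trigonometric polynomial of degree m, so the integral sees only Taylor coefficients of g up to m;
  these are read off from g' = \<open>E\<close>.\<close>

lemma integral_log_poly:
  fixes p :: "complex poly" and E :: "complex fps"
  assumes p0: "coeff p 0 = 1" and nz: "\<And>z. norm z \<le> 1 \<Longrightarrow> poly p z \<noteq> 0"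
    and E: "fps_deriv (fps_of_poly p) = fps_of_poly p * E"
  shows "(\<integral>t. (1 - cos t) ^ m * ln ((norm (poly p (cis t)))\<^sup>2) \<partial>angle_measure)
     = (\<Sum>k=1..m. 2 * sum_rule_coeff m k / real k * Re (E $ (k - 1)))"
proof -
  obtain R where R: "R > 1" and nzR: "\<And>z. z \<in> ball 0 R \<Longrightarrow> poly p z \<noteq> 0"
    using nonvanishing_larger_ball[of p] nz by blast
  obtain g0 where g0: "g0 holomorphic_on ball 0 R" "\<And>z. z \<in> ball 0 R \<Longrightarrow> exp (g0 z) = poly p z"
    by (rule holomorphic_logarithm_exists[of "ball 0 R" "poly p" 0]) (use nzR R in \<open>auto intro!: holomorphic_intros\<close>)
  \<comment> \<open>Since p(0) = 1, subtracting \<open>g0 0\<close> still gives a logarithm of p,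
    and now its constant coefficient is 0.\<close>
  define g where "g z = g0 z - g0 0" for z
  have g_hol: "g holomorphic_on ball 0 R" unfolding g_def by (intro holomorphic_intros g0)
  have "exp (g0 0) = 1" using g0(2)[of 0] R p0 by (simp add: poly_0_coeff_0)
  then have g_exp: "exp (g z) = poly p z" if "z \<in> ball 0 R" for z
    using g0(2)[OF that] by (simp add: g_def exp_diff)
  define G where "G = fps_expansion g 0"
  have G: "g has_fps_expansion G" unfolding G_def
    by (rule has_fps_expansion_fps_expansion[of "ball 0 R"]) (use g_hol R in auto)
  have "(\<lambda>z. poly p z * deriv g z) has_fps_expansion fps_of_poly p * fps_deriv G"
    by (intro has_fps_expansion_mult has_fps_expansion_deriv poly_has_fps_expansion G)
  moreover have "\<forall>\<^sub>F z in nhds 0. poly p z * deriv g z = deriv (poly p) z"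
  proof (rule eventually_nhds_in_open[THEN eventually_mono])
    fix z assume z: "z \<in> ball (0::complex) R"
    have gd: "(g has_field_derivative deriv g z) (at z)"
      using g_hol z by (simp add: holomorphic_derivI)
    have "((\<lambda>z. exp (g z)) has_field_derivative exp (g z) * deriv g z) (at z)"
      by (rule DERIV_fun_exp[OF gd])
    then have "(poly p has_field_derivative exp (g z) * deriv g z) (at z)"
      by (rule has_field_derivative_transform_within_open[of _ _ _ "ball 0 R"]) (use z g_exp in auto)
    then show "poly p z * deriv g z = deriv (poly p) z" using g_exp[OF z] DERIV_imp_deriv by metis
  qed (use R in auto)
  ultimately have "deriv (poly p) has_fps_expansion fps_of_poly p * fps_deriv G"
    by (simp cong: has_fps_expansion_cong)
  moreover have "deriv (poly p) has_fps_expansion fps_deriv (fps_of_poly p)"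
    by (intro has_fps_expansion_deriv poly_has_fps_expansion)
  ultimately have "fps_of_poly p * fps_deriv G = fps_of_poly p * E"
    unfolding E[symmetric] by (metis fps_ext fps_nth_fps_expansion)
  moreover have "fps_of_poly p \<noteq> 0" using p0 by auto
  ultimately have GE: "fps_deriv G = E" by simp
  have G0: "G $ 0 = 0" using fps_nth_fps_expansion[OF G, of 0] by (simp add: g_def)
  have GEk: "G $ k = E $ (k - 1) / of_nat k" if "k \<ge> 1" for k
  proof -
    have "of_nat k * G $ k = E $ (k - 1)" using that GE[symmetric] by (cases k) auto
    then show ?thesis using that by (simp add: field_simps)
  qed
  \<comment> \<open>On the circle 1 - cos t = -(1 - z)^2 / (2 z), so the weighted integral of g is
    (-1/2)^m times coefficient m of this function.\<close>
  let ?h = "\<lambda>z. (1 - z) ^ (2 * m) * g z"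
  have h_hol: "?h holomorphic_on ball 0 R" by (intro holomorphic_intros g_hol)
  have h_exp: "?h has_fps_expansion (1 - fps_X) ^ (2 * m) * G"
    by (intro has_fps_expansion_mult has_fps_expansion_power has_fps_expansion_diff G) (auto intro: has_fps_expansion_fps_X)
  have int_eq: "of_real ((1 - cos t) ^ m) * g (cis t) = (- 1 / 2) ^ m * (?h (cis t) / cis t ^ m)" for t
  proof -
    have "complex_of_real ((1 - cos t) ^ m) = ((- 1 / 2) * (1 - cis t)\<^sup>2 / cis t) ^ m"
      unfolding of_real_power one_minus_cos_cis ..
    also have "\<dots> = (- 1 / 2) ^ m * (1 - cis t) ^ (2 * m) / cis t ^ m"
      by (simp only: power_divide power_mult_distrib power_mult)
    finally show ?thesis by simp
  qed
  have gc: "continuous_on (sphere 0 1) g"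
    by (rule continuous_on_subset[OF holomorphic_on_imp_continuous_on[OF g_hol]]) (use R in auto)
  have cont: "continuous_on UNIV (\<lambda>t. complex_of_real ((1 - cos t) ^ m) * g (cis t))"
    by (intro continuous_intros continuous_on_compose2[OF gc]) auto
  have intg: "integrable angle_measure (\<lambda>t. complex_of_real ((1 - cos t) ^ m) * g (cis t))"
  proof -
    obtain B where "\<forall>y\<in>g ` sphere 0 1. norm y \<le> B"
      using compact_imp_bounded[OF compact_continuous_image[OF gc compact_sphere]] unfolding bounded_iff by blast
    then have B: "norm (g z) \<le> B" if "z \<in> sphere 0 1" for z using that by blast
    show ?thesis
    proof (rule integrable_angle_bounded[where B = "2 ^ m * B"])
      fix t :: real
      have "\<bar>1 - cos t\<bar> \<le> 2" using cos_le_one[of t] cos_ge_minus_one[of t] by linarith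
      then have "\<bar>1 - cos t\<bar> ^ m \<le> 2 ^ m" by (intro power_mono) auto
      then show "norm (complex_of_real ((1 - cos t) ^ m) * g (cis t)) \<le> 2 ^ m * B"
        unfolding norm_mult using B[of "cis t"] by (intro mult_mono) (auto simp: power_abs simp del: of_real_power)
    qed (rule measurable_angle_measure, rule borel_measurable_continuous_onI, rule cont)
  qed
  have "(\<integral>t. (1 - cos t) ^ m * ln ((norm (poly p (cis t)))\<^sup>2) \<partial>angle_measure) = 
     (\<integral>t. 2 * Re (complex_of_real ((1 - cos t) ^ m) * g (cis t)) \<partial>angle_measure)"
  proof (rule Bochner_Integration.integral_cong[OF refl])
    fix t
    have "norm (poly p (cis t)) = exp (Re (g (cis t)))" using g_exp[of "cis t"] R by (metis norm_exp_eq_Re mem_ball_0 norm_cis)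
    then show "(1 - cos t) ^ m * ln ((norm (poly p (cis t)))\<^sup>2) = 2 * Re (complex_of_real ((1 - cos t) ^ m) * g (cis t))"
      by (simp add: ln_realpow del: of_real_power)
  qed
  also have "\<dots> = 2 * Re (\<integral>t. complex_of_real ((1 - cos t) ^ m) * g (cis t) \<partial>angle_measure)"
    using integral_Re[OF intg] by simp
  also have "(\<integral>t. complex_of_real ((1 - cos t) ^ m) * g (cis t) \<partial>angle_measure) = (- 1 / 2) ^ m * (((1 - fps_X) ^ (2 * m) * G) $ m)"
    unfolding int_eq integral_mult_right_zero circle_coefficient[OF h_hol R h_exp] ..
  also have "((1 - fps_X) ^ (2 * m) * G) $ m = (\<Sum>k=0..m. G $ k * ((1 - fps_X) ^ (2 * m)) $ (m - k))"
    by (subst mult.commute) (simp add: fps_mult_nth)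
  also have "\<dots> = (\<Sum>k=1..m. G $ k * ((1 - fps_X) ^ (2 * m)) $ (m - k))"
    by (simp add: sum.atLeast_Suc_atMost[of 0] G0)
  also have "(- 1 / 2) ^ m * \<dots> = (\<Sum>k=1..m. of_real (sum_rule_coeff m k / real k) * E $ (k - 1))"
    unfolding sum_distrib_left
  proof (intro sum.cong refl)
    fix k assume k: "k \<in> {1..m}"
    have "(2 * m) choose (m - k) = (2 * m) choose (m + k)"
      using k by (subst binomial_symmetric) (auto intro: arg_cong2[where f = binomial])
    moreover have "(-1 :: complex) ^ m * (-1) ^ (m - k) = (-1) ^ k"
      using k by (auto simp: minus_one_power_iff)
    then have "(- 1 / 2 :: complex) ^ m * (-1) ^ (m - k) = (-1) ^ k / 2 ^ m"
      unfolding power_divide by (simp only: times_divide_eq_left)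
    then have "(- 1 / 2) ^ m * (G $ k * ((-1) ^ (m - k) * c)) = (-1) ^ k / 2 ^ m * (G $ k * c)" for c
      by (metis (no_types, lifting) mult.assoc mult.left_commute)
    ultimately show "(- 1 / 2) ^ m * (G $ k * ((1 - fps_X) ^ (2 * m)) $ (m - k)) = of_real (sum_rule_coeff m k / real k) * E $ (k - 1)"
      using k by (simp only: one_minus_fps_X_power_nth) (simp add: GEk sum_rule_coeff_def)
  qed
  finally show ?thesis by (simp add: sum_distrib_left mult.assoc)
qed

lemma integral_log_rev_poly:
  assumes nz: "\<And>z. norm z \<le> 1 \<Longrightarrow> poly (rev_poly \<alpha> N) z \<noteq> 0"
  shows "(\<integral>t. (1 - cos t) ^ m * ln ((norm (poly (rev_poly \<alpha> N) (cis t)))\<^sup>2) \<partial>angle_measure)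
     = (\<Sum>n<N. Re (sum_rule_term m \<alpha> n))"
proof -
  have "(\<integral>t. (1 - cos t) ^ m * ln ((norm (poly (rev_poly \<alpha> N) (cis t)))\<^sup>2) \<partial>angle_measure)
    = (\<Sum>k=1..m. 2 * sum_rule_coeff m k / real k * Re ((\<Sum>n<N. log_deriv_fps \<alpha> n) $ (k - 1)))"
    by (rule integral_log_poly) (use nz deriv_rev_fps in auto)
  also have "\<dots> = (\<Sum>k=1..m. \<Sum>n<N. 2 * sum_rule_coeff m k / real k * Re (log_deriv_fps \<alpha> n $ (k - 1)))"
    by (simp add: fps_sum_nth sum_distrib_left)
  also have "\<dots> = (\<Sum>n<N. \<Sum>k=1..m. 2 * sum_rule_coeff m k / real k * Re (log_deriv_fps \<alpha> n $ (k - 1)))"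
    by (rule sum.swap)
  finally show ?thesis by (simp add: sum_rule_term_def)
qed

section \<open>Orthogonality and Bernstein--Szego measures\<close>

text \<open>Links the recursively defined \<open>rev_poly\<close> to the reversal in the recursion
  for the orthonormal polynomials. The two identities are proved together because each recursion
  mixes both polynomials.\<close>

lemma rev_poly_reverse:
  assumes "z \<noteq> 0"
  shows "z ^ n * cnj (poly (monic_poly \<alpha> n) (1 / cnj z)) = poly (rev_poly \<alpha> n) z"
    and "z ^ n * cnj (poly (rev_poly \<alpha> n) (1 / cnj z)) = poly (monic_poly \<alpha> n) z"
proof (induction n)
  case (Suc n)
  {
    case 1
    show ?case using assms
      by (simp add: monic_poly_Suc rev_poly_Suc Suc[symmetric] algebra_simps)
  next
    case 2
    show ?case using assms
      by (simp add: monic_poly_Suc rev_poly_Suc Suc[symmetric] algebra_simps)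
  }
qed simp_all

lemma cnj_mult_circle: "norm z = 1 \<Longrightarrow> cnj z * z = 1"
  using complex_norm_square[of z] by (simp add: mult.commute)

lemma cnj_circle: "norm z = 1 \<Longrightarrow> 1 / cnj z = z"
  using cnj_mult_circle[of z] by (auto simp: divide_eq_eq mult.commute)

lemma poly_rev_circle:
  assumes "norm z = 1"
  shows "poly (rev_poly \<alpha> n) z = z ^ n * cnj (poly (monic_poly \<alpha> n) z)"
    and "poly (monic_poly \<alpha> n) z = z ^ n * cnj (poly (rev_poly \<alpha> n) z)"
proof -
  have "z \<noteq> 0" using assms by auto
  from rev_poly_reverse[OF this, of n \<alpha>] cnj_circle[OF assms]
  show "poly (rev_poly \<alpha> n) z = z ^ n * cnj (poly (monic_poly \<alpha> n) z)"
    and "poly (monic_poly \<alpha> n) z = z ^ n * cnj (poly (rev_poly \<alpha> n) z)" by simp_all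
qed

lemma norm_rev_circle: "norm z = 1 \<Longrightarrow> norm (poly (rev_poly \<alpha> n) z) = norm (poly (monic_poly \<alpha> n) z)"
  by (simp add: poly_rev_circle(1) norm_mult norm_power)

text \<open>The transfer matrix preserves the indefinite form |v|^2 - |u|^2 up to the factor 1 -
  |a|^2.\<close>

lemma norm_szego_identity:
  fixes u v a :: complex
  shows "(norm (v - a * u))\<^sup>2 - (norm (u - cnj a * v))\<^sup>2 = (1 - (norm a)\<^sup>2) * ((norm v)\<^sup>2 - (norm u)\<^sup>2)"
  unfolding cmod_power2 by (simp add: power2_eq_square algebra_simps)

text \<open>The invariant |Phi_n| <= |Phi_n^*| on the closed disc gives |\<alpha>_n z Phi_n| <
  |Phi_n^*|, so Phi_(n+1)^* has no zero there, and \<open>norm_szego_identity\<close> carries the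
  invariant over to n + 1.\<close>

lemma rev_poly_nonzero:
  assumes \<alpha>: "\<And>n. norm (\<alpha> n) < 1" and z: "norm z \<le> 1"
  shows "poly (rev_poly \<alpha> n) z \<noteq> 0 \<and> norm (poly (monic_poly \<alpha> n) z) \<le> norm (poly (rev_poly \<alpha> n) z)"
proof (induction n)
  case (Suc n)
  let ?u = "z * poly (monic_poly \<alpha> n) z" and ?v = "poly (rev_poly \<alpha> n) z"
  have uv: "norm ?u \<le> norm ?v"
    using Suc z mult_mono[of "norm z" 1 "norm (poly (monic_poly \<alpha> n) z)" "norm ?v"] by (simp add: norm_mult)
  have "norm (\<alpha> n * ?u) < norm ?v"
  proof -
    have "norm (\<alpha> n) * norm ?u \<le> norm (\<alpha> n) * norm ?v" using uv by (intro mult_left_mono) auto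
    also have "\<dots> < 1 * norm ?v" using \<alpha>[of n] Suc by (intro mult_strict_right_mono) auto
    finally show ?thesis by (simp add: norm_mult)
  qed
  then have "?v - \<alpha> n * ?u \<noteq> 0" by auto
  moreover have "(norm (?u - cnj (\<alpha> n) * ?v))\<^sup>2 \<le> (norm (?v - \<alpha> n * ?u))\<^sup>2"
  proof -
    have "0 \<le> (1 - (norm (\<alpha> n))\<^sup>2) * ((norm ?v)\<^sup>2 - (norm ?u)\<^sup>2)"
      using uv \<alpha>[of n] by (intro mult_nonneg_nonneg) (auto simp: power_le_one less_imp_le)
    then show ?thesis using norm_szego_identity[of ?v "\<alpha> n" ?u] by linarith
  qed
  then have "norm (?u - cnj (\<alpha> n) * ?v) \<le> norm (?v - \<alpha> n * ?u)" by (rule power2_le_imp_le) simp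
  ultimately show ?case by (simp add: monic_poly_Suc rev_poly_Suc mult.left_commute)
qed simp

lemma coeff_szego_above: "k > n \<Longrightarrow> coeff (monic_poly \<alpha> n) k = 0 \<and> coeff (rev_poly \<alpha> n) k = 0"
  by (induction n arbitrary: k) (auto simp: monic_poly_Suc rev_poly_Suc coeff_pCons split: nat.splits)

lemma coeff_monic_top: "coeff (monic_poly \<alpha> n) n = 1"
  by (induction n) (auto simp: monic_poly_Suc coeff_szego_above)

section \<open>Orthogonal polynomials of a finite measure on the circle\<close>

locale circle_measure = finite_measure M for M :: "complex measure" +
  assumes sets_M: "sets M = sets circle_borel"
begin

lemma space_M: "space M = sphere 0 1"
  using sets_eq_imp_space_eq[OF sets_M] by (simp add: circle_borel_def space_restrict_space)

lemma measurable_M: "continuous_on (sphere 0 1) f \<Longrightarrow> f \<in> borel_measurable M"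
  for f :: "complex \<Rightarrow> 'b :: topological_space"
  unfolding measurable_cong_sets[OF sets_M refl] circle_borel_def by (rule borel_measurable_continuous_on_restrict)

lemma integrable_M:
  fixes f :: "complex \<Rightarrow> 'b :: {banach, second_countable_topology}"
  assumes "continuous_on (sphere 0 1) f" 
  shows "integrable M f"
proof -
  obtain B where "\<forall>y\<in>f ` sphere 0 1. norm y \<le> B"
    using compact_imp_bounded[OF compact_continuous_image[OF assms compact_sphere]] unfolding bounded_iff by blast
  then show ?thesis
    by (intro integrable_const_bound[of _ B] measurable_M assms AE_I2) (auto simp: space_M)
qed

lemma integrable_inner: "integrable M (\<lambda>z. cnj (poly p z) * poly q z)"
  by (intro integrable_M continuous_intros)

lemma inner_diff_right: "poly_inner M p (q - r) = poly_inner M p q - poly_inner M p r"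
  unfolding poly_inner_def by (simp add: right_diff_distrib integrable_inner)

lemma inner_add_right: "poly_inner M p (q + r) = poly_inner M p q + poly_inner M p r"
  unfolding poly_inner_def by (simp add: distrib_left integrable_inner)

lemma inner_smult_right: "poly_inner M p (smult c q) = c * poly_inner M p q"
  unfolding poly_inner_def by (simp add: mult.left_commute)

lemma inner_commute: "poly_inner M q p = cnj (poly_inner M p q)"
proof -
  have "poly_inner M q p = (\<integral>z. cnj (cnj (poly p z) * poly q z) \<partial>M)"
    by (simp add: poly_inner_def mult.commute)
  also have "\<dots> = cnj (poly_inner M p q)" unfolding poly_inner_def by (rule Bochner_Integration.integral_cnj)
  finally show ?thesis .
qed

lemma inner_add_left: "poly_inner M (q + r) p = poly_inner M q p + poly_inner M r p"
  using inner_add_right[of p q r] by (metis complex_cnj_add inner_commute)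

lemma inner_smult_left: "poly_inner M (smult c q) p = cnj c * poly_inner M q p"
  using inner_smult_right[of p c q] by (metis complex_cnj_mult inner_commute)

lemma inner_zero_right: "poly_inner M p 0 = 0"
  unfolding poly_inner_def by simp

lemma inner_sum_right: "finite I \<Longrightarrow> poly_inner M p (\<Sum>i\<in>I. f i) = (\<Sum>i\<in>I. poly_inner M p (f i))"
  by (induction I rule: finite_induct) (auto simp: inner_add_right inner_zero_right)

lemma inner_pCons: "poly_inner M (pCons 0 p) (pCons 0 q) = poly_inner M p q"
  unfolding poly_inner_def
proof (rule Bochner_Integration.integral_cong[OF refl])
  fix z assume "z \<in> space M"
  then have "cnj z * z = 1" by (simp add: space_M cnj_mult_circle)
  moreover have "cnj (poly (pCons 0 p) z) * poly (pCons 0 q) z = (cnj z * z) * (cnj (poly p z) * poly q z)"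
    by (simp add: mult_ac)
  ultimately show "cnj (poly (pCons 0 p) z) * poly (pCons 0 q) z = cnj (poly p z) * poly q z" by simp
qed

lemma inner_self: "poly_inner M p p = of_real (\<integral>z. (norm (poly p z))\<^sup>2 \<partial>M)"
proof -
  have "poly_inner M p p = (\<integral>z. of_real ((norm (poly p z))\<^sup>2) \<partial>M)"
    unfolding poly_inner_def by (simp add: complex_norm_square mult.commute del: of_real_power)
  then show ?thesis by (simp del: of_real_power)
qed

lemma inner_monomials_zero:
  assumes "\<And>k. coeff q k \<noteq> 0 \<Longrightarrow> poly_inner M p (monom 1 k) = 0"
  shows "poly_inner M p q = 0"
proof -
  have "q = (\<Sum>i\<le>degree q. smult (coeff q i) (monom 1 i))"
    using poly_as_sum_of_monoms[of q] by (simp add: smult_monom)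
  then have "poly_inner M p q = (\<Sum>i\<le>degree q. coeff q i * poly_inner M p (monom 1 i))"
    by (metis (no_types, lifting) inner_sum_right finite_atMost inner_smult_right sum.cong)
  also have "\<dots> = 0" using assms by (intro sum.neutral) auto
  finally show ?thesis .
qed

text \<open>Says that the polynomial built from \<alpha> is the monic orthogonal polynomial of
  degree n of \<open>M\<close>, with the norm predicted by \<alpha>. For |\<alpha>_i| < 1 this
  passes to all smaller degrees and so fixes inner products up to degree n.\<close>

definition szego_orthogonal :: "(nat \<Rightarrow> complex) \<Rightarrow> nat \<Rightarrow> bool" where
  "szego_orthogonal \<alpha> n \<longleftrightarrow> (\<forall>k<n. poly_inner M (monic_poly \<alpha> n) (monom 1 k) = 0) \<and>
     poly_inner M (monic_poly \<alpha> n) (monic_poly \<alpha> n) = of_real (\<Prod>i<n. 1 - (norm (\<alpha> i))\<^sup>2)"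

text \<open>On the circle Phi_n^* = z^n conj(Phi_n), so pairing it with z^k amounts to pairing Phi_n
  with z^(n-k). The orthogonality range 0..n-1 becomes 1..n.\<close>

lemma rev_orthogonal:
  assumes "\<And>k. k < n \<Longrightarrow> poly_inner M (monic_poly \<alpha> n) (monom 1 k) = 0" "1 \<le> k" "k \<le> n"
  shows "poly_inner M (rev_poly \<alpha> n) (monom 1 k) = 0"
proof -
  have "poly_inner M (rev_poly \<alpha> n) (monom 1 k) = poly_inner M (monom 1 (n - k)) (monic_poly \<alpha> n)"
    unfolding poly_inner_def
  proof (rule Bochner_Integration.integral_cong[OF refl])
    fix z assume "z \<in> space M"
    then have z: "norm z = 1" by (simp add: space_M)
    then have zz: "cnj z * z = 1" by (rule cnj_mult_circle)
    have "cnj z ^ n * z ^ k = cnj z ^ (n - k) * (cnj z * z) ^ k"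
      using assms(3) by (simp add: power_mult_distrib mult.assoc[symmetric] power_add[symmetric])
    then show "cnj (poly (rev_poly \<alpha> n) z) * poly (monom 1 k) z = cnj (poly (monom 1 (n - k)) z) * poly (monic_poly \<alpha> n) z"
      by (simp add: poly_rev_circle(1)[OF z] poly_monom zz)
  qed
  also have "\<dots> = cnj (poly_inner M (monic_poly \<alpha> n) (monom 1 (n - k)))" by (rule inner_commute)
  also have "\<dots> = 0" using assms by simp
  finally show ?thesis .
qed

text \<open>Inverse recursion: $(1 - |\alpha_n|^2) z \Phi_n = \Phi_{n+1} + \bar\alpha_n \Phi_{n+1}^*$.\<close>

lemma szego_orthogonal_descend:
  assumes \<alpha>: "norm (\<alpha> n) < 1" and o: "szego_orthogonal \<alpha> (Suc n)"
  shows "szego_orthogonal \<alpha> n"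
proof -
  let ?A = "monic_poly \<alpha>" and ?B = "rev_poly \<alpha>"
  define r where "r = 1 - (norm (\<alpha> n))\<^sup>2"
  have r: "r > 0" using \<alpha> by (simp add: r_def power_less_one_iff abs_square_less_1)
  have orth: "poly_inner M (?A (Suc n)) (monom 1 k) = 0" if "k < Suc n" for k
    using o that by (auto simp: szego_orthogonal_def)
  have rorth: "poly_inner M (?B (Suc n)) (monom 1 k) = 0" if "1 \<le> k" "k \<le> Suc n" for k
    by (rule rev_orthogonal) (use orth that in auto)
  have "cnj (\<alpha> n) * \<alpha> n = of_real ((norm (\<alpha> n))\<^sup>2)" by (metis complex_norm_square mult.commute)
  then have inv: "smult (of_real r) (pCons 0 (?A n)) = ?A (Suc n) + smult (cnj (\<alpha> n)) (?B (Suc n))"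
    by (simp add: monic_poly_Suc rev_poly_Suc r_def smult_diff_right smult_diff_left del: of_real_power)
  have key: "of_real r * poly_inner M (pCons 0 (?A n)) q = poly_inner M (?A (Suc n)) q + \<alpha> n * poly_inner M (?B (Suc n)) q" for q
    using arg_cong[OF inv, of "\<lambda>p. poly_inner M p q"] by (simp only: inner_smult_left inner_add_left complex_cnj_complex_of_real complex_cnj_cnj)
  have 1: "poly_inner M (?A n) (monom 1 k) = 0" if "k < n" for k
  proof -
    have "of_real r * poly_inner M (pCons 0 (?A n)) (monom 1 (Suc k)) = 0"
      unfolding key using orth[of "Suc k"] rorth[of "Suc k"] that by simp
    then have "poly_inner M (pCons 0 (?A n)) (pCons 0 (monom 1 k)) = 0"
      using r by (simp add: monom_Suc)
    then show ?thesis by (simp add: inner_pCons)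
  qed
  \<comment> \<open>The polynomial z Phi_n has no constant term and degree at most n + 1, hence only
    monomials orthogonal to Phi_(n+1)^*.\<close>
  have "poly_inner M (?B (Suc n)) (pCons 0 (?A n)) = 0"
  proof (rule inner_monomials_zero, rule rorth)
    fix k assume "coeff (pCons 0 (?A n)) k \<noteq> 0"
    then show "1 \<le> k" "k \<le> Suc n" 
      using coeff_szego_above[of n "k - 1" \<alpha>] by (auto simp: coeff_pCons split: nat.splits) (metis not_less)
  qed
  \<comment> \<open>Both polynomials are monic of degree n + 1, so their difference has degree at
    most n.\<close>
  moreover have "poly_inner M (?A (Suc n)) (pCons 0 (?A n) - ?A (Suc n)) = 0"
  proof (rule inner_monomials_zero, rule orth)
    fix k assume k: "coeff (pCons 0 (?A n) - ?A (Suc n)) k \<noteq> 0"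
    show "k < Suc n"
    proof (rule ccontr)
      assume "\<not> k < Suc n"
      then obtain j where j: "k = Suc j" "j \<ge> n" by (cases k) auto
      then have "coeff (pCons 0 (?A n) - ?A (Suc n)) k = 0"
        using coeff_szego_above[of n "Suc j" \<alpha>] by (simp add: monic_poly_Suc)
      with k show False by simp
    qed
  qed
  then have "poly_inner M (?A (Suc n)) (pCons 0 (?A n)) = poly_inner M (?A (Suc n)) (?A (Suc n))"
    by (simp add: inner_diff_right)
  ultimately have "of_real r * poly_inner M (pCons 0 (?A n)) (pCons 0 (?A n)) = of_real (\<Prod>i<Suc n. 1 - (norm (\<alpha> i))\<^sup>2)"
    unfolding key using o by (simp add: szego_orthogonal_def)
  then have "of_real r * poly_inner M (?A n) (?A n) = of_real r * of_real (\<Prod>i<n. 1 - (norm (\<alpha> i))\<^sup>2)"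
    by (simp add: inner_pCons r_def mult.commute)
  then have "poly_inner M (?A n) (?A n) = of_real (\<Prod>i<n. 1 - (norm (\<alpha> i))\<^sup>2)"
    using r by simp
  with 1 show ?thesis by (simp add: szego_orthogonal_def)
qed

lemma szego_orthogonal_le:
  assumes "\<And>n. norm (\<alpha> n) < 1" "szego_orthogonal \<alpha> N" "n \<le> N"
  shows "szego_orthogonal \<alpha> n"
  using assms(3,2) by (induction rule: inc_induct) (auto intro: szego_orthogonal_descend assms(1))

text \<open>Pythagoras: removing the multiple of Phi_n that carries the leading coefficient leaves a
  polynomial of lower degree, orthogonal to Phi_n.\<close>

lemma inner_expand:
  assumes o: "szego_orthogonal \<alpha> n" and q: "\<And>k. k > n \<Longrightarrow> coeff q k = 0"
  defines "q' \<equiv> q - smult (coeff q n) (monic_poly \<alpha> n)"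
  shows "poly_inner M q q = of_real ((norm (coeff q n))\<^sup>2 * (\<Prod>i<n. 1 - (norm (\<alpha> i))\<^sup>2)) + poly_inner M q' q'"
    and "\<And>k. k \<ge> n \<Longrightarrow> coeff q' k = 0"
proof -
  let ?A = "monic_poly \<alpha> n" and ?c = "coeff q n"
  show co: "coeff q' k = 0" if "k \<ge> n" for k
    using that q[of k] coeff_szego_above[of n k \<alpha>] coeff_monic_top[of \<alpha> n]
    by (cases "k = n") (auto simp: q'_def)
  have z: "poly_inner M ?A q' = 0"
  proof (rule inner_monomials_zero)
    fix k assume "coeff q' k \<noteq> 0"
    then have "k < n" using co[of k] by (meson not_le)
    then show "poly_inner M ?A (monom 1 k) = 0" using o by (simp add: szego_orthogonal_def)
  qed
  have z': "poly_inner M q' ?A = 0" by (subst inner_commute) (simp add: z)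
  have "q = smult ?c ?A + q'" by (simp add: q'_def)
  then have "poly_inner M q q = poly_inner M (smult ?c ?A + q') (smult ?c ?A + q')" by simp
  also have "\<dots> = cnj ?c * ?c * poly_inner M ?A ?A + poly_inner M q' q'"
    by (simp add: inner_add_left inner_add_right inner_smult_left inner_smult_right z z' algebra_simps)
  also have "cnj ?c * ?c = of_real ((norm ?c)\<^sup>2)" by (metis complex_norm_square mult.commute)
  also have "poly_inner M ?A ?A = of_real (\<Prod>i<n. 1 - (norm (\<alpha> i))\<^sup>2)" using o by (simp add: szego_orthogonal_def)
  finally show "poly_inner M q q = of_real ((norm (coeff q n))\<^sup>2 * (\<Prod>i<n. 1 - (norm (\<alpha> i))\<^sup>2)) + poly_inner M q' q'"
    by (simp del: of_real_prod)
qed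

lemma gram_schmidt:
  assumes nz: "\<And>n. orthonormal_poly M n \<noteq> 0"
  shows "j \<le> n \<Longrightarrow> poly_inner M (orthonormal_poly M j) (orthonormal_poly M n) = (if j = n then 1 else 0)"
proof (induction n arbitrary: j rule: less_induct)
  case (less n)
  let ?\<phi> = "orthonormal_poly M"
  define P where "P = monom 1 n - (\<Sum>k<n. smult (poly_inner M (?\<phi> k) (monom 1 n)) (?\<phi> k))"
  have \<phi>: "?\<phi> n = smult (complex_of_real (1 / poly_norm M P)) P"
    by (subst orthonormal_poly.simps) (simp add: P_def Let_def)
  have orth: "poly_inner M (?\<phi> j) (?\<phi> k) = (if j = k then 1 else 0)" if "j < n" "k < n" for j k
  proof (cases "j \<le> k")
    case True then show ?thesis using less.IH[of k j] that by simp
  next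
    case False then show ?thesis using less.IH[of j k] that inner_commute[of "?\<phi> j" "?\<phi> k"] by simp
  qed
  have zero: "poly_inner M (?\<phi> i) P = 0" if "i < n" for i
  proof -
    have "poly_inner M (?\<phi> i) P = poly_inner M (?\<phi> i) (monom 1 n) - (\<Sum>k<n. poly_inner M (?\<phi> k) (monom 1 n) * (if i = k then 1 else 0))"
      unfolding P_def inner_diff_right inner_sum_right[OF finite_lessThan] inner_smult_right
      by (intro arg_cong2[where f = minus] refl sum.cong arg_cong2[where f = times] orth) (use that in auto)
    also have "\<dots> = 0" using that by (simp add: if_distrib sum.delta cong: if_cong)
    finally show ?thesis .
  qed
  show ?case
  proof (cases "j = n")
    case False
    then show ?thesis using zero[of j] less.prems by (simp add: \<phi> inner_smult_right)
  next
    case True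
    define I where "I = (\<integral>z. (norm (poly P z))\<^sup>2 \<partial>M)"
    have I: "poly_inner M P P = of_real I" by (simp add: I_def inner_self)
    have I0: "I \<ge> 0" unfolding I_def by (rule integral_nonneg_AE) simp
    \<comment> \<open>With norm 0 the normalizing factor 1/0 would be 0 and the polynomial would
      vanish, contrary to \<open>nz\<close>.\<close>
    have "poly_norm M P \<noteq> 0" using nz[of n] \<phi> by auto
    then have "I > 0" using I0 by (auto simp: poly_norm_def I)
    moreover have "poly_norm M P = sqrt I" by (simp add: poly_norm_def I)
    ultimately show ?thesis using True
      by (simp add: \<phi> inner_smult_left inner_smult_right I field_simps of_real_mult[symmetric] del: of_real_mult)
  qed
qed

end

text \<open>Repeated use of \<open>inner_expand\<close> writes the norm of q through its successive
  leading coefficients and \<alpha>, by the same formula for both measures.\<close>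

lemma inner_eq_of_orthogonal:
  assumes M1: "circle_measure M1" and M2: "circle_measure M2"
    and "\<And>n. n \<le> N \<Longrightarrow> circle_measure.szego_orthogonal M1 \<alpha> n" "\<And>n. n \<le> N \<Longrightarrow> circle_measure.szego_orthogonal M2 \<alpha> n"
    and "\<And>k. k > N \<Longrightarrow> coeff q k = 0"
  shows "poly_inner M1 q q = poly_inner M2 q q"
  using assms(3-)
proof (induction N arbitrary: q)
  case 0
  define q' where "q' = q - smult (coeff q 0) (monic_poly \<alpha> 0)"
  have e1: "poly_inner M1 q q = of_real ((norm (coeff q 0))\<^sup>2 * (\<Prod>i<0. 1 - (norm (\<alpha> i))\<^sup>2)) + poly_inner M1 q' q'"
    unfolding q'_def by (rule circle_measure.inner_expand(1)[OF M1 0(1)[OF le_refl] 0(3)])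
  have e2: "poly_inner M2 q q = of_real ((norm (coeff q 0))\<^sup>2 * (\<Prod>i<0. 1 - (norm (\<alpha> i))\<^sup>2)) + poly_inner M2 q' q'"
    unfolding q'_def by (rule circle_measure.inner_expand(1)[OF M2 0(2)[OF le_refl] 0(3)])
  have "coeff q' k = 0" for k
    unfolding q'_def by (rule circle_measure.inner_expand(2)[OF M1 0(1)[OF le_refl] 0(3)]) simp_all
  then have "q' = 0" by (intro poly_eqI) simp
  then have "poly_inner M1 q' q' = poly_inner M2 q' q'" by (simp add: circle_measure.inner_zero_right M1 M2)
  then show ?case by (simp only: e1 e2)
next
  case (Suc N)
  define q' where "q' = q - smult (coeff q (Suc N)) (monic_poly \<alpha> (Suc N))"
  have e1: "poly_inner M1 q q = of_real ((norm (coeff q (Suc N)))\<^sup>2 * (\<Prod>i<Suc N. 1 - (norm (\<alpha> i))\<^sup>2)) + poly_inner M1 q' q'"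
    unfolding q'_def by (rule circle_measure.inner_expand(1)[OF M1 Suc.prems(1)[OF le_refl] Suc.prems(3)])
  have e2: "poly_inner M2 q q = of_real ((norm (coeff q (Suc N)))\<^sup>2 * (\<Prod>i<Suc N. 1 - (norm (\<alpha> i))\<^sup>2)) + poly_inner M2 q' q'"
    unfolding q'_def by (rule circle_measure.inner_expand(1)[OF M2 Suc.prems(2)[OF le_refl] Suc.prems(3)])
  have "poly_inner M1 q' q' = poly_inner M2 q' q'"
  proof (rule Suc.IH)
    fix k assume "N < k"
    then show "coeff q' k = 0"
      unfolding q'_def by (intro circle_measure.inner_expand(2)[OF M1 Suc.prems(1)[OF le_refl] Suc.prems(3)]) simp_all
  qed (use Suc.prems(1,2) in auto)
  then show ?case by (simp only: e1 e2)
qed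

text \<open>Multiplying both polynomials by X makes them agree at 0 as well.\<close>

lemma poly_eqI_nonzero:
  fixes p q :: "complex poly"
  assumes "\<And>z. z \<noteq> 0 \<Longrightarrow> poly p z = poly q z"
  shows "p = q"
proof -
  have "poly (pCons 0 p) z = poly (pCons 0 q) z" for z
    using assms[of z] by (cases "z = 0") simp_all
  then have "pCons 0 p = pCons 0 q" by (simp add: poly_eq_poly_eq_iff[symmetric] fun_eq_iff)
  then show ?thesis by simp
qed

text \<open>Total mass 1 gives the constant polynomial 1 in degree 0; from there the recursion alone
  determines all orthonormal polynomials.\<close>

lemma orthonormal_poly_eq:
  assumes M: "prob_space M" and v: "verblunsky_coefficients M \<alpha>"
  shows "orthonormal_poly M n = smult (of_real (\<Prod>i<n. 1 / sqrt (1 - (norm (\<alpha> i))\<^sup>2))) (monic_poly \<alpha> n)"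
proof (induction n)
  case 0
  interpret prob_space M by fact
  have "poly_norm M 1 = 1" by (simp add: poly_norm_def poly_inner_def prob_space)
  then show ?case by (subst orthonormal_poly.simps) (simp add: Let_def monom_0 one_pCons)
next
  case (Suc n)
  let ?\<kappa> = "\<lambda>n. complex_of_real (\<Prod>i<n. 1 / sqrt (1 - (norm (\<alpha> i))\<^sup>2))"
  show ?case
  proof (rule poly_eqI_nonzero)
    fix z :: complex assume z: "z \<noteq> 0"
    let ?r = "complex_of_real (1 / sqrt (1 - (norm (\<alpha> n))\<^sup>2))"
    have "poly (orthonormal_poly M (Suc n)) z = ?r * (z * poly (orthonormal_poly M n) z
              - cnj (\<alpha> n) * z ^ n * cnj (poly (orthonormal_poly M n) (1 / cnj z)))"
      using v z unfolding verblunsky_coefficients_def by blast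
    also have "\<dots> = ?r * (z * (?\<kappa> n * poly (monic_poly \<alpha> n) z) - cnj (\<alpha> n) * (?\<kappa> n * (z ^ n * cnj (poly (monic_poly \<alpha> n) (1 / cnj z)))))"
      unfolding Suc poly_smult complex_cnj_mult complex_cnj_complex_of_real by (simp only: mult_ac)
    also have "\<dots> = ?r * ?\<kappa> n * (z * poly (monic_poly \<alpha> n) z - cnj (\<alpha> n) * poly (rev_poly \<alpha> n) z)"
      unfolding rev_poly_reverse(1)[OF z] by (simp only: algebra_simps)
    also have "\<dots> = poly (smult (?\<kappa> (Suc n)) (monic_poly \<alpha> (Suc n))) z"
      by (simp add: monic_poly_Suc mult_ac)
    finally show "poly (orthonormal_poly M (Suc n)) z = poly (smult (?\<kappa> (Suc n)) (monic_poly \<alpha> (Suc n))) z" .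
  qed
qed

text \<open>The orthonormal polynomials are positive multiples of the monic ones, hence nonzero, so
  \<open>gram_schmidt\<close> applies. Dividing out the factors \<kappa> turns orthonormality into
  the required norms.\<close>

lemma (in circle_measure) szego_orthogonal_of_verblunsky:
  assumes M: "prob_space M" and v: "verblunsky_coefficients M \<alpha>"
  shows "szego_orthogonal \<alpha> n"
proof -
  define \<kappa> where "\<kappa> n = (\<Prod>i<n. 1 / sqrt (1 - (norm (\<alpha> i))\<^sup>2))" for n
  have a: "1 - (norm (\<alpha> i))\<^sup>2 > 0" for i
    using v by (simp add: verblunsky_coefficients_def abs_square_less_1)
  have \<kappa>: "\<kappa> n > 0" for n unfolding \<kappa>_def using a by (intro prod_pos) auto
  have \<phi>: "orthonormal_poly M n = smult (of_real (\<kappa> n)) (monic_poly \<alpha> n)" for n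
    unfolding \<kappa>_def by (rule orthonormal_poly_eq[OF M v])
  have "monic_poly \<alpha> n \<noteq> 0" for n using coeff_monic_top[of \<alpha> n] by auto
  then have "orthonormal_poly M n \<noteq> 0" for n using \<kappa>[of n] by (simp add: \<phi>)
  note gs = gram_schmidt[OF this]
  have AA: "poly_inner M (monic_poly \<alpha> j) (monic_poly \<alpha> n) = (if j = n then of_real (1 / (\<kappa> n)\<^sup>2) else 0)" if "j \<le> n" for j n
  proof -
    have "of_real (\<kappa> j * \<kappa> n) * poly_inner M (monic_poly \<alpha> j) (monic_poly \<alpha> n) = (if j = n then 1 else 0)"
      using gs[OF that] unfolding \<phi> inner_smult_left inner_smult_right
      by (simp only: complex_cnj_complex_of_real of_real_mult mult_ac)
    moreover have "complex_of_real (\<kappa> j * \<kappa> n) \<noteq> 0"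
      unfolding of_real_eq_0_iff using \<kappa>[of j] \<kappa>[of n] by simp
    ultimately have "poly_inner M (monic_poly \<alpha> j) (monic_poly \<alpha> n) = (if j = n then 1 else 0) / of_real (\<kappa> j * \<kappa> n)"
      by (metis nonzero_mult_div_cancel_left)
    then show ?thesis by (simp add: power2_eq_square)
  qed
  \<comment> \<open>Orthogonality to Phi_j for all j < n becomes orthogonality to every polynomial
    of degree below n, by stripping leading coefficients.\<close>
  have "j \<le> n \<Longrightarrow> (\<And>k. k \<ge> j \<Longrightarrow> coeff q k = 0) \<Longrightarrow> poly_inner M (monic_poly \<alpha> n) q = 0" for j q
  proof (induction j arbitrary: q)
    case 0
    then have "q = 0" by (intro poly_eqI) simp
    then show ?case by (simp add: inner_zero_right)
  next
    case (Suc j)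
    define q' where "q' = q - smult (coeff q j) (monic_poly \<alpha> j)"
    have "coeff q' k = 0" if "k \<ge> j" for k
      using that Suc.prems(2)[of k] coeff_szego_above[of j k \<alpha>] coeff_monic_top[of \<alpha> j]
      by (cases "k = j") (auto simp: q'_def)
    then have "poly_inner M (monic_poly \<alpha> n) q' = 0" using Suc by simp
    moreover have "poly_inner M (monic_poly \<alpha> n) (monic_poly \<alpha> j) = 0"
      using AA[of j n] Suc.prems(1) inner_commute[of "monic_poly \<alpha> n" "monic_poly \<alpha> j"] by simp
    moreover have "q = q' + smult (coeff q j) (monic_poly \<alpha> j)" by (simp add: q'_def)
    ultimately show ?case by (metis inner_add_right inner_smult_right mult_zero_right add_0_right)
  qed
  from this[of n] have "poly_inner M (monic_poly \<alpha> n) (monom 1 k) = 0" if "k < n" for k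
    using that by (simp add: coeff_monom)
  moreover have "1 / (\<kappa> n)\<^sup>2 = (\<Prod>i<n. 1 - (norm (\<alpha> i))\<^sup>2)"
  proof -
    have "(\<kappa> n)\<^sup>2 = (\<Prod>i<n. (1 / sqrt (1 - (norm (\<alpha> i))\<^sup>2))\<^sup>2)" by (simp add: \<kappa>_def prod_power_distrib)
    also have "\<dots> = (\<Prod>i<n. 1 / (1 - (norm (\<alpha> i))\<^sup>2))"
      using a by (intro prod.cong) (auto simp: power_divide less_imp_le)
    finally show ?thesis by (simp add: prod_dividef)
  qed
  ultimately show ?thesis using AA[of n n] by (simp add: szego_orthogonal_def del: of_real_prod)
qed

section \<open>Bernstein--Szego measures\<close>

definition bernstein_szego :: "(nat \<Rightarrow> complex) \<Rightarrow> nat \<Rightarrow> complex measure" where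
  "bernstein_szego \<alpha> N = distr (density angle_measure
     (\<lambda>t. ennreal ((\<Prod>i<N. 1 - (norm (\<alpha> i))\<^sup>2) / (norm (poly (monic_poly \<alpha> N) (cis t)))\<^sup>2))) circle_borel cis"

lemma measurable_cis [measurable]: "cis \<in> measurable angle_measure circle_borel"
  unfolding circle_borel_def
  by (intro measurable_restrict_space2 measurable_angle_measure borel_measurable_continuous_onI continuous_intros) auto

text \<open>Both facts rest on the density being continuous and bounded, which holds because Phi_N
  has no zeros on the circle.\<close>

lemma
  assumes \<alpha>: "\<And>n. norm (\<alpha> n) < 1"
  shows circle_measure_bernstein_szego: "circle_measure (bernstein_szego \<alpha> N)"
    and integral_bernstein_szego: "continuous_on (sphere 0 1) f \<Longrightarrow> (\<integral>z. f z \<partial>bernstein_szego \<alpha> N) =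
      (\<integral>t. ((\<Prod>i<N. 1 - (norm (\<alpha> i))\<^sup>2) / (norm (poly (monic_poly \<alpha> N) (cis t)))\<^sup>2) *\<^sub>R (f (cis t) :: 'b :: {banach, second_countable_topology}) \<partial>angle_measure)"
proof -
  define e where "e = (\<Prod>i<N. 1 - (norm (\<alpha> i))\<^sup>2)"
  let ?A = "monic_poly \<alpha> N" and ?B = "rev_poly \<alpha> N"
  define W where "W t = e / (norm (poly ?A (cis t)))\<^sup>2" for t
  have e0: "e > 0" unfolding e_def using \<alpha> by (intro prod_pos) (auto simp: abs_square_less_1)
  have nzB: "poly ?B z \<noteq> 0" if "norm z \<le> 1" for z using rev_poly_nonzero[of \<alpha> z N] \<alpha> that by blast
  have nz: "poly ?A (cis t) \<noteq> 0" for t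
    using nzB[of "cis t"] norm_rev_circle[of "cis t" \<alpha> N] by auto
  have contW: "continuous_on UNIV W"
    unfolding W_def using nz by (intro continuous_intros) auto
  have W0: "W t \<ge> 0" for t using e0 by (simp add: W_def)
  have Wm [measurable]: "W \<in> borel_measurable angle_measure"
    by (intro measurable_angle_measure borel_measurable_continuous_onI contW)
  have bs: "bernstein_szego \<alpha> N = distr (density angle_measure (\<lambda>t. ennreal (W t))) circle_borel cis"
    by (simp add: bernstein_szego_def W_def e_def)
  have cism: "cis \<in> measurable (density angle_measure (\<lambda>t. ennreal (W t))) circle_borel"
    by simp
  obtain C where C: "\<And>t. W t \<le> C"
  proof -
    have "continuous_on (sphere 0 1) (\<lambda>z. e / (norm (poly ?A z))\<^sup>2)"
      by (intro continuous_intros) (metis mem_sphere_0 norm_eq_zero norm_rev_circle nzB order_refl power_eq_0_iff)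
    from compact_imp_bounded[OF compact_continuous_image[OF this compact_sphere]]
    obtain B where "\<forall>y\<in>(\<lambda>z. e / (norm (poly ?A z))\<^sup>2) ` sphere 0 1. norm y \<le> B" unfolding bounded_iff by blast
    then have "norm (W t) \<le> B" for t unfolding W_def by simp
    then have "W t \<le> B" for t by (metis abs_le_D1 real_norm_def)
    then show thesis by (rule that)
  qed
  have "emeasure (density angle_measure (\<lambda>t. ennreal (W t))) (space angle_measure) \<noteq> \<infinity>"
  proof -
    have "emeasure (density angle_measure (\<lambda>t. ennreal (W t))) (space angle_measure) = (\<integral>\<^sup>+t. ennreal (W t) \<partial>angle_measure)"
      by (subst emeasure_density) (auto intro!: nn_integral_cong simp: sets.top indicator_def simp del: space_angle_measure)
    also have "\<dots> \<le> (\<integral>\<^sup>+t. ennreal C \<partial>angle_measure)" using C by (intro nn_integral_mono ennreal_leI) auto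
    also have "\<dots> = ennreal C" by (simp add: angle.emeasure_space_1 del: space_angle_measure)
    finally show ?thesis by (auto simp: top_unique)
  qed
  then have fin: "finite_measure (bernstein_szego \<alpha> N)"
    unfolding bs by (intro finite_measure.finite_measure_distr cism finite_measureI) (simp add: sets.top)
  show cm: "circle_measure (bernstein_szego \<alpha> N)"
    using fin by (simp add: circle_measure_def circle_measure_axioms_def bs)
  assume f: "continuous_on (sphere 0 1) f"
  have fm: "f \<in> borel_measurable circle_borel"
    unfolding circle_borel_def by (rule borel_measurable_continuous_on_restrict[OF f])
  have "(\<integral>z. f z \<partial>bernstein_szego \<alpha> N) = (\<integral>t. f (cis t) \<partial>density angle_measure (\<lambda>t. ennreal (W t)))"
    unfolding bs by (rule integral_distr[OF cism fm])
  also have "\<dots> = (\<integral>t. W t *\<^sub>R f (cis t) \<partial>angle_measure)"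
    by (rule integral_density) (use W0 fm in \<open>auto intro: measurable_compose[OF measurable_cis]\<close>)
  finally show "(\<integral>z. f z \<partial>bernstein_szego \<alpha> N) =
      (\<integral>t. ((\<Prod>i<N. 1 - (norm (\<alpha> i))\<^sup>2) / (norm (poly (monic_poly \<alpha> N) (cis t)))\<^sup>2) *\<^sub>R f (cis t) \<partial>angle_measure)"
    by (simp add: W_def e_def)
qed

lemma monic_poly_circle_nonzero:
  assumes "\<And>n. norm (\<alpha> n) < 1"
  shows "poly (monic_poly \<alpha> N) (cis t) \<noteq> 0"
  using rev_poly_nonzero[of \<alpha> "cis t" N] assms norm_rev_circle[of "cis t" \<alpha> N] by auto

text \<open>The density cancels conj(Phi_N) and leaves z^k / Phi_N, on the circle the conjugate of
  z^(N-k) / Phi_N^*. That function is holomorphic beyond the closed disc and vanishes at 0, hence so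
  does its mean. For the norm the integrand is constant.\<close>

lemma bernstein_szego_orthogonal:
  assumes \<alpha>: "\<And>n. norm (\<alpha> n) < 1"
  shows "circle_measure.szego_orthogonal (bernstein_szego \<alpha> N) \<alpha> N"
proof -
  define e where "e = (\<Prod>i<N. 1 - (norm (\<alpha> i))\<^sup>2)"
  let ?A = "monic_poly \<alpha> N" and ?B = "rev_poly \<alpha> N"
  have nzB: "poly ?B z \<noteq> 0" if "norm z \<le> 1" for z using rev_poly_nonzero[of \<alpha> z N] \<alpha> that by blast
  have nz: "poly ?A (cis t) \<noteq> 0" for t using monic_poly_circle_nonzero \<alpha> by blast
  interpret circle_measure "bernstein_szego \<alpha> N" by (rule circle_measure_bernstein_szego[OF \<alpha>])
  note int = integral_bernstein_szego[where \<alpha> = \<alpha> and N = N, OF \<alpha>, folded e_def]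
  have mono: "poly_inner (bernstein_szego \<alpha> N) ?A (monom 1 k) = 0" if k: "k < N" for k
  proof -
    obtain R where R: "R > 1" "\<And>z. z \<in> ball 0 R \<Longrightarrow> poly ?B z \<noteq> 0"
      using nonvanishing_larger_ball[of ?B] nzB by blast
    let ?h = "\<lambda>z. z ^ (N - k) / poly ?B z"
    have h: "?h holomorphic_on ball 0 R" using R by (intro holomorphic_intros) auto
    have H: "?h has_fps_expansion fps_expansion ?h 0"
      by (rule has_fps_expansion_fps_expansion[of "ball 0 R"]) (use h R in auto)
    have "(\<integral>t. ?h (cis t) / cis t ^ 0 \<partial>angle_measure) = fps_expansion ?h 0 $ 0"
      by (rule circle_coefficient[OF h R(1) H])
    also have "\<dots> = 0" using fps_nth_fps_expansion[OF H, of 0] k by simp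
    finally have h0: "(\<integral>t. ?h (cis t) \<partial>angle_measure) = 0" by simp
    have "poly_inner (bernstein_szego \<alpha> N) ?A (monom 1 k) = (\<integral>t. (e / (norm (poly ?A (cis t)))\<^sup>2) *\<^sub>R (cnj (poly ?A (cis t)) * poly (monom 1 k) (cis t)) \<partial>angle_measure)"
      unfolding poly_inner_def by (intro int continuous_intros)
    also have "\<dots> = (\<integral>t. of_real e * cnj (?h (cis t)) \<partial>angle_measure)"
    proof (rule Bochner_Integration.integral_cong[OF refl])
      fix t
      let ?z = "cis t"
      have A: "poly ?A ?z = ?z ^ N * cnj (poly ?B ?z)" by (rule poly_rev_circle) simp
      have n2: "complex_of_real ((norm (poly ?A ?z))\<^sup>2) = poly ?A ?z * cnj (poly ?A ?z)" by (rule complex_norm_square)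
      have zN: "?z ^ N = ?z ^ k * ?z ^ (N - k)" using k by (simp add: power_add[symmetric])
      have "cnj ?z ^ (N - k) * ?z ^ (N - k) = 1"
        by (simp add: power_mult_distrib[symmetric] cis_cnj cis_mult)
      then have inv: "cnj ?z ^ (N - k) = 1 / ?z ^ (N - k)" by (simp add: field_simps)
      have "(e / (norm (poly ?A ?z))\<^sup>2) *\<^sub>R (cnj (poly ?A ?z) * poly (monom 1 k) ?z) = of_real e * (cnj (poly ?A ?z) * ?z ^ k) / complex_of_real ((norm (poly ?A ?z))\<^sup>2)"
        by (simp add: scaleR_conv_of_real poly_monom)
      also have "\<dots> = of_real e * ?z ^ k / poly ?A ?z"
        unfolding n2 using nz[of t] by simp
      also have "\<dots> = of_real e * cnj (?h ?z)"
        unfolding A zN using inv by simp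
      finally show "(e / (norm (poly ?A ?z))\<^sup>2) *\<^sub>R (cnj (poly ?A ?z) * poly (monom 1 k) ?z) = of_real e * cnj (?h ?z)" .
    qed
    also have "\<dots> = of_real e * cnj (\<integral>t. ?h (cis t) \<partial>angle_measure)"
      unfolding Bochner_Integration.integral_cnj[symmetric] by (rule integral_mult_right_zero)
    finally show ?thesis using h0 by simp
  qed
  have "poly_inner (bernstein_szego \<alpha> N) ?A ?A = (\<integral>t. (e / (norm (poly ?A (cis t)))\<^sup>2) *\<^sub>R (cnj (poly ?A (cis t)) * poly ?A (cis t)) \<partial>angle_measure)"
    unfolding poly_inner_def by (intro int continuous_intros)
  also have "\<dots> = (\<integral>t. of_real e \<partial>angle_measure)"
  proof (rule Bochner_Integration.integral_cong[OF refl])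
    fix t
    have "cnj (poly ?A (cis t)) * poly ?A (cis t) = complex_of_real ((norm (poly ?A (cis t)))\<^sup>2)"
      by (metis complex_norm_square mult.commute)
    then show "(e / (norm (poly ?A (cis t)))\<^sup>2) *\<^sub>R (cnj (poly ?A (cis t)) * poly ?A (cis t)) = of_real e"
      using nz[of t] by (simp add: scaleR_conv_of_real)
  qed
  also have "\<dots> = of_real e" by (simp add: angle.prob_space del: space_angle_measure)
  finally show "szego_orthogonal \<alpha> N" using mono by (simp add: szego_orthogonal_def e_def del: of_real_prod)
qed

section \<open>The entropy of the Bernstein--Szego approximations\<close>

lemma sum_rule_coeff_0_pos: "sum_rule_coeff m 0 > 0"
  by (simp add: sum_rule_coeff_def)

lemma integrable_angle_continuous:
  fixes g :: "real \<Rightarrow> 'a :: {banach, second_countable_topology}"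
  assumes "continuous_on UNIV g"
  shows "integrable angle_measure g"
proof -
  have c: "compact (g ` {0..2 * pi})"
    by (intro compact_continuous_image continuous_on_subset[OF assms]) auto
  obtain B where "\<forall>y\<in>g ` {0..2 * pi}. norm y \<le> B"
    using compact_imp_bounded[OF c] unfolding bounded_iff by blast
  then have B: "norm (g t) \<le> B" if "t \<in> {0..<2 * pi}" for t using that by simp
  show ?thesis
  proof (rule angle.integrable_const_bound[of _ B])
    show "AE t in angle_measure. norm (g t) \<le> B"
      by (rule AE_I2) (rule B, simp)
    show "g \<in> borel_measurable angle_measure"
      by (rule measurable_angle_measure, rule borel_measurable_continuous_onI, rule assms)
  qed
qed

lemma integral_one_minus_cos_power: "(\<integral>t. (1 - cos t) ^ m \<partial>angle_measure) = sum_rule_coeff m 0"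
proof -
  have h: "(\<lambda>z. (1 - z) ^ (2 * m)) holomorphic_on ball 0 2" by (intro holomorphic_intros)
  have H: "(\<lambda>z. (1 - z) ^ (2 * m)) has_fps_expansion (1 - fps_X :: complex fps) ^ (2 * m)"
    by (intro has_fps_expansion_power has_fps_expansion_diff) (auto intro: has_fps_expansion_fps_X)
  have eq: "complex_of_real ((1 - cos t) ^ m) = (- 1 / 2) ^ m * ((1 - cis t) ^ (2 * m) / cis t ^ m)" for t
  proof -
    have "complex_of_real ((1 - cos t) ^ m) = ((- 1 / 2) * (1 - cis t)\<^sup>2 / cis t) ^ m"
      unfolding of_real_power one_minus_cos_cis ..
    then show ?thesis by (simp only: power_divide power_mult_distrib power_mult times_divide_eq_right)
  qed
  have "complex_of_real (\<integral>t. (1 - cos t) ^ m \<partial>angle_measure) = (\<integral>t. complex_of_real ((1 - cos t) ^ m) \<partial>angle_measure)"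
    by (rule integral_complex_of_real[symmetric])
  also have "\<dots> = (- 1 / 2) ^ m * (((1 - fps_X :: complex fps) ^ (2 * m)) $ m)"
    unfolding eq integral_mult_right_zero by (subst circle_coefficient[OF h _ H]) simp_all
  also have "\<dots> = (- 1 / 2) ^ m * ((-1) ^ m * of_nat ((2 * m) choose m))"
    unfolding one_minus_fps_X_power_nth ..
  also have "\<dots> = complex_of_real (sum_rule_coeff m 0)"
  proof -
    have "(- 1 / 2 :: complex) ^ m * (-1) ^ m = (1 / 2) ^ m"
      unfolding power_mult_distrib[symmetric] by simp
    then have "(- 1 / 2 :: complex) ^ m * ((-1) ^ m * c) = (1 / 2) ^ m * c" for c
      by (simp only: mult.assoc[symmetric])
    then show ?thesis by (simp add: sum_rule_coeff_def power_divide)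
  qed
  finally show ?thesis by (simp only: of_real_eq_iff)
qed

text \<open>On the circle this is $|\varphi_N|^2$.\<close>

definition szego_weight :: "(nat \<Rightarrow> complex) \<Rightarrow> nat \<Rightarrow> complex \<Rightarrow> real" where
  "szego_weight \<alpha> N z = (norm (poly (monic_poly \<alpha> N) z))\<^sup>2 / (\<Prod>i<N. 1 - (norm (\<alpha> i))\<^sup>2)"

definition szego_entropy :: "nat \<Rightarrow> (nat \<Rightarrow> complex) \<Rightarrow> nat \<Rightarrow> real" where
  "szego_entropy m \<alpha> N = (\<integral>t. (1 - cos t) ^ m * ln (szego_weight \<alpha> N (cis t)) \<partial>angle_measure)"

lemma prod_verblunsky_pos:
  assumes "\<And>n. norm (\<alpha> n) < 1"
  shows "(\<Prod>i<N. 1 - (norm (\<alpha> i :: complex))\<^sup>2) > 0"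
  by (rule prod_pos) (use assms in \<open>auto simp: abs_square_less_1\<close>)

lemma szego_weight_pos:
  assumes "\<And>n. norm (\<alpha> n) < 1"
  shows "szego_weight \<alpha> N (cis t) > 0"
  using monic_poly_circle_nonzero[where \<alpha> = \<alpha>, OF assms] prod_verblunsky_pos[where \<alpha> = \<alpha>, OF assms]
  unfolding szego_weight_def by simp

lemma continuous_szego_weight:
  assumes "\<And>n. norm (\<alpha> n) < 1"
  shows "continuous_on UNIV (\<lambda>t. szego_weight \<alpha> N (cis t))"
proof -
  have "(\<Prod>i<N. 1 - (norm (\<alpha> i))\<^sup>2) \<noteq> 0"
    using prod_verblunsky_pos[where \<alpha> = \<alpha> and N = N, OF assms] by linarith
  then show ?thesis unfolding szego_weight_def by (intro continuous_intros) blast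
qed

lemma integrable_szego_entropy:
  assumes "\<And>n. norm (\<alpha> n) < 1"
  shows "integrable angle_measure (\<lambda>t. (1 - cos t) ^ m * ln (szego_weight \<alpha> N (cis t)))"
  by (intro integrable_angle_continuous continuous_intros continuous_szego_weight assms)
     (use szego_weight_pos[where \<alpha> = \<alpha>, OF assms] in \<open>auto simp: less_imp_neq[symmetric]\<close>)

text \<open>The exact sum rule at finite N. As |Phi_N| = |Phi_N^*| on the circle, the integral of
  log|Phi_N^*|^2 applies; the normalizing product contributes its logarithm times the mean of the
  weight.\<close>

lemma szego_entropy_eq:
  assumes \<alpha>: "\<And>n. norm (\<alpha> n) < 1"
  shows "szego_entropy m \<alpha> N = (\<Sum>n<N. - sum_rule_coeff m 0 * ln (1 - (norm (\<alpha> n))\<^sup>2) + Re (sum_rule_term m \<alpha> n))"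
proof -
  define e where "e = (\<Prod>i<N. 1 - (norm (\<alpha> i))\<^sup>2)"
  have e: "e > 0" unfolding e_def by (rule prod_verblunsky_pos[OF \<alpha>])
  have nz: "poly (rev_poly \<alpha> N) z \<noteq> 0" if "norm z \<le> 1" for z using rev_poly_nonzero[of \<alpha> z N] \<alpha> that by blast
  have "1 - (norm (\<alpha> n))\<^sup>2 \<noteq> 0" for n using \<alpha>[of n] abs_square_less_1[of "norm (\<alpha> n)"] by simp
  then have lne: "ln e = (\<Sum>n<N. ln (1 - (norm (\<alpha> n))\<^sup>2))"
    unfolding e_def by (intro ln_prod) auto
  have int: "integrable angle_measure (\<lambda>t. (1 - cos t) ^ m * ln ((norm (poly (rev_poly \<alpha> N) (cis t)))\<^sup>2))"
    by (intro integrable_angle_continuous continuous_intros) (use nz in auto)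
  have int2: "integrable angle_measure (\<lambda>t. (1 - cos t) ^ m * ln e)"
    by (intro integrable_angle_continuous continuous_intros)
  have "szego_entropy m \<alpha> N = (\<integral>t. (1 - cos t) ^ m * ln ((norm (poly (rev_poly \<alpha> N) (cis t)))\<^sup>2) - (1 - cos t) ^ m * ln e \<partial>angle_measure)"
    unfolding szego_entropy_def
  proof (rule Bochner_Integration.integral_cong[OF refl])
    fix t
    have "ln (szego_weight \<alpha> N (cis t)) = ln ((norm (poly (rev_poly \<alpha> N) (cis t)))\<^sup>2) - ln e"
      unfolding szego_weight_def e_def[symmetric] using e nz[of "cis t"] norm_rev_circle[of "cis t" \<alpha> N]
      by (subst ln_div) auto
    then show "(1 - cos t) ^ m * ln (szego_weight \<alpha> N (cis t)) = (1 - cos t) ^ m * ln ((norm (poly (rev_poly \<alpha> N) (cis t)))\<^sup>2) - (1 - cos t) ^ m * ln e"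
      by (simp add: right_diff_distrib)
  qed
  also have "\<dots> = (\<Sum>n<N. Re (sum_rule_term m \<alpha> n)) - sum_rule_coeff m 0 * ln e"
    by (simp only: Bochner_Integration.integral_diff[OF int int2] integral_log_rev_poly[OF nz] integral_mult_left_zero integral_one_minus_cos_power)
  finally show ?thesis unfolding lne sum_distrib_left sum_subtractf[symmetric] by simp
qed

text \<open>The Taylor remainder, the sum of x^i / i over i > m. Its leading power x^(m+1) at x =
  |\<alpha>_n|^2 is the origin of the exponent 2m + 2.\<close>

definition log_tail :: "nat \<Rightarrow> real \<Rightarrow> real" where
  "log_tail m x = - ln (1 - x) - (\<Sum>i=1..m. x ^ i / real i)"

lemma szego_entropy_bound:
  assumes \<alpha>: "\<And>n. norm (\<alpha> n) < 1" and sm: "summable (\<lambda>n. (norm (\<alpha> (Suc n) - \<alpha> n))\<^sup>2)"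
  shows "\<exists>C. \<forall>N. \<bar>szego_entropy m \<alpha> N - sum_rule_coeff m 0 * (\<Sum>n<N. log_tail m ((norm (\<alpha> n))\<^sup>2))\<bar> \<le> C"
proof -
  have "szego_entropy m \<alpha> N - sum_rule_coeff m 0 * (\<Sum>n<N. log_tail m ((norm (\<alpha> n))\<^sup>2))
     = (\<Sum>n<N. Re (sum_rule_term m \<alpha> n) + sum_rule_coeff m 0 * (\<Sum>i=1..m. ((norm (\<alpha> n))\<^sup>2) ^ i / real i))" for N
    unfolding szego_entropy_eq[where \<alpha> = \<alpha>, OF \<alpha>] log_tail_def sum_distrib_left sum_subtractf[symmetric]
    by (intro sum.cong refl) (simp add: algebra_simps sum_distrib_left)
  then show ?thesis using sum_rule_term_bounded[where \<alpha> = \<alpha>, OF \<alpha> sm, of m] by simp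
qed

lemma log_tail_sums:
  assumes "0 \<le> x" "x < 1"
  shows "(\<lambda>k. x ^ (k + Suc m) / real (k + Suc m)) sums log_tail m x"
proof -
  have "(\<lambda>n. - (- (x ^ n) / real n)) sums - ln (1 + - x)"
    by (intro sums_minus) (use ln_series'[of "- x"] assms in auto)
  then have s: "(\<lambda>n. x ^ n / real n) sums - ln (1 - x)" by simp
  have "(\<Sum>i<Suc m. x ^ i / real i) = (\<Sum>i=1..m. x ^ i / real i)"
    by (simp add: lessThan_Suc_atMost atMost_atLeast0 sum.atLeast_Suc_atMost[of 0])
  then show ?thesis
    using sums_split_initial_segment[OF s, of "Suc m"] by (simp add: log_tail_def)
qed

lemma log_tail_lower:
  assumes "0 \<le> x" "x < 1"
  shows "x ^ Suc m / real (Suc m) \<le> log_tail m x"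
proof -
  have "(\<Sum>k\<in>{0}. x ^ (k + Suc m) / real (k + Suc m)) \<le> log_tail m x"
    unfolding sums_unique[OF log_tail_sums[OF assms]]
    by (rule sum_le_suminf[OF sums_summable[OF log_tail_sums[OF assms]]]) (use assms in auto)
  then show ?thesis by simp
qed

lemma log_tail_upper:
  assumes "0 \<le> x" "x \<le> 1 / 2"
  shows "log_tail m x \<le> 2 * x ^ Suc m"
proof -
  have geo: "(\<lambda>k. x ^ Suc m * x ^ k) sums (x ^ Suc m * (1 / (1 - x)))"
    by (intro sums_mult geometric_sums) (use assms in auto)
  have le: "x ^ (k + Suc m) / real (k + Suc m) \<le> x ^ Suc m * x ^ k" for k
  proof -
    have "x ^ (k + Suc m) / real (k + Suc m) \<le> x ^ (k + Suc m) / 1"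
      using assms by (intro divide_left_mono) auto
    then show ?thesis by (simp add: power_add mult_ac)
  qed
  have "x < 1" using assms by simp
  then have "log_tail m x \<le> x ^ Suc m * (1 / (1 - x))"
    by (rule sums_le[OF le log_tail_sums[OF assms(1)] geo])
  also have "\<dots> \<le> x ^ Suc m * 2"
    using assms by (intro mult_left_mono) (auto simp: field_simps)
  finally show ?thesis by simp
qed

lemma bounded_log_tail_iff:
  assumes \<alpha>: "\<And>n. norm (\<alpha> n) < 1"
  shows "(\<exists>C. \<forall>N. (\<Sum>n<N. log_tail m ((norm (\<alpha> n))\<^sup>2)) \<le> C) \<longleftrightarrow> \<alpha> \<in> little_l (2 * m + 2)"
proof -
  define x where "x n = (norm (\<alpha> n))\<^sup>2" for n
  have x: "0 \<le> x n" "x n < 1" for n using \<alpha> by (auto simp: x_def abs_square_less_1)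
  have xm: "x n ^ Suc m = norm (\<alpha> n) ^ (2 * m + 2)" for n
    by (simp add: x_def power_mult[symmetric] power_add[symmetric])
  have tail0: "log_tail m (x n) \<ge> 0" for n
    using log_tail_lower[OF x, of n m] x(1)[of n] by (meson divide_nonneg_nonneg of_nat_0_le_iff order_trans zero_le_power)
  have "(\<exists>C. \<forall>N. (\<Sum>n<N. log_tail m (x n)) \<le> C) \<longleftrightarrow> summable (\<lambda>n. log_tail m (x n))"
  proof
    assume "\<exists>C. \<forall>N. (\<Sum>n<N. log_tail m (x n)) \<le> C"
    then show "summable (\<lambda>n. log_tail m (x n))" using summableI_nonneg_bounded[where f = "\<lambda>n. log_tail m (x n)", OF tail0] by blast
  next
    assume "summable (\<lambda>n. log_tail m (x n))"
    then show "\<exists>C. \<forall>N. (\<Sum>n<N. log_tail m (x n)) \<le> C" using tail0 by (intro exI[of _ "\<Sum>n. log_tail m (x n)"]) (auto intro: sum_le_suminf)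
  qed
  also have "\<dots> \<longleftrightarrow> summable (\<lambda>n. x n ^ Suc m)"
  proof
    assume s: "summable (\<lambda>n. log_tail m (x n))"
    show "summable (\<lambda>n. x n ^ Suc m)"
    proof (rule summable_comparison_test'[OF summable_mult[OF s, of "real (Suc m)"], where N = 0])
      fix n
      have "real (Suc m) * (x n ^ Suc m / real (Suc m)) \<le> real (Suc m) * log_tail m (x n)"
        using log_tail_lower[OF x, of n m] by (intro mult_left_mono) auto
      then show "norm (x n ^ Suc m) \<le> real (Suc m) * log_tail m (x n)" using x by (simp del: of_nat_Suc power_Suc)
    qed
  next
    assume s: "summable (\<lambda>n. x n ^ Suc m)"
    \<comment> \<open>The upper bound on the tail is restricted to x <= 1/2; summability forces x to
      0, so it holds from some index on.\<close>
    have "(\<lambda>n. x n ^ Suc m) \<longlonglongrightarrow> 0" by (rule summable_LIMSEQ_zero[OF s])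
    then have "\<forall>\<^sub>F n in sequentially. x n ^ Suc m < (1 / 2) ^ Suc m" by (rule order_tendstoD) simp
    then have "\<forall>\<^sub>F n in sequentially. norm (log_tail m (x n)) \<le> 2 * x n ^ Suc m"
    proof eventually_elim
      case (elim n)
      then have "x n < 1 / 2" by (rule power_less_imp_less_base) simp
      then show ?case using log_tail_upper[of "x n" m] x tail0 by simp
    qed
    then show "summable (\<lambda>n. log_tail m (x n))"
      by (rule summable_comparison_test_ev) (rule summable_mult[OF s])
  qed
  finally show ?thesis unfolding xm by (simp add: little_l_def x_def)
qed

lemma szego_entropy_bounded_iff:
  assumes \<alpha>: "\<And>n. norm (\<alpha> n) < 1" and sm: "forward_diff \<alpha> \<in> little_l 2"
  shows "(\<exists>C. \<forall>N. szego_entropy m \<alpha> N \<le> C) \<longleftrightarrow> \<alpha> \<in> little_l (2 * m + 2)"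
proof -
  let ?S = "\<lambda>N. \<Sum>n<N. log_tail m ((norm (\<alpha> n))\<^sup>2)"
  have "summable (\<lambda>n. (norm (\<alpha> (Suc n) - \<alpha> n))\<^sup>2)" using sm by (simp add: little_l_def forward_diff_def)
  then obtain D where D: "\<And>N. \<bar>szego_entropy m \<alpha> N - sum_rule_coeff m 0 * ?S N\<bar> \<le> D"
    using szego_entropy_bound[where \<alpha> = \<alpha>, OF \<alpha>] by blast
  have c: "sum_rule_coeff m 0 > 0" by (rule sum_rule_coeff_0_pos)
  have "(\<exists>C. \<forall>N. szego_entropy m \<alpha> N \<le> C) \<longleftrightarrow> (\<exists>C. \<forall>N. ?S N \<le> C)"
  proof
    assume "\<exists>C. \<forall>N. szego_entropy m \<alpha> N \<le> C"
    then obtain C where C: "\<And>N. szego_entropy m \<alpha> N \<le> C" by blast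
    have "?S N \<le> (C + D) / sum_rule_coeff m 0" for N
    proof -
      have "sum_rule_coeff m 0 * ?S N \<le> C + D" using C[of N] D[of N] by linarith
      then show ?thesis using c by (simp add: pos_le_divide_eq mult.commute)
    qed
    then show "\<exists>C. \<forall>N. ?S N \<le> C" by blast
  next
    assume "\<exists>C. \<forall>N. ?S N \<le> C"
    then obtain C where C: "\<And>N. ?S N \<le> C" by blast
    have "szego_entropy m \<alpha> N \<le> sum_rule_coeff m 0 * C + D" for N
    proof -
      have "sum_rule_coeff m 0 * ?S N \<le> sum_rule_coeff m 0 * C" using c C by (intro mult_left_mono) auto
      then show ?thesis using D[of N] by linarith
    qed
    then show "\<exists>C. \<forall>N. szego_entropy m \<alpha> N \<le> C" by blast
  qed
  also have "\<dots> \<longleftrightarrow> \<alpha> \<in> little_l (2 * m + 2)" by (rule bounded_log_tail_iff[OF \<alpha>])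
  finally show ?thesis .
qed

section \<open>Comparison with the entropy of the measure\<close>

lemma one_minus_cos_power_bounds: "0 \<le> (1 - cos t) ^ m" "(1 - cos t) ^ m \<le> 2 ^ m" for t :: real
proof -
  have "0 \<le> 1 - cos t" "1 - cos t \<le> 2" using cos_le_one[of t] cos_ge_minus_one[of t] by linarith+
  then show "0 \<le> (1 - cos t) ^ m" "(1 - cos t) ^ m \<le> 2 ^ m" by (auto intro: power_mono)
qed

lemma measurable_log_ereal [measurable]: "log_ereal \<in> borel_measurable borel"
  unfolding log_ereal_def[abs_def] by measurable

definition negative_entropy :: "nat \<Rightarrow> (real \<Rightarrow> real) \<Rightarrow> real \<Rightarrow> ennreal" where
  "negative_entropy m w t = e2ennreal (- (ereal ((1 - cos t) ^ m) * log_ereal (w t)))"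

lemma measurable_one_minus_cos_power [measurable]: "(\<lambda>t. (1 - cos t) ^ m) \<in> borel_measurable angle_measure"
  by (intro measurable_angle_measure borel_measurable_continuous_onI continuous_intros)

lemma measurable_negative_entropy:
  assumes [measurable]: "w \<in> borel_measurable angle_measure"
  shows "negative_entropy m w \<in> borel_measurable angle_measure"
  unfolding negative_entropy_def[abs_def] by measurable

lemma negative_entropy_pos: "w t > 0 \<Longrightarrow> negative_entropy m w t = ennreal (- ((1 - cos t) ^ m * ln (w t)))"
  by (simp add: negative_entropy_def log_ereal_def e2ennreal_ereal)

text \<open>Follows the convention 0 * \<infinity> = 0: a zero of w costs nothing where the weight
  vanishes.\<close>

lemma negative_entropy_zero:
  assumes "w t = 0"
  shows "negative_entropy m w t = (if (1 - cos t) ^ m = 0 then 0 else \<infinity>)"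
proof (cases "(1 - cos t) ^ m = 0")
  case True
  then show ?thesis using assms by (simp add: negative_entropy_def log_ereal_def del: power_eq_0_iff)
next
  case False
  then have "(1 - cos t) ^ m > 0" using one_minus_cos_power_bounds(1)[of t m] by linarith
  moreover have "- (ereal p * - \<infinity>) = \<infinity>" if "p > 0" for p :: real using that by simp
  ultimately show ?thesis using assms False
    by (simp only: negative_entropy_def log_ereal_def if_False if_True order_refl) (simp add: e2ennreal_infty)
qed

section \<open>From a finite logarithmic integral to bounded entropies\<close>

locale circle_decomposition =
  fixes \<mu> \<mu>s :: "complex measure" and w :: "real \<Rightarrow> real" and \<alpha> :: "nat \<Rightarrow> complex"
  assumes prob: "prob_space \<mu>" and sets_mu: "sets \<mu> = sets circle_borel"
    and verblunsky: "verblunsky_coefficients \<mu> \<alpha>"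
    and decomposition: "lebesgue_decomposition \<mu> w \<mu>s"
begin

sublocale prob_space \<mu> by (rule prob)

sublocale circle_measure \<mu>
  by unfold_locales (rule sets_mu)

lemma norm_verblunsky: "norm (\<alpha> n) < 1"
  using verblunsky by (simp add: verblunsky_coefficients_def)

lemma w_measurable [measurable]: "w \<in> borel_measurable angle_measure"
  and w_nonneg: "t \<in> {0..<2 * pi} \<Longrightarrow> 0 \<le> w t"
  using decomposition by (auto simp: lebesgue_decomposition_def)

definition ac_part :: "complex measure" where
  "ac_part = distr (density angle_measure (\<lambda>\<theta>. ennreal (w \<theta>))) circle_borel cis"

lemma sets_ac_part: "sets ac_part = sets circle_borel"
  by (simp add: ac_part_def)

lemma emeasure_decomposition: "A \<in> sets circle_borel \<Longrightarrow> emeasure \<mu> A = emeasure ac_part A + emeasure \<mu>s A"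
  using decomposition by (simp add: lebesgue_decomposition_def ac_part_def)

lemma nn_integral_ac_part:
  assumes [measurable]: "f \<in> borel_measurable circle_borel"
  shows "(\<integral>\<^sup>+z. f z \<partial>ac_part) = (\<integral>\<^sup>+t. ennreal (w t) * f (cis t) \<partial>angle_measure)"
proof -
  have c: "cis \<in> measurable (density angle_measure (\<lambda>\<theta>. ennreal (w \<theta>))) circle_borel" by simp
  have "(\<integral>\<^sup>+z. f z \<partial>ac_part) = (\<integral>\<^sup>+t. f (cis t) \<partial>density angle_measure (\<lambda>\<theta>. ennreal (w \<theta>)))"
    unfolding ac_part_def by (rule nn_integral_distr[OF c]) simp
  also have "\<dots> = (\<integral>\<^sup>+t. ennreal (w t) * f (cis t) \<partial>angle_measure)"
    by (rule nn_integral_density) measurable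
  finally show ?thesis .
qed

lemma nn_integral_ac_part_le: "(\<integral>\<^sup>+z. f z \<partial>ac_part) \<le> (\<integral>\<^sup>+z. f z \<partial>\<mu>)"
proof (rule nn_integral_mono_measure)
  show s: "sets ac_part = sets \<mu>" by (simp add: sets_ac_part sets_mu)
  show "ac_part \<le> \<mu>"
    unfolding le_measure[OF s] using emeasure_decomposition by (simp add: sets_ac_part)
qed

lemma nn_integral_w: "(\<integral>\<^sup>+t. ennreal (w t) \<partial>angle_measure) \<le> 1"
proof -
  have "(\<integral>\<^sup>+t. ennreal (w t) \<partial>angle_measure) = (\<integral>\<^sup>+z. 1 \<partial>ac_part)"
    by (subst nn_integral_ac_part) simp_all
  also have "\<dots> \<le> (\<integral>\<^sup>+z. 1 \<partial>\<mu>)" by (rule nn_integral_ac_part_le)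
  finally show ?thesis by (simp add: emeasure_space_1)
qed

lemma integral_szego_weight: "(\<integral>z. szego_weight \<alpha> N z \<partial>\<mu>) = 1"
proof -
  define e where "e = (\<Prod>i<N. 1 - (norm (\<alpha> i))\<^sup>2)"
  have e: "e > 0" unfolding e_def by (rule prod_verblunsky_pos) (rule norm_verblunsky)
  have "szego_orthogonal \<alpha> N" by (rule szego_orthogonal_of_verblunsky[OF prob verblunsky])
  then have "(\<integral>z. (norm (poly (monic_poly \<alpha> N) z))\<^sup>2 \<partial>\<mu>) = e"
    unfolding szego_orthogonal_def inner_self of_real_eq_iff e_def by simp
  with e show ?thesis by (simp add: szego_weight_def e_def[symmetric])
qed

text \<open>The absolutely continuous part is at most \<mu> as a measure, and |phi_N|^2 has integral
  1 with respect to \<mu>.\<close>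

lemma integrable_w_szego_weight: 
  "integrable angle_measure (\<lambda>t. w t * szego_weight \<alpha> N (cis t))"
  "(\<integral>t. w t * szego_weight \<alpha> N (cis t) \<partial>angle_measure) \<le> 1"
proof -
  have cont: "continuous_on (sphere 0 1) (\<lambda>z. szego_weight \<alpha> N z)"
  proof -
    have "(\<Prod>i<N. 1 - (norm (\<alpha> i))\<^sup>2) \<noteq> 0"
      using prod_verblunsky_pos[where \<alpha> = \<alpha> and N = N, OF norm_verblunsky] by linarith
    then show ?thesis unfolding szego_weight_def by (intro continuous_intros) blast
  qed
  have sw0: "szego_weight \<alpha> N z \<ge> 0" for z
    unfolding szego_weight_def using prod_verblunsky_pos[where \<alpha> = \<alpha> and N = N, OF norm_verblunsky]
    by (intro divide_nonneg_nonneg) auto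
  have swm: "szego_weight \<alpha> N \<in> borel_measurable circle_borel"
    unfolding circle_borel_def by (rule borel_measurable_continuous_on_restrict[OF cont])
  have swm' [measurable]: "(\<lambda>t. szego_weight \<alpha> N (cis t)) \<in> borel_measurable angle_measure"
    by (rule measurable_compose[OF measurable_cis swm])
  have nn: "(\<integral>\<^sup>+t. ennreal (w t * szego_weight \<alpha> N (cis t)) \<partial>angle_measure) \<le> 1"
  proof -
    have "(\<integral>\<^sup>+t. ennreal (w t * szego_weight \<alpha> N (cis t)) \<partial>angle_measure) = (\<integral>\<^sup>+t. ennreal (w t) * ennreal (szego_weight \<alpha> N (cis t)) \<partial>angle_measure)"
      by (intro nn_integral_cong) (auto simp: ennreal_mult w_nonneg sw0)
    also have "\<dots> = (\<integral>\<^sup>+z. ennreal (szego_weight \<alpha> N z) \<partial>ac_part)"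
      by (rule nn_integral_ac_part[symmetric]) (use swm in measurable)
    also have "\<dots> \<le> (\<integral>\<^sup>+z. ennreal (szego_weight \<alpha> N z) \<partial>\<mu>)" by (rule nn_integral_ac_part_le)
    also have "\<dots> = ennreal (\<integral>z. szego_weight \<alpha> N z \<partial>\<mu>)"
      by (rule nn_integral_eq_integral) (auto intro: integrable_M cont sw0)
    finally show ?thesis by (simp add: integral_szego_weight)
  qed
  have nonneg: "AE t in angle_measure. 0 \<le> w t * szego_weight \<alpha> N (cis t)"
    by (intro AE_I2 mult_nonneg_nonneg sw0 w_nonneg) simp
  show int: "integrable angle_measure (\<lambda>t. w t * szego_weight \<alpha> N (cis t))"
  proof (rule integrableI_nonneg)
    show "(\<integral>\<^sup>+t. ennreal (w t * szego_weight \<alpha> N (cis t)) \<partial>angle_measure) < \<infinity>"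
      using nn by (auto simp: less_top[symmetric] top_unique)
  qed (use nonneg in measurable)
  have "ennreal (\<integral>t. w t * szego_weight \<alpha> N (cis t) \<partial>angle_measure) \<le> 1"
    using nn nn_integral_eq_integral[OF int nonneg] by simp
  then show "(\<integral>t. w t * szego_weight \<alpha> N (cis t) \<partial>angle_measure) \<le> 1"
    by simp
qed

lemma szego_entropy_bounded:
  assumes fin: "(\<integral>\<^sup>+t. negative_entropy m w t \<partial>angle_measure) \<noteq> \<infinity>"
  shows "\<exists>C. \<forall>N. szego_entropy m \<alpha> N \<le> C"
proof -
  \<comment> \<open>Real \<open>ln\<close> has a default value at 0. This is harmless: finiteness of
    the negative part forces the weight to vanish almost everywhere on {w = 0}, so L is 0
    there.\<close>
  define L where "L t = (1 - cos t) ^ m * ln (w t)" for t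
  have Lm [measurable]: "L \<in> borel_measurable angle_measure" unfolding L_def[abs_def] by measurable
  have AEn: "AE t in angle_measure. negative_entropy m w t \<noteq> \<infinity>"
    by (rule nn_integral_PInf_AE[OF measurable_negative_entropy[OF w_measurable]]) (use fin in simp)
  have AE: "AE t in angle_measure. 0 \<le> w t \<and> (w t = 0 \<longrightarrow> (1 - cos t) ^ m = 0)"
    using AEn AE_space
  proof eventually_elim
    case (elim t)
    then show ?case using w_nonneg[of t] negative_entropy_zero[of w t m] by (auto split: if_splits)
  qed
  \<comment> \<open>The positive part of L is at most 2^m w because ln x <= x and the weight is at
    most 2^m; the negative part is integrable by assumption. Hence the integral of L is finite and
    does not depend on N.\<close>
  have bound: "AE t in angle_measure. ennreal (norm (L t)) \<le> ennreal (2 ^ m) * ennreal (w t) + negative_entropy m w t"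
    using AE
  proof eventually_elim
    case (elim t)
    show ?case
    proof (cases "w t = 0")
      case True
      then show ?thesis using elim by (simp add: L_def)
    next
      case False
      then have w: "w t > 0" using elim by simp
      have "L t \<le> 2 ^ m * w t"
      proof -
        have "L t \<le> (1 - cos t) ^ m * w t"
          unfolding L_def using one_minus_cos_power_bounds(1)[of t m] ln_bound[OF w] by (intro mult_left_mono) auto
        also have "\<dots> \<le> 2 ^ m * w t" using one_minus_cos_power_bounds(2)[of t m] w by (intro mult_right_mono) auto
        finally show ?thesis .
      qed
      then have "norm (L t) \<le> 2 ^ m * w t + max 0 (- L t)" using w mult_nonneg_nonneg[of "2 ^ m" "w t"] by (auto simp: max_def abs_if)
      then have "ennreal (norm (L t)) \<le> ennreal (2 ^ m * w t + max 0 (- L t))" by (rule ennreal_leI)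
      also have "\<dots> = ennreal (2 ^ m * w t) + ennreal (- L t)"
        using w by (subst ennreal_plus) (auto simp: max_def ennreal_neg)
      finally show ?thesis using w by (simp add: negative_entropy_pos L_def ennreal_mult)
    qed
  qed
  have intL: "integrable angle_measure L"
  proof (rule integrableI_bounded)
    have "(\<integral>\<^sup>+t. ennreal (norm (L t)) \<partial>angle_measure) \<le> (\<integral>\<^sup>+t. ennreal (2 ^ m) * ennreal (w t) + negative_entropy m w t \<partial>angle_measure)"
      by (rule nn_integral_mono_AE[OF bound])
    also have "\<dots> = ennreal (2 ^ m) * (\<integral>\<^sup>+t. ennreal (w t) \<partial>angle_measure) + (\<integral>\<^sup>+t. negative_entropy m w t \<partial>angle_measure)"
      using measurable_negative_entropy[OF w_measurable]
      by (subst nn_integral_add; (subst nn_integral_cmult)?) auto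
    also have "\<dots> < \<infinity>"
      using fin nn_integral_w by (auto simp: ennreal_mult_less_top ennreal_mult_eq_top_iff less_top[symmetric] top_unique)
    finally show "(\<integral>\<^sup>+t. ennreal (norm (L t)) \<partial>angle_measure) < \<infinity>" .
  qed measurable
  show ?thesis
  proof (intro exI allI)
    fix N
    let ?g = "\<lambda>t. szego_weight \<alpha> N (cis t)"
    have g: "?g t > 0" for t by (rule szego_weight_pos) (rule norm_verblunsky)
    have "szego_entropy m \<alpha> N \<le> (\<integral>t. 2 ^ m * (w t * ?g t) - L t \<partial>angle_measure)"
      unfolding szego_entropy_def
    proof (rule integral_mono_AE)
      show "integrable angle_measure (\<lambda>t. (1 - cos t) ^ m * ln (?g t))"
        by (rule integrable_szego_entropy) (rule norm_verblunsky)
      show "integrable angle_measure (\<lambda>t. 2 ^ m * (w t * ?g t) - L t)"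
        by (intro Bochner_Integration.integrable_diff integrable_mult_right integrable_w_szego_weight intL)
      show "AE t in angle_measure. (1 - cos t) ^ m * ln (?g t) \<le> 2 ^ m * (w t * ?g t) - L t"
        using AE
      proof eventually_elim
        case (elim t)
        show ?case
        proof (cases "w t = 0")
          case True
          then have "(1 - cos t) ^ m = 0" using elim by blast
          then show ?thesis unfolding L_def True by (simp only: mult_zero_left mult_zero_right diff_self order_refl)
        next
          case False
          then have w: "w t > 0" using elim by simp
          have "(1 - cos t) ^ m * ln (?g t) + L t = (1 - cos t) ^ m * ln (w t * ?g t)"
            using w g[of t] by (simp add: L_def ln_mult distrib_left)
          also have "\<dots> \<le> (1 - cos t) ^ m * (w t * ?g t)"
            using one_minus_cos_power_bounds(1)[of t m] ln_bound[of "w t * ?g t"] w g[of t] by (intro mult_left_mono) auto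
          also have "\<dots> \<le> 2 ^ m * (w t * ?g t)"
            using one_minus_cos_power_bounds(2)[of t m] w g[of t] by (intro mult_right_mono) auto
          finally show ?thesis by simp
        qed
      qed
    qed
    also have "\<dots> = 2 ^ m * (\<integral>t. w t * ?g t \<partial>angle_measure) - (\<integral>t. L t \<partial>angle_measure)"
      by (subst Bochner_Integration.integral_diff) (auto intro: integrable_w_szego_weight intL)
    also have "\<dots> \<le> 2 ^ m * 1 - (\<integral>t. L t \<partial>angle_measure)"
      by (intro diff_right_mono mult_left_mono integrable_w_szego_weight) simp
    finally show "szego_entropy m \<alpha> N \<le> 2 ^ m * 1 - (\<integral>t. L t \<partial>angle_measure)" .
  qed
qed

text \<open>Taking N = deg q makes the norm of q the same for \<mu> and the Bernstein--Szego
  measure. With g = |phi_N|^2, log|q|^2 = log(|q|^2 / g) + log g: the first term is at most |q|^2 /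
  g, the second integrates to the entropy.\<close>

lemma integral_log_poly_le:
  assumes C: "\<And>N. szego_entropy m \<alpha> N \<le> C" and q: "\<And>t. poly q (cis t) \<noteq> 0"
  shows "(\<integral>t. (1 - cos t) ^ m * ln ((norm (poly q (cis t)))\<^sup>2) \<partial>angle_measure) \<le> 2 ^ m * (\<integral>z. (norm (poly q z))\<^sup>2 \<partial>\<mu>) + C"
proof -
  define N where "N = degree q"
  let ?g = "\<lambda>t. szego_weight \<alpha> N (cis t)" and ?Q = "\<lambda>t. (norm (poly q (cis t)))\<^sup>2"
  have g: "?g t > 0" for t by (rule szego_weight_pos) (rule norm_verblunsky)
  have contg: "continuous_on UNIV ?g" by (rule continuous_szego_weight) (rule norm_verblunsky)
  have intQ: "integrable angle_measure (\<lambda>t. ?Q t / ?g t)"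
    by (intro integrable_angle_continuous continuous_intros contg) (use g in \<open>auto simp: less_imp_neq[symmetric]\<close>)
  have i1: "integrable angle_measure (\<lambda>t. 2 ^ m * (?Q t / ?g t))"
    by (intro integrable_mult_right intQ)
  have i2: "integrable angle_measure (\<lambda>t. (1 - cos t) ^ m * ln (?g t))"
    by (rule integrable_szego_entropy) (rule norm_verblunsky)
  have "(\<integral>t. (1 - cos t) ^ m * ln (?Q t) \<partial>angle_measure) \<le> (\<integral>t. 2 ^ m * (?Q t / ?g t) + (1 - cos t) ^ m * ln (?g t) \<partial>angle_measure)"
  proof (rule integral_mono)
    show "integrable angle_measure (\<lambda>t. (1 - cos t) ^ m * ln (?Q t))"
      by (intro integrable_angle_continuous continuous_intros) (use q in auto)
    show "integrable angle_measure (\<lambda>t. 2 ^ m * (?Q t / ?g t) + (1 - cos t) ^ m * ln (?g t))"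
      by (intro Bochner_Integration.integrable_add i1 i2)
    fix t
    have Q: "?Q t > 0" using q by simp
    have "ln (?Q t) = ln (?Q t / ?g t) + ln (?g t)" using Q g[of t] by (subst ln_div) auto
    then have "(1 - cos t) ^ m * ln (?Q t) = (1 - cos t) ^ m * ln (?Q t / ?g t) + (1 - cos t) ^ m * ln (?g t)"
      by (simp add: distrib_left)
    moreover have "(1 - cos t) ^ m * ln (?Q t / ?g t) \<le> (1 - cos t) ^ m * (?Q t / ?g t)"
      using one_minus_cos_power_bounds(1)[of t m] ln_bound[of "?Q t / ?g t"] Q g[of t] by (intro mult_left_mono) auto
    moreover have "\<dots> \<le> 2 ^ m * (?Q t / ?g t)"
      using one_minus_cos_power_bounds(2)[of t m] Q g[of t] by (intro mult_right_mono) auto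
    ultimately show "(1 - cos t) ^ m * ln (?Q t) \<le> 2 ^ m * (?Q t / ?g t) + (1 - cos t) ^ m * ln (?g t)" by linarith
  qed
  also have "\<dots> = 2 ^ m * (\<integral>t. ?Q t / ?g t \<partial>angle_measure) + szego_entropy m \<alpha> N"
    unfolding szego_entropy_def
    unfolding Bochner_Integration.integral_add[OF i1 i2] integral_mult_right_zero ..
  also have "(\<integral>t. ?Q t / ?g t \<partial>angle_measure) = (\<integral>z. (norm (poly q z))\<^sup>2 \<partial>bernstein_szego \<alpha> N)"
    by (subst integral_bernstein_szego) (auto intro!: norm_verblunsky continuous_intros simp: szego_weight_def mult.commute)
  also have "\<dots> = (\<integral>z. (norm (poly q z))\<^sup>2 \<partial>\<mu>)"
  proof -
    have bs: "circle_measure (bernstein_szego \<alpha> N)" by (rule circle_measure_bernstein_szego) (rule norm_verblunsky)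
    have "poly_inner (bernstein_szego \<alpha> N) q q = poly_inner \<mu> q q"
    proof (rule inner_eq_of_orthogonal[OF bs circle_measure_axioms])
      show "circle_measure.szego_orthogonal (bernstein_szego \<alpha> N) \<alpha> n" if "n \<le> N" for n
        by (rule circle_measure.szego_orthogonal_le[OF bs _ bernstein_szego_orthogonal that]) (rule norm_verblunsky)+
      show "szego_orthogonal \<alpha> n" for n by (rule szego_orthogonal_of_verblunsky[OF prob verblunsky])
      show "coeff q k = 0" if "N < k" for k using that by (simp add: N_def coeff_eq_0)
    qed
    then show ?thesis unfolding inner_self circle_measure.inner_self[OF bs] of_real_eq_iff .
  qed
  finally show ?thesis using C[of N] by linarith
qed

end

section \<open>Approximation by trigonometric polynomials and by continuous functions\<close>

lemma circle_real_poly_dense: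
  fixes f :: "complex \<Rightarrow> real"
  assumes f: "continuous_on (sphere 0 1) f" and e: "e > 0"
  obtains g n q where "\<And>z. z \<in> sphere 0 1 \<Longrightarrow> \<bar>f z - g z\<bar> < e"
    "\<And>z. z \<in> sphere 0 1 \<Longrightarrow> complex_of_real (g z) * z ^ n = poly q z"
proof -
  \<comment> \<open>Real trigonometric polynomials, with negative powers cleared by z^n. In this
    form |q| = |g| on the circle, so a positive approximant is the modulus of a polynomial.\<close>
  define R where "R = {g :: complex \<Rightarrow> real. \<exists>n q. \<forall>z\<in>sphere 0 1. complex_of_real (g z) * z ^ n = poly q z}"
  interpret function_ring_on R "sphere 0 1"
  proof
    show "compact (sphere 0 1 :: complex set)" by simp
  next
    fix g assume "g \<in> R"
    then obtain n q where g: "\<And>z. z \<in> sphere 0 1 \<Longrightarrow> complex_of_real (g z) * z ^ n = poly q z" unfolding R_def by blast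
    have "continuous_on (sphere 0 1) (\<lambda>z. Re (poly q z / z ^ n))"
      by (intro continuous_intros) auto
    moreover have "Re (poly q z / z ^ n) = g z" if "z \<in> sphere 0 1" for z
    proof -
      have "z ^ n \<noteq> 0" using that by auto
      then have "poly q z / z ^ n = complex_of_real (g z)" using g[OF that] by (simp add: field_simps)
      then show ?thesis by simp
    qed
    ultimately show "continuous_on (sphere 0 1) g" by (rule continuous_on_eq)
  next
    fix g h assume "g \<in> R" "h \<in> R"
    then obtain n1 q1 n2 q2 where g: "\<And>z. z \<in> sphere 0 1 \<Longrightarrow> complex_of_real (g z) * z ^ n1 = poly q1 z"
      and h: "\<And>z. z \<in> sphere 0 1 \<Longrightarrow> complex_of_real (h z) * z ^ n2 = poly q2 z" unfolding R_def by blast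
    have "complex_of_real (g z + h z) * z ^ (n1 + n2) = poly (q1 * monom 1 n2 + q2 * monom 1 n1) z" if "z \<in> sphere 0 1" for z
      using g[OF that, symmetric] h[OF that, symmetric] by (simp add: poly_monom power_add algebra_simps)
    then show "(\<lambda>x. g x + h x) \<in> R" unfolding R_def by blast
    have "complex_of_real (g z * h z) * z ^ (n1 + n2) = poly (q1 * q2) z" if "z \<in> sphere 0 1" for z
      using g[OF that, symmetric] h[OF that, symmetric] by (simp add: power_add algebra_simps)
    then show "(\<lambda>x. g x * h x) \<in> R" unfolding R_def by blast
  next
    fix c :: real
    have "complex_of_real c * z ^ 0 = poly [:of_real c:] z" for z by simp
    then show "(\<lambda>_. c) \<in> R" unfolding R_def by blast
  next
    fix x y :: complex assume "x \<noteq> y"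
    \<comment> \<open>On the circle conj(z) = 1/z, which makes both coordinates members of
      \<open>R\<close>; together they separate points.\<close>
    have sq: "complex_of_real (2 * Re z) * z = z\<^sup>2 + 1" "complex_of_real (2 * Im z) * z = \<i> * (1 - z\<^sup>2)" if "z \<in> sphere 0 1" for z
    proof -
      have c: "cnj z * z = 1" using that by (intro cnj_mult_circle) simp
      have "complex_of_real (2 * Re z) = z + cnj z" by (simp add: complex_eq_iff)
      then show "complex_of_real (2 * Re z) * z = z\<^sup>2 + 1"
        by (simp only: distrib_right c power2_eq_square)
      have "complex_of_real (2 * Im z) = \<i> * (cnj z - z)" by (simp add: complex_eq_iff)
      then show "complex_of_real (2 * Im z) * z = \<i> * (1 - z\<^sup>2)"
        by (simp only: mult.assoc left_diff_distrib c power2_eq_square)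
    qed
    have "complex_of_real (2 * Re z) * z ^ 1 = poly [:1, 0, 1:] z" if "z \<in> sphere 0 1" for z
      using sq(1)[OF that] by (simp add: power2_eq_square)
    then have 1: "(\<lambda>z. 2 * Re z) \<in> R" unfolding R_def by blast
    have "complex_of_real (2 * Im z) * z ^ 1 = poly [:\<i>, 0, - \<i>:] z" if "z \<in> sphere 0 1" for z
      using sq(2)[OF that] by (simp add: power2_eq_square algebra_simps)
    then have 2: "(\<lambda>z. 2 * Im z) \<in> R" unfolding R_def by blast
    show "\<exists>f\<in>R. f x \<noteq> f y"
    proof (cases "Re x = Re y")
      case True
      then show ?thesis using \<open>x \<noteq> y\<close> by (intro bexI[OF _ 2]) (simp add: complex_eq_iff)
    next
      case False
      then show ?thesis by (intro bexI[OF _ 1]) simp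
    qed
  qed
  obtain g where "g \<in> R" "\<forall>z\<in>sphere 0 1. \<bar>f z - g z\<bar> < e"
    using Stone_Weierstrass_basic[OF f e] by blast
  then show thesis unfolding R_def using that by blast
qed

text \<open>For an indicator, regularity gives a compact K inside A and an open U around it with U -
  K of small measure, and a Urysohn function between them differs from the indicator only on U - K.
  Sums and dominated limits follow by the triangle inequality.\<close>

lemma continuous_L1_dense:
  fixes \<nu> :: "complex measure" and g :: "complex \<Rightarrow> real"
  assumes sets: "sets \<nu> = sets borel" and fin: "finite_measure \<nu>" and g: "integrable \<nu> g"
  shows "\<forall>e>0. \<exists>h. continuous_on UNIV h \<and> (\<integral>\<^sup>+z. ennreal \<bar>g z - h z\<bar> \<partial>\<nu>) < ennreal e"
proof -
  have contm: "h \<in> borel_measurable \<nu>" if "continuous_on UNIV h" for h :: "complex \<Rightarrow> real"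
    unfolding measurable_cong_sets[OF sets refl] by (rule borel_measurable_continuous_onI[OF that])
  from g show ?thesis
  proof (induction rule: integrable_induct)
    case (base A c)
    interpret finite_measure \<nu> by fact
    show ?case
    proof (intro allI impI)
      fix e :: real assume e: "e > 0"
      \<comment> \<open>The error is at most |c| times the measure of U - K, which is below 2 d; the
        summand 1 covers c = 0.\<close>
      define d where "d = e / (2 * (\<bar>c\<bar> + 1))"
      have d: "d > 0" using e by (simp add: d_def)
      have A: "A \<in> sets borel" using base sets by simp
      have fin': "emeasure \<nu> (space \<nu>) \<noteq> \<infinity>" by simp
      have finA: "emeasure \<nu> A < \<infinity>" using base by simp
      have "emeasure \<nu> A < emeasure \<nu> A + ennreal d"
        using d by (simp add: emeasure_eq_measure ennreal_plus[symmetric] ennreal_lessI add_nonneg_pos del: ennreal_plus)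
      then have "(INF U \<in> {U. A \<subseteq> U \<and> open U}. emeasure \<nu> U) < emeasure \<nu> A + ennreal d"
        using outer_regular[OF sets fin' A] by simp
      then obtain U where U: "A \<subseteq> U" "open U" "emeasure \<nu> U < emeasure \<nu> A + ennreal d" unfolding INF_less_iff by blast
      have "measure \<nu> U < measure \<nu> A + d"
        using U(3) d by (simp add: emeasure_eq_measure ennreal_plus[symmetric] ennreal_less_iff del: ennreal_plus)
      \<comment> \<open>No real lies strictly below measure 0 in \<open>ennreal\<close>, hence the
        separate case with K empty; \<open>min\<close> keeps the lower bound nonnegative
        otherwise.\<close>
      obtain K where K: "K \<subseteq> A" "compact K" "measure \<nu> A < measure \<nu> K + d"
      proof (cases "measure \<nu> A = 0")
        case True
        then show thesis using that[of "{}"] d by simp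
      next
        case False
        then have mA: "measure \<nu> A > 0" by (simp add: zero_less_measure_iff)
        have "ennreal (measure \<nu> A - min d (measure \<nu> A)) < ennreal (measure \<nu> A)" using d mA by (intro ennreal_lessI) auto
        then have "ennreal (measure \<nu> A - min d (measure \<nu> A)) < (SUP K \<in> {K. K \<subseteq> A \<and> compact K}. emeasure \<nu> K)"
          using inner_regular[OF sets fin' A] by (simp add: emeasure_eq_measure)
        then obtain K where K: "K \<subseteq> A" "compact K" "ennreal (measure \<nu> A - min d (measure \<nu> A)) < emeasure \<nu> K"
          unfolding less_SUP_iff by blast
        have "measure \<nu> A - min d (measure \<nu> A) < measure \<nu> K"
          using K(3) by (simp add: emeasure_eq_measure ennreal_less_iff)
        then show thesis using that[OF K(1,2)] by linarith
      qed
      have mUK: "U - K \<in> sets \<nu>" using U K by (auto simp: sets compact_imp_closed borel_open borel_closed)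
      have KU: "K \<subseteq> U" using K U by blast
      have "measure \<nu> (U - K) = measure \<nu> U - measure \<nu> K"
        by (rule finite_measure_Diff) (use U K KU in \<open>auto simp: sets compact_imp_closed borel_open borel_closed\<close>)
      then have mlt: "measure \<nu> (U - K) < 2 * d" using \<open>measure \<nu> U < measure \<nu> A + d\<close> K(3) by linarith
      obtain h where h: "continuous_on UNIV h" "\<And>x. h x \<in> closed_segment (0::real) 1" "\<And>x. x \<in> - U \<Longrightarrow> h x = 0" "\<And>x. x \<in> K \<Longrightarrow> h x = 1"
        using Urysohn[of "- U" K 0 "1::real"] U K KU by (auto simp: compact_imp_closed)
      have h01: "0 \<le> h x" "h x \<le> 1" for x using h(2)[of x] by (auto simp: closed_segment_eq_real_ivl)
      have "(\<integral>\<^sup>+z. ennreal \<bar>indicator A z *\<^sub>R c - c * h z\<bar> \<partial>\<nu>) \<le> (\<integral>\<^sup>+z. ennreal \<bar>c\<bar> * indicator (U - K) z \<partial>\<nu>)"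
      proof (rule nn_integral_mono)
        fix z
        have "\<bar>indicator A z *\<^sub>R c - c * h z\<bar> \<le> \<bar>c\<bar> * indicator (U - K) z"
        proof -
          have "indicator A z *\<^sub>R c - c * h z = c * (indicator A z - h z)" by (simp add: algebra_simps)
          moreover have "\<bar>indicator A z - h z\<bar> \<le> indicator (U - K) z"
            using h01[of z] h(3)[of z] h(4)[of z] U(1) K(1) by (auto simp: indicator_def split: if_splits)
          ultimately show ?thesis by (simp add: abs_mult mult_left_mono)
        qed
        then have "ennreal \<bar>indicator A z *\<^sub>R c - c * h z\<bar> \<le> ennreal (\<bar>c\<bar> * indicator (U - K) z)" by (rule ennreal_leI)
        then show "ennreal \<bar>indicator A z *\<^sub>R c - c * h z\<bar> \<le> ennreal \<bar>c\<bar> * indicator (U - K) z"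
          by (simp add: ennreal_mult ennreal_indicator)
      qed
      also have "\<dots> = ennreal (\<bar>c\<bar> * measure \<nu> (U - K))"
        using mUK by (simp add: nn_integral_cmult_indicator emeasure_eq_measure ennreal_mult)
      also have "\<dots> < ennreal e"
      proof (rule ennreal_lessI[OF e])
        have "\<bar>c\<bar> * measure \<nu> (U - K) \<le> \<bar>c\<bar> * (2 * d)" using mlt by (intro mult_left_mono) auto
        also have "\<dots> < (\<bar>c\<bar> + 1) * (2 * d)" using d by (intro mult_strict_right_mono) auto
        also have "\<dots> = e"
        proof -
          have "a * (2 * (e / (2 * a))) = e" if "a \<noteq> 0" for a :: real using that by simp
          moreover have "\<bar>c\<bar> + 1 \<noteq> 0" using abs_ge_zero[of c] by linarith
          ultimately show ?thesis unfolding d_def by blast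
        qed
        finally show "\<bar>c\<bar> * measure \<nu> (U - K) < e" .
      qed
      finally show "\<exists>h. continuous_on UNIV h \<and> (\<integral>\<^sup>+z. ennreal \<bar>indicator A z *\<^sub>R c - h z\<bar> \<partial>\<nu>) < ennreal e"
        by (intro exI[of _ "\<lambda>z. c * h z"] conjI continuous_intros h(1))
    qed
  next
    case (add f g)
    show ?case
    proof (intro allI impI)
      fix e :: real assume "e > 0"
      then have e: "e / 2 > 0" by simp
      obtain h1 where h1: "continuous_on UNIV h1" "(\<integral>\<^sup>+z. ennreal \<bar>f z - h1 z\<bar> \<partial>\<nu>) < ennreal (e / 2)"
        using add.IH(1) e by blast
      obtain h2 where h2: "continuous_on UNIV h2" "(\<integral>\<^sup>+z. ennreal \<bar>g z - h2 z\<bar> \<partial>\<nu>) < ennreal (e / 2)"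
        using add.IH(2) e by blast
      have m: "f \<in> borel_measurable \<nu>" "g \<in> borel_measurable \<nu>" "h1 \<in> borel_measurable \<nu>" "h2 \<in> borel_measurable \<nu>"
        by (rule borel_measurable_integrable contm add.hyps h1 h2)+
      have "(\<integral>\<^sup>+z. ennreal \<bar>f z + g z - (h1 z + h2 z)\<bar> \<partial>\<nu>) \<le> (\<integral>\<^sup>+z. ennreal \<bar>f z - h1 z\<bar> + ennreal \<bar>g z - h2 z\<bar> \<partial>\<nu>)"
        by (intro nn_integral_mono) (simp add: ennreal_plus[symmetric] ennreal_leI del: ennreal_plus)
      also have "\<dots> = (\<integral>\<^sup>+z. ennreal \<bar>f z - h1 z\<bar> \<partial>\<nu>) + (\<integral>\<^sup>+z. ennreal \<bar>g z - h2 z\<bar> \<partial>\<nu>)"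
        by (rule nn_integral_add) (use m in measurable)
      also have "\<dots> < ennreal (e / 2) + ennreal (e / 2)" by (rule add_strict_mono[OF h1(2) h2(2)])
      also have "\<dots> = ennreal e" using e by (simp add: ennreal_plus[symmetric] del: ennreal_plus)
      finally show "\<exists>h. continuous_on UNIV h \<and> (\<integral>\<^sup>+z. ennreal \<bar>f z + g z - h z\<bar> \<partial>\<nu>) < ennreal e"
        by (intro exI[of _ "\<lambda>z. h1 z + h2 z"] conjI continuous_intros h1 h2)
    qed
  next
    case (lim f s)
    show ?case
    proof (intro allI impI)
      fix e :: real assume "e > 0"
      then have e: "e / 2 > 0" by simp
      have m: "f \<in> borel_measurable \<nu>" "\<And>i. s i \<in> borel_measurable \<nu>" using lim.hyps by (auto dest: borel_measurable_integrable)
      have "(\<lambda>i. \<integral>\<^sup>+z. ennreal (norm (f z - s i z)) \<partial>\<nu>) \<longlonglongrightarrow> 0"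
      proof (rule nn_integral_dominated_convergence_norm[where w = "\<lambda>z. 2 * norm (f z)"])
        show "(\<integral>\<^sup>+z. ennreal (2 * norm (f z)) \<partial>\<nu>) < \<infinity>"
        proof -
          have "integrable \<nu> (\<lambda>z. 2 * f z)" by (rule integrable_mult_right) (rule lim.hyps)
          then show ?thesis unfolding integrable_iff_bounded by (simp add: abs_mult)
        qed
      qed (use lim.hyps m in auto)
      then have "\<forall>\<^sub>F i in sequentially. (\<integral>\<^sup>+z. ennreal (norm (f z - s i z)) \<partial>\<nu>) < ennreal (e / 2)"
        by (rule order_tendstoD) (use e in simp)
      then obtain i where i: "(\<integral>\<^sup>+z. ennreal (norm (f z - s i z)) \<partial>\<nu>) < ennreal (e / 2)"
        by (auto simp: eventually_sequentially)
      obtain h where h: "continuous_on UNIV h" "(\<integral>\<^sup>+z. ennreal \<bar>s i z - h z\<bar> \<partial>\<nu>) < ennreal (e / 2)"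
        using lim.IH[of i] e by blast
      have hm: "h \<in> borel_measurable \<nu>" by (rule contm[OF h(1)])
      have "(\<integral>\<^sup>+z. ennreal \<bar>f z - h z\<bar> \<partial>\<nu>) \<le> (\<integral>\<^sup>+z. ennreal (norm (f z - s i z)) + ennreal \<bar>s i z - h z\<bar> \<partial>\<nu>)"
        by (intro nn_integral_mono) (simp add: ennreal_plus[symmetric] ennreal_leI del: ennreal_plus)
      also have "\<dots> = (\<integral>\<^sup>+z. ennreal (norm (f z - s i z)) \<partial>\<nu>) + (\<integral>\<^sup>+z. ennreal \<bar>s i z - h z\<bar> \<partial>\<nu>)"
        by (rule nn_integral_add) (use m hm in measurable)
      also have "\<dots> < ennreal (e / 2) + ennreal (e / 2)" by (rule add_strict_mono[OF i h(2)])
      also have "\<dots> = ennreal e" using e by (simp add: ennreal_plus[symmetric] del: ennreal_plus)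
      finally show "\<exists>h. continuous_on UNIV h \<and> (\<integral>\<^sup>+z. ennreal \<bar>f z - h z\<bar> \<partial>\<nu>) < ennreal e"
        using h(1) by blast
    qed
  qed
qed

text \<open>An approximation in L^1 of the sum is one in L^1 of both measures, so a single
  continuous function serves for \<mu> and for d\<theta>/2\<pi>.\<close>

definition measure_add :: "'a measure \<Rightarrow> 'a measure \<Rightarrow> 'a measure" where
  "measure_add M N = measure_of (space M) (sets M) (\<lambda>A. emeasure M A + emeasure N A)"

lemma sets_measure_add [simp]: "sets (measure_add M N) = sets M"
  by (simp add: measure_add_def)

lemma space_measure_add [simp]: "space (measure_add M N) = space M"
  by (simp add: measure_add_def)

lemma emeasure_measure_add:
  assumes s: "sets N = sets M" and A: "A \<in> sets M"
  shows "emeasure (measure_add M N) A = emeasure M A + emeasure N A"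
proof (rule emeasure_measure_of[OF measure_add_def])
  show "countably_additive (sets (measure_add M N)) (\<lambda>A. emeasure M A + emeasure N A)"
  proof (rule countably_additiveI)
    fix F :: "nat \<Rightarrow> 'a set" assume F: "range F \<subseteq> sets (measure_add M N)" "disjoint_family F"
    have "(\<Sum>i. emeasure M (F i) + emeasure N (F i)) = (\<Sum>i. emeasure M (F i)) + (\<Sum>i. emeasure N (F i))"
      by (rule suminf_add[symmetric]) auto
    also have "\<dots> = emeasure M (\<Union>i. F i) + emeasure N (\<Union>i. F i)"
      using F s by (simp add: suminf_emeasure)
    finally show "(\<Sum>i. emeasure M (F i) + emeasure N (F i)) = emeasure M (\<Union>i. F i) + emeasure N (\<Union>i. F i)" .
  qed
qed (use A sets.space_closed in \<open>auto simp: positive_def\<close>)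

lemma nn_integral_le_measure_add:
  assumes s: "sets N = sets M"
  shows "(\<integral>\<^sup>+x. f x \<partial>M) \<le> (\<integral>\<^sup>+x. f x \<partial>measure_add M N)" "(\<integral>\<^sup>+x. f x \<partial>N) \<le> (\<integral>\<^sup>+x. f x \<partial>measure_add M N)"
proof -
  show "(\<integral>\<^sup>+x. f x \<partial>M) \<le> (\<integral>\<^sup>+x. f x \<partial>measure_add M N)"
  proof (rule nn_integral_mono_measure)
    show "M \<le> measure_add M N" by (subst le_measure) (simp_all add: emeasure_measure_add[OF s])
  qed simp
  show "(\<integral>\<^sup>+x. f x \<partial>N) \<le> (\<integral>\<^sup>+x. f x \<partial>measure_add M N)"
  proof (rule nn_integral_mono_measure)
    show "N \<le> measure_add M N" by (subst le_measure) (simp_all add: emeasure_measure_add[OF s] s)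
  qed (simp add: s)
qed

text \<open>A Borel inverse of \<open>cis\<close> on the period. Clamping keeps the argument of
  \<open>arccos\<close> in [-1, 1] off the circle, so that it is continuous on the whole
  plane.\<close>

definition circle_angle :: "complex \<Rightarrow> real" where
  "circle_angle z = (if Im z \<ge> 0 then arccos (max (-1) (min 1 (Re z))) else 2 * pi - arccos (max (-1) (min 1 (Re z))))"

lemma measurable_circle_angle [measurable]: "circle_angle \<in> borel_measurable borel"
proof -
  have "continuous_on UNIV (\<lambda>z. arccos (max (-1) (min 1 (Re z))))"
    by (intro continuous_on_arccos continuous_intros) auto
  then have [measurable]: "(\<lambda>z. arccos (max (-1) (min 1 (Re z)))) \<in> borel_measurable borel"
    by (rule borel_measurable_continuous_onI)
  show ?thesis unfolding circle_angle_def[abs_def] by measurable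
qed

lemma circle_angle_cis:
  assumes "t \<in> {0..<2 * pi}"
  shows "circle_angle (cis t) = t"
proof -
  have c: "max (- 1) (min 1 (cos t)) = cos t" using cos_le_one[of t] cos_ge_minus_one[of t] by simp
  show ?thesis
  proof (cases "t \<le> pi")
    case True
    then have "sin t \<ge> 0" using assms by (intro sin_ge_zero) auto
    then show ?thesis using True assms by (simp add: circle_angle_def c arccos_cos)
  next
    case False
    then have s: "sin t < 0" using assms by (intro sin_lt_zero) auto
    have "cos t = cos (2 * pi - t)" by (simp add: cos_diff)
    then have "arccos (cos t) = arccos (cos (2 * pi - t))" by (rule arg_cong)
    also have "\<dots> = 2 * pi - t" by (rule arccos_cos) (use False assms in auto)
    finally have "arccos (cos t) = 2 * pi - t" .
    then show ?thesis using s by (simp add: circle_angle_def c)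
  qed
qed

text \<open>By convexity, exp y lies above the tangent at x. Only x has to be bounded by K, since
  the estimate is one-sided.\<close>

lemma exp_diff_le: "exp x - exp y \<le> exp K * \<bar>x - y\<bar>" if "x \<le> K" for x y K :: real
proof (cases "y \<le> x")
  case True
  have "exp x * (1 + (y - x)) \<le> exp x * exp (y - x)"
    by (intro mult_left_mono exp_ge_add_one_self) simp
  also have "\<dots> = exp y" by (simp add: exp_add[symmetric])
  finally have "exp x - exp y \<le> exp x * (x - y)" by (simp add: algebra_simps)
  also have "\<dots> \<le> exp K * (x - y)" using that True by (intro mult_right_mono) auto
  finally show ?thesis using True by simp
next
  case False
  then have "exp x - exp y \<le> 0" by simp
  also have "0 \<le> exp K * \<bar>x - y\<bar>" by simp
  finally show ?thesis .
qed

section \<open>From bounded entropies to a finite logarithmic integral\<close>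

context circle_decomposition
begin

lemma measurable_mu: "f \<in> borel_measurable borel \<Longrightarrow> f \<in> borel_measurable \<mu>"
  unfolding measurable_cong_sets[OF sets_mu refl] circle_borel_def by (rule measurable_restrict_space1)

lemma measurable_angle_cis: "f \<in> borel_measurable borel \<Longrightarrow> (\<lambda>t. f (cis t)) \<in> borel_measurable angle_measure"
  by (rule measurable_angle_measure, rule measurable_compose[of cis borel borel f], rule borel_measurable_continuous_onI)
     (intro continuous_intros)

text \<open>Approximating exp(h/2) up to factors 1 - \<epsilon> and 1 + \<epsilon> by the modulus of
  a polynomial q reduces the claim to the bound for log|q|^2.\<close>

lemma integral_continuous_le:
  assumes C: "\<And>N. szego_entropy m \<alpha> N \<le> C" and h: "continuous_on (sphere 0 1) h"
  shows "(\<integral>t. (1 - cos t) ^ m * h (cis t) \<partial>angle_measure) \<le> 2 ^ m * (\<integral>z. exp (h z) \<partial>\<mu>) + C"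
proof -
  define p0 where "p0 = sum_rule_coeff m 0"
  define X where "X = (\<integral>t. (1 - cos t) ^ m * h (cis t) \<partial>angle_measure)"
  define E where "E = (\<integral>z. exp (h z) \<partial>\<mu>)"
  obtain B where B: "\<forall>y\<in>h ` sphere 0 1. norm y \<le> B"
    using compact_imp_bounded[OF compact_continuous_image[OF h compact_sphere]] unfolding bounded_iff by blast
  define f where "f z = exp (h z / 2)" for z
  \<comment> \<open>A positive lower bound of \<open>f\<close> on the circle, so that the uniform
    error \<open>\<epsilon> * c\<close> is a relative error \<epsilon>.\<close>
  define c where "c = exp (- B / 2)"
  have c0: "c > 0" by (simp add: c_def)
  have fc: "f z \<ge> c" if "z \<in> sphere 0 1" for z
  proof -
    have "\<bar>h z\<bar> \<le> B" using B that by auto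
    then show ?thesis by (simp add: f_def c_def)
  qed
  have f: "continuous_on (sphere 0 1) f" unfolding f_def using h by (intro continuous_intros) auto
  have hc: "continuous_on UNIV (\<lambda>t. h (cis t))"
    by (rule continuous_on_compose2[OF h]) (auto intro: continuous_intros)
  have main: "X + 2 * ln (1 - \<epsilon>) * p0 \<le> 2 ^ m * ((1 + \<epsilon>)\<^sup>2 * E) + C" if \<epsilon>: "0 < \<epsilon>" "\<epsilon> < 1" for \<epsilon>
  proof -
    have "\<epsilon> * c > 0" using \<epsilon> c0 by simp
    then obtain g n q where g: "\<And>z. z \<in> sphere 0 1 \<Longrightarrow> \<bar>f z - g z\<bar> < \<epsilon> * c"
      "\<And>z. z \<in> sphere 0 1 \<Longrightarrow> complex_of_real (g z) * z ^ n = poly q z"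
      using circle_real_poly_dense[OF f] by metis
    have g1: "(1 - \<epsilon>) * f z \<le> g z" and g2: "g z \<le> (1 + \<epsilon>) * f z" if "z \<in> sphere 0 1" for z
    proof -
      have "\<epsilon> * c \<le> \<epsilon> * f z" using fc[OF that] \<epsilon> by (intro mult_left_mono) auto
      then show "(1 - \<epsilon>) * f z \<le> g z" "g z \<le> (1 + \<epsilon>) * f z" using g(1)[OF that] by (auto simp: algebra_simps)
    qed
    have gpos: "g z > 0" if "z \<in> sphere 0 1" for z
    proof -
      have "(1 - \<epsilon>) * f z > 0" using \<epsilon> by (simp add: f_def)
      then show ?thesis using g1[OF that] by linarith
    qed
    have nq: "norm (poly q z) = g z" if "z \<in> sphere 0 1" for z
      using g(2)[OF that, symmetric] gpos[OF that] that by (simp add: norm_mult norm_power)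
    have q0: "poly q (cis t) \<noteq> 0" for t using nq[of "cis t"] gpos[of "cis t"] by auto
    have "X + 2 * ln (1 - \<epsilon>) * p0 = (\<integral>t. (1 - cos t) ^ m * h (cis t) + 2 * ln (1 - \<epsilon>) * (1 - cos t) ^ m \<partial>angle_measure)"
      unfolding X_def p0_def integral_one_minus_cos_power[symmetric]
      by (subst Bochner_Integration.integral_add) (auto intro!: integrable_angle_continuous continuous_intros hc)
    also have "\<dots> \<le> (\<integral>t. (1 - cos t) ^ m * ln ((norm (poly q (cis t)))\<^sup>2) \<partial>angle_measure)"
    proof (rule integral_mono)
      show "integrable angle_measure (\<lambda>t. (1 - cos t) ^ m * h (cis t) + 2 * ln (1 - \<epsilon>) * (1 - cos t) ^ m)"
        by (intro integrable_angle_continuous continuous_intros hc)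
      show "integrable angle_measure (\<lambda>t. (1 - cos t) ^ m * ln ((norm (poly q (cis t)))\<^sup>2))"
        by (intro integrable_angle_continuous continuous_intros) (use q0 in auto)
      fix t
      let ?z = "cis t"
      have z: "?z \<in> sphere 0 1" by simp
      have "ln ((1 - \<epsilon>) * f ?z) \<le> ln (g ?z)"
        using g1[OF z] gpos[OF z] \<epsilon> by (subst ln_le_cancel_iff) (auto simp: f_def)
      moreover have "ln ((1 - \<epsilon>) * f ?z) = ln (1 - \<epsilon>) + h ?z / 2"
        using \<epsilon> by (subst ln_mult) (auto simp: f_def)
      moreover have "ln ((norm (poly q ?z))\<^sup>2) = 2 * ln (g ?z)"
        unfolding nq[OF z] using gpos[OF z] by (simp add: ln_realpow)
      ultimately have "h ?z + 2 * ln (1 - \<epsilon>) \<le> ln ((norm (poly q ?z))\<^sup>2)" by linarith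
      then have "(1 - cos t) ^ m * (h ?z + 2 * ln (1 - \<epsilon>)) \<le> (1 - cos t) ^ m * ln ((norm (poly q ?z))\<^sup>2)"
        by (intro mult_left_mono one_minus_cos_power_bounds)
      then show "(1 - cos t) ^ m * h ?z + 2 * ln (1 - \<epsilon>) * (1 - cos t) ^ m \<le> (1 - cos t) ^ m * ln ((norm (poly q ?z))\<^sup>2)"
        by (simp add: algebra_simps)
    qed
    also have "\<dots> \<le> 2 ^ m * (\<integral>z. (norm (poly q z))\<^sup>2 \<partial>\<mu>) + C" by (rule integral_log_poly_le[OF C q0])
    also have "(\<integral>z. (norm (poly q z))\<^sup>2 \<partial>\<mu>) \<le> (\<integral>z. (1 + \<epsilon>)\<^sup>2 * exp (h z) \<partial>\<mu>)"
    proof (rule integral_mono)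
      show "integrable \<mu> (\<lambda>z. (norm (poly q z))\<^sup>2)" by (intro integrable_M continuous_intros)
      show "integrable \<mu> (\<lambda>z. (1 + \<epsilon>)\<^sup>2 * exp (h z))" by (intro integrable_M continuous_intros h)
      fix z assume "z \<in> space \<mu>"
      then have z: "z \<in> sphere 0 1" by (simp add: space_M)
      have "(g z)\<^sup>2 \<le> ((1 + \<epsilon>) * f z)\<^sup>2" using g2[OF z] gpos[OF z] by (intro power_mono) auto
      also have "\<dots> = (1 + \<epsilon>)\<^sup>2 * exp (h z)"
        by (simp add: f_def power_mult_distrib exp_double[symmetric])
      finally show "(norm (poly q z))\<^sup>2 \<le> (1 + \<epsilon>)\<^sup>2 * exp (h z)" unfolding nq[OF z] .
    qed
    also have "(\<integral>z. (1 + \<epsilon>)\<^sup>2 * exp (h z) \<partial>\<mu>) = (1 + \<epsilon>)\<^sup>2 * E" unfolding E_def by simp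
    finally show ?thesis by simp
  qed
  \<comment> \<open>The case \<epsilon> = 0 is reached as a one-sided limit, since the approximation
    requires \<epsilon> > 0.\<close>
  have "X + 2 * ln (1 - 0) * p0 \<le> 2 ^ m * ((1 + 0)\<^sup>2 * E) + C"
  proof (rule tendsto_le[OF trivial_limit_at_right_real])
    show "((\<lambda>\<epsilon>. X + 2 * ln (1 - \<epsilon>) * p0) \<longlongrightarrow> X + 2 * ln (1 - 0) * p0) (at_right 0)"
      by (intro tendsto_intros) auto
    show "((\<lambda>\<epsilon>. 2 ^ m * ((1 + \<epsilon>)\<^sup>2 * E) + C) \<longlongrightarrow> 2 ^ m * ((1 + 0)\<^sup>2 * E) + C) (at_right 0)"
      by (intro tendsto_intros)
    show "\<forall>\<^sub>F \<epsilon> in at_right 0. X + 2 * ln (1 - \<epsilon>) * p0 \<le> 2 ^ m * ((1 + \<epsilon>)\<^sup>2 * E) + C"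
      by (rule eventually_mono[OF eventually_at_right_real[of 0 1]]) (use main in auto)
  qed
  then show ?thesis by (simp add: X_def E_def)
qed

lemma integral_bounded_le:
  assumes C: "\<And>N. szego_entropy m \<alpha> N \<le> C" and g: "g \<in> borel_measurable borel" and K: "\<And>z. \<bar>g z\<bar> \<le> K"
  shows "(\<integral>t. (1 - cos t) ^ m * g (cis t) \<partial>angle_measure) \<le> 2 ^ m * (\<integral>z. exp (g z) \<partial>\<mu>) + C"
proof (rule field_le_epsilon)
  fix e :: real assume e: "e > 0"
  \<comment> \<open>An L^1 error d costs 2^m d on the left and 2^m exp(K) d on the right, e in
    total.\<close>
  define d where "d = e / (2 ^ m * (1 + exp K))"
  have pos: "2 ^ m * (1 + exp K) > 0" by (intro mult_pos_pos add_pos_pos) auto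
  have d: "d > 0" unfolding d_def using e pos by (rule divide_pos_pos)
  define M1 where "M1 = distr \<mu> borel (\<lambda>z. z)"
  define M2 where "M2 = distr angle_measure borel cis"
  define \<nu> where "\<nu> = measure_add M1 M2"
  have idm: "(\<lambda>z. z) \<in> measurable \<mu> borel" by (rule measurable_mu) simp
  have cism: "cis \<in> measurable angle_measure borel"
    by (intro measurable_angle_measure borel_measurable_continuous_onI continuous_intros)
  interpret M1: prob_space M1 unfolding M1_def by (rule prob_space_distr[OF idm])
  interpret M2: prob_space M2 unfolding M2_def by (rule angle.prob_space_distr[OF cism])
  have s: "sets M2 = sets M1" by (simp add: M1_def M2_def)
  have s\<nu>: "sets \<nu> = sets borel" by (simp add: \<nu>_def M1_def)
  have fin: "finite_measure \<nu>"
  proof (rule finite_measureI)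
    have "emeasure \<nu> (space \<nu>) = emeasure M1 (space M1) + emeasure M2 (space M1)"
      unfolding \<nu>_def by (simp add: emeasure_measure_add[OF s])
    then show "emeasure \<nu> (space \<nu>) \<noteq> \<infinity>" by simp
  qed
  interpret \<nu>: finite_measure \<nu> by (rule fin)
  have "integrable \<nu> g"
    by (rule \<nu>.integrable_const_bound[of _ K]) (use K g in \<open>auto simp: measurable_cong_sets[OF s\<nu> refl]\<close>)
  then obtain h0 where h0: "continuous_on UNIV h0" "(\<integral>\<^sup>+z. ennreal \<bar>g z - h0 z\<bar> \<partial>\<nu>) < ennreal d"
    using continuous_L1_dense[OF s\<nu> fin] d by blast
  \<comment> \<open>Clamping does not increase the distance to g, as |g| <= K, and provides the
    bound on h needed for the Lipschitz constant exp(K).\<close>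
  define h where "h z = max (- K) (min K (h0 z))" for z
  have h: "continuous_on UNIV h" unfolding h_def by (intro continuous_intros h0)
  have K0: "K \<ge> 0" using K[of 0] by linarith
  have hK: "\<bar>h z\<bar> \<le> K" for z using K0 by (auto simp: h_def)
  have gh: "\<bar>g z - h z\<bar> \<le> \<bar>g z - h0 z\<bar>" for z using K[of z] by (auto simp: h_def max_def min_def abs_if split: if_splits)
  have hm: "h \<in> borel_measurable borel" by (rule borel_measurable_continuous_onI[OF h])
  have \<nu>d: "(\<integral>\<^sup>+z. ennreal \<bar>g z - h z\<bar> \<partial>\<nu>) \<le> ennreal d"
    using nn_integral_mono[of \<nu> "\<lambda>z. ennreal \<bar>g z - h z\<bar>" "\<lambda>z. ennreal \<bar>g z - h0 z\<bar>"] h0(2) gh by (auto intro: ennreal_leI)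
  have ghm: "(\<lambda>z. \<bar>g z - h z\<bar>) \<in> borel_measurable borel" using g hm by measurable
  have ghm': "(\<lambda>z. ennreal \<bar>g z - h z\<bar>) \<in> borel_measurable borel" using ghm by measurable
  have ghB: "\<bar>g z - h z\<bar> \<le> 2 * K" for z using K[of z] hK[of z] by linarith
  then have ghB': "\<bar>\<bar>g z - h z\<bar>\<bar> \<le> 2 * K" for z by simp
  have i_mu: "integrable \<mu> f" if "f \<in> borel_measurable borel" "\<And>z. \<bar>f z\<bar> \<le> B" for f :: "complex \<Rightarrow> real" and B
    by (rule integrable_const_bound[of _ B]) (use that in \<open>auto intro: measurable_mu\<close>)
  have i_an: "integrable angle_measure (\<lambda>t. f (cis t))" if "f \<in> borel_measurable borel" "\<And>z. \<bar>f z\<bar> \<le> B" for f :: "complex \<Rightarrow> real" and B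
    by (rule angle.integrable_const_bound[of _ B]) (use that in \<open>auto intro: measurable_angle_cis\<close>)
  have a: "(\<integral>t. \<bar>g (cis t) - h (cis t)\<bar> \<partial>angle_measure) \<le> d"
  proof -
    have "ennreal (\<integral>t. \<bar>g (cis t) - h (cis t)\<bar> \<partial>angle_measure) = (\<integral>\<^sup>+t. ennreal \<bar>g (cis t) - h (cis t)\<bar> \<partial>angle_measure)"
      by (rule nn_integral_eq_integral[symmetric]) (use i_an[OF ghm, of "2 * K"] ghB in auto)
    also have "\<dots> = (\<integral>\<^sup>+z. ennreal \<bar>g z - h z\<bar> \<partial>M2)"
      unfolding M2_def by (rule nn_integral_distr[symmetric, OF cism]) (use ghm' in simp)
    also have "\<dots> \<le> ennreal d" using nn_integral_le_measure_add(2)[OF s] \<nu>d unfolding \<nu>_def by (rule order_trans)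
    finally show ?thesis using d by (simp add: ennreal_le_iff)
  qed
  have b: "(\<integral>z. \<bar>g z - h z\<bar> \<partial>\<mu>) \<le> d"
  proof -
    have "ennreal (\<integral>z. \<bar>g z - h z\<bar> \<partial>\<mu>) = (\<integral>\<^sup>+z. ennreal \<bar>g z - h z\<bar> \<partial>\<mu>)"
      by (rule nn_integral_eq_integral[symmetric]) (use i_mu[OF ghm, of "2 * K"] ghB in auto)
    also have "\<dots> = (\<integral>\<^sup>+z. ennreal \<bar>g z - h z\<bar> \<partial>M1)"
      unfolding M1_def by (rule nn_integral_distr[symmetric, OF idm]) (use ghm' in simp)
    also have "\<dots> \<le> ennreal d" using nn_integral_le_measure_add(1)[OF s] \<nu>d unfolding \<nu>_def by (rule order_trans)
    finally show ?thesis using d by (simp add: ennreal_le_iff)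
  qed
  have ig: "integrable angle_measure (\<lambda>t. (1 - cos t) ^ m * f (cis t))" if f: "f \<in> borel_measurable borel" "\<And>z. \<bar>f z\<bar> \<le> B" for f :: "complex \<Rightarrow> real" and B
  proof (rule angle.integrable_const_bound[of _ "2 ^ m * B"])
    have "norm ((1 - cos t) ^ m * f (cis t)) \<le> 2 ^ m * B" for t
    proof -
      have "\<bar>(1 - cos t) ^ m\<bar> * \<bar>f (cis t)\<bar> \<le> 2 ^ m * B"
        using one_minus_cos_power_bounds[of t m] f(2)[of "cis t"] by (intro mult_mono) auto
      then show ?thesis by (simp only: real_norm_def abs_mult)
    qed
    then show "AE t in angle_measure. norm ((1 - cos t) ^ m * f (cis t)) \<le> 2 ^ m * B" by simp
    show "(\<lambda>t. (1 - cos t) ^ m * f (cis t)) \<in> borel_measurable angle_measure"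
      using measurable_angle_cis[OF f(1)] by measurable
  qed
  have exm: "(\<lambda>z. exp (f z)) \<in> borel_measurable borel" if "f \<in> borel_measurable borel" for f :: "complex \<Rightarrow> real"
    using that by measurable
  have egB: "\<bar>exp (g z)\<bar> \<le> exp K" and ehB: "\<bar>exp (h z)\<bar> \<le> exp K" for z
    using K[of z] hK[of z] by simp_all
  have "(\<integral>t. (1 - cos t) ^ m * g (cis t) \<partial>angle_measure) \<le> (\<integral>t. (1 - cos t) ^ m * h (cis t) + 2 ^ m * \<bar>g (cis t) - h (cis t)\<bar> \<partial>angle_measure)"
  proof (rule integral_mono)
    show "integrable angle_measure (\<lambda>t. (1 - cos t) ^ m * g (cis t))" by (rule ig[OF g K])
    show "integrable angle_measure (\<lambda>t. (1 - cos t) ^ m * h (cis t) + 2 ^ m * \<bar>g (cis t) - h (cis t)\<bar>)"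
      by (intro Bochner_Integration.integrable_add integrable_mult_right ig[OF hm hK] i_an[OF ghm ghB'])
    fix t
    have "(1 - cos t) ^ m * (g (cis t) - h (cis t)) \<le> (1 - cos t) ^ m * \<bar>g (cis t) - h (cis t)\<bar>"
      by (intro mult_left_mono one_minus_cos_power_bounds) simp
    also have "\<dots> \<le> 2 ^ m * \<bar>g (cis t) - h (cis t)\<bar>" by (intro mult_right_mono one_minus_cos_power_bounds) simp
    finally show "(1 - cos t) ^ m * g (cis t) \<le> (1 - cos t) ^ m * h (cis t) + 2 ^ m * \<bar>g (cis t) - h (cis t)\<bar>"
      by (simp add: algebra_simps)
  qed
  also have "\<dots> = (\<integral>t. (1 - cos t) ^ m * h (cis t) \<partial>angle_measure) + 2 ^ m * (\<integral>t. \<bar>g (cis t) - h (cis t)\<bar> \<partial>angle_measure)"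
    by (simp only: Bochner_Integration.integral_add[OF ig[OF hm hK] integrable_mult_right[OF i_an[OF ghm ghB']]] integral_mult_right_zero)
  also have "\<dots> \<le> (2 ^ m * (\<integral>z. exp (h z) \<partial>\<mu>) + C) + 2 ^ m * d"
    by (intro add_mono mult_left_mono a integral_continuous_le[OF C] continuous_on_subset[OF h]) auto
  also have "(\<integral>z. exp (h z) \<partial>\<mu>) \<le> (\<integral>z. exp (g z) + exp K * \<bar>g z - h z\<bar> \<partial>\<mu>)"
  proof (rule integral_mono)
    show "integrable \<mu> (\<lambda>z. exp (h z))" by (rule i_mu[OF exm[OF hm] ehB])
    show "integrable \<mu> (\<lambda>z. exp (g z) + exp K * \<bar>g z - h z\<bar>)"
      by (intro Bochner_Integration.integrable_add integrable_mult_right i_mu[OF exm[OF g] egB] i_mu[OF ghm ghB'])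
    fix z
    show "exp (h z) \<le> exp (g z) + exp K * \<bar>g z - h z\<bar>"
      using exp_diff_le[of "h z" K "g z"] hK[of z] abs_le_D1[of "h z" K] by (simp add: abs_minus_commute)
  qed
  also have "(\<integral>z. exp (g z) + exp K * \<bar>g z - h z\<bar> \<partial>\<mu>) = (\<integral>z. exp (g z) \<partial>\<mu>) + exp K * (\<integral>z. \<bar>g z - h z\<bar> \<partial>\<mu>)"
    by (simp only: Bochner_Integration.integral_add[OF i_mu[OF exm[OF g] egB] integrable_mult_right[OF i_mu[OF ghm ghB']]] integral_mult_right_zero)
  also have "\<dots> \<le> (\<integral>z. exp (g z) \<partial>\<mu>) + exp K * d" using b by (intro add_left_mono mult_left_mono) auto
  also have "2 ^ m * ((\<integral>z. exp (g z) \<partial>\<mu>) + exp K * d) + C + 2 ^ m * d = 2 ^ m * (\<integral>z. exp (g z) \<partial>\<mu>) + C + d * (2 ^ m * (1 + exp K))"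
    by (simp add: algebra_simps)
  also have "d * (2 ^ m * (1 + exp K)) = e" 
    by (rule iffD1[OF nonzero_eq_divide_eq[OF less_imp_neq[OF pos, symmetric]]]) (rule d_def)
  finally show "(\<integral>t. (1 - cos t) ^ m * g (cis t) \<partial>angle_measure) \<le> 2 ^ m * (\<integral>z. exp (g z) \<partial>\<mu>) + C + e"
    by simp
qed

end

context circle_decomposition
begin

lemma singular_support:
  obtains N where "N \<in> sets circle_borel" "emeasure circle_lebesgue N = 0" "emeasure \<mu>s (sphere 0 1 - N) = 0" "sets \<mu>s = sets circle_borel"
  using decomposition unfolding lebesgue_decomposition_def by blast

text \<open>Restricted to the complement of N, the singular part has no mass and the two measures
  coincide; they are compared as densities.\<close>

lemma nn_integral_off_singular:
  assumes N: "N \<in> sets circle_borel" "emeasure \<mu>s (sphere 0 1 - N) = 0" "sets \<mu>s = sets circle_borel"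
    and f: "f \<in> borel_measurable circle_borel"
  shows "(\<integral>\<^sup>+z. indicator (sphere 0 1 - N) z * f z \<partial>\<mu>) = (\<integral>\<^sup>+z. indicator (sphere 0 1 - N) z * f z \<partial>ac_part)"
proof -
  let ?S = "sphere 0 1 - N"
  have "space circle_borel = sphere 0 1" by (simp add: circle_borel_def space_restrict_space)
  then have S: "?S \<in> sets circle_borel" using N(1) sets.compl_sets by metis
  have "density \<mu> (indicator ?S) = density ac_part (indicator ?S)"
  proof (rule measure_eqI)
    fix A assume "A \<in> sets (density \<mu> (indicator ?S))"
    then have A: "A \<in> sets circle_borel" by (simp add: sets_mu)
    have SA: "?S \<inter> A \<in> sets circle_borel" using S A by blast
    have "emeasure \<mu>s (?S \<inter> A) \<le> emeasure \<mu>s ?S" using S N(3) by (intro emeasure_mono) auto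
    then have "emeasure \<mu>s (?S \<inter> A) = 0" using N(2) by simp
    then show "emeasure (density \<mu> (indicator ?S)) A = emeasure (density ac_part (indicator ?S)) A"
      using S A by (simp add: emeasure_restricted sets_mu sets_ac_part emeasure_decomposition[OF SA])
  qed (simp add: sets_mu sets_ac_part)
  then have "(\<integral>\<^sup>+z. f z \<partial>density \<mu> (indicator ?S)) = (\<integral>\<^sup>+z. f z \<partial>density ac_part (indicator ?S))" by simp
  then show ?thesis
    using S f by (simp add: nn_integral_density measurable_cong_sets[OF sets_mu refl] measurable_cong_sets[OF sets_ac_part refl])
qed

text \<open>The bound for bounded test functions is applied to the truncation v, set to 0 on the
  null set N carrying the singular part. Since w exp(v) <= 1 + w, the resulting bound is independent
  of K.\<close>

lemma truncated_entropy_le: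
  fixes K :: nat
  assumes C: "\<And>N. szego_entropy m \<alpha> N \<le> C"
  defines "v \<equiv> (\<lambda>t. if w t = 0 then real K else min (real K) (max 0 (- ln (w t))))"
  shows "(\<integral>\<^sup>+t. ennreal ((1 - cos t) ^ m * v t) \<partial>angle_measure) \<le> ennreal (2 ^ m * 3 + C)"
proof -
  obtain N where N: "N \<in> sets circle_borel" "emeasure circle_lebesgue N = 0" "emeasure \<mu>s (sphere 0 1 - N) = 0" "sets \<mu>s = sets circle_borel"
    by (rule singular_support)
  have vm [measurable]: "v \<in> borel_measurable angle_measure" unfolding v_def by measurable
  have v0: "0 \<le> v t" "v t \<le> real K" for t by (auto simp: v_def)
  \<comment> \<open>Extension by 0 off the period gives a Borel function on the line that can be
    composed with \<open>circle_angle\<close>.\<close>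
  define v' where "v' t = indicator {0..<2 * pi} t *\<^sub>R v t" for t
  have "v \<in> borel_measurable (restrict_space borel {0..<2 * pi})"
    using vm measurable_cong_sets[OF sets_angle_measure refl] by blast
  then have v'm: "v' \<in> borel_measurable borel"
    unfolding v'_def[abs_def] by (subst (asm) borel_measurable_restrict_space_iff) auto
  define g where "g z = (if z \<in> N then 0 else v' (circle_angle z))" for z
  have "N \<in> sets borel" using N(1) by (simp add: circle_borel_def sets_restrict_space_iff)
  then have gm: "g \<in> borel_measurable borel"
    unfolding g_def[abs_def] using measurable_compose[OF measurable_circle_angle v'm] by measurable
  have g_cis: "g (cis t) = (if cis t \<in> N then 0 else v t)" if "t \<in> {0..<2 * pi}" for t
    using that by (simp add: g_def v'_def circle_angle_cis)
  have g01: "0 \<le> g z" "\<bar>g z\<bar> \<le> real K" for z using v0 by (auto simp: g_def v'_def indicator_def)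
  \<comment> \<open>N is a Lebesgue null set, so changing the test function on N leaves the integral
    over the angle unchanged.\<close>
  have "AE z in circle_lebesgue. z \<notin> N"
    by (rule AE_not_in) (use N in \<open>auto simp: null_sets_def circle_lebesgue_def\<close>)
  then have AEN: "AE t in angle_measure. cis t \<notin> N"
    unfolding circle_lebesgue_def by (rule AE_distrD[OF measurable_cis])
  have gcm: "g \<in> borel_measurable circle_borel" unfolding circle_borel_def by (rule measurable_restrict_space1[OF gm])
  \<comment> \<open>The three units are the bound \<mu>(N) <= 1, the total mass of d\<theta>/2\<pi>,
    and the bound 1 for the integral of w.\<close>
  have E: "(\<integral>z. exp (g z) \<partial>\<mu>) \<le> 3"
  proof -
    have split: "ennreal (exp (g z)) \<le> indicator N z + indicator (sphere 0 1 - N) z * ennreal (exp (g z))" if "z \<in> space \<mu>" for z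
      using that by (auto simp: space_M indicator_def g_def)
    have efm: "(\<lambda>z. ennreal (exp (g z))) \<in> borel_measurable circle_borel" using gcm by measurable
    have "space circle_borel = sphere 0 1" by (simp add: circle_borel_def space_restrict_space)
    then have S: "sphere 0 1 - N \<in> sets circle_borel" using N(1) sets.compl_sets by metis
    have ifm: "(\<lambda>z. indicator (sphere 0 1 - N) z * ennreal (exp (g z))) \<in> borel_measurable circle_borel"
      using efm S by measurable
    have "(\<integral>\<^sup>+z. ennreal (exp (g z)) \<partial>\<mu>) \<le> (\<integral>\<^sup>+z. indicator N z + indicator (sphere 0 1 - N) z * ennreal (exp (g z)) \<partial>\<mu>)"
      by (rule nn_integral_mono) (rule split)
    also have "\<dots> = (\<integral>\<^sup>+z. indicator N z \<partial>\<mu>) + (\<integral>\<^sup>+z. indicator (sphere 0 1 - N) z * ennreal (exp (g z)) \<partial>\<mu>)"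
      by (rule nn_integral_add) (use N ifm in \<open>auto simp: measurable_cong_sets[OF sets_mu refl]\<close>)
    also have "(\<integral>\<^sup>+z. indicator N z \<partial>\<mu>) \<le> 1"
      using N(1) by (simp add: sets_mu emeasure_le_1)
    also have "(\<integral>\<^sup>+z. indicator (sphere 0 1 - N) z * ennreal (exp (g z)) \<partial>\<mu>)
        = (\<integral>\<^sup>+z. indicator (sphere 0 1 - N) z * ennreal (exp (g z)) \<partial>ac_part)"
      by (rule nn_integral_off_singular[OF N(1,3,4) efm])
    also have "\<dots> = (\<integral>\<^sup>+t. ennreal (w t) * (indicator (sphere 0 1 - N) (cis t) * ennreal (exp (g (cis t)))) \<partial>angle_measure)"
      by (rule nn_integral_ac_part[OF ifm])
    also have "\<dots> \<le> (\<integral>\<^sup>+t. 1 + ennreal (w t) \<partial>angle_measure)"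
    proof (rule nn_integral_mono)
      fix t assume "t \<in> space angle_measure"
      then have t: "t \<in> {0..<2 * pi}" by simp
      show "ennreal (w t) * (indicator (sphere 0 1 - N) (cis t) * ennreal (exp (g (cis t)))) \<le> 1 + ennreal (w t)"
      proof (cases "cis t \<in> N \<or> w t = 0")
        case True
        then show ?thesis by auto
      next
        case False
        then have w: "w t > 0" using w_nonneg[OF t] by simp
        have "v t \<le> max 0 (- ln (w t))" using False by (simp add: v_def)
        then have "exp (v t) \<le> exp (max 0 (- ln (w t)))" by simp
        also have "\<dots> = max 1 (1 / w t)" using w by (simp add: max_def exp_minus inverse_eq_divide)
        finally have "w t * exp (v t) \<le> w t * max 1 (1 / w t)" using w by (intro mult_left_mono) auto
        also have "\<dots> \<le> 1 + w t" using w by (auto simp: max_def)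
        finally have "ennreal (w t * exp (v t)) \<le> ennreal (1 + w t)" by (rule ennreal_leI)
        moreover have "ennreal (1 + w t) = 1 + ennreal (w t)" using w by (subst ennreal_plus) auto
        ultimately show ?thesis using False w by (simp add: g_cis[OF t] ennreal_mult)
      qed
    qed
    also have "\<dots> = 1 + (\<integral>\<^sup>+t. ennreal (w t) \<partial>angle_measure)"
      by (subst nn_integral_add) (auto simp: angle.emeasure_space_1 simp del: space_angle_measure)
    also have "\<dots> \<le> 1 + 1" by (intro add_left_mono nn_integral_w)
    finally have "(\<integral>\<^sup>+z. ennreal (exp (g z)) \<partial>\<mu>) \<le> 1 + (1 + 1)" by (simp add: add_mono)
    moreover have "integrable \<mu> (\<lambda>z. exp (g z))"
    proof (rule integrable_const_bound[of _ "exp (real K)"])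
      show "AE z in \<mu>. norm (exp (g z)) \<le> exp (real K)" using g01(2) by (intro AE_I2) (simp add: abs_le_iff)
      show "(\<lambda>z. exp (g z)) \<in> borel_measurable \<mu>" using gm by (intro measurable_mu) measurable
    qed
    then have "(\<integral>\<^sup>+z. ennreal (exp (g z)) \<partial>\<mu>) = ennreal (\<integral>z. exp (g z) \<partial>\<mu>)"
      by (rule nn_integral_eq_integral) simp
    moreover have "(1 :: ennreal) + (1 + 1) = ennreal 3" by simp
    ultimately have "ennreal (\<integral>z. exp (g z) \<partial>\<mu>) \<le> ennreal 3" by simp
    then show ?thesis by (rule iffD1[OF ennreal_le_iff, rotated]) simp
  qed
  have int: "integrable angle_measure (\<lambda>t. (1 - cos t) ^ m * v t)"
  proof (rule angle.integrable_const_bound[of _ "2 ^ m * real K"])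
    have "norm ((1 - cos t) ^ m * v t) \<le> 2 ^ m * real K" for t
    proof -
      have "\<bar>(1 - cos t) ^ m\<bar> * \<bar>v t\<bar> \<le> 2 ^ m * real K"
        using one_minus_cos_power_bounds[of t m] v0[of t] by (intro mult_mono) auto
      then show ?thesis by (simp only: real_norm_def abs_mult)
    qed
    then show "AE t in angle_measure. norm ((1 - cos t) ^ m * v t) \<le> 2 ^ m * real K" by simp
  qed measurable
  have "(\<integral>t. (1 - cos t) ^ m * v t \<partial>angle_measure) = (\<integral>t. (1 - cos t) ^ m * g (cis t) \<partial>angle_measure)"
  proof (rule integral_cong_AE)
    show "AE t in angle_measure. (1 - cos t) ^ m * v t = (1 - cos t) ^ m * g (cis t)"
      using AEN AE_space by eventually_elim (simp add: g_cis)
    show "(\<lambda>t. (1 - cos t) ^ m * g (cis t)) \<in> borel_measurable angle_measure"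
      using measurable_angle_cis[OF gm] by measurable
  qed measurable
  also have "\<dots> \<le> 2 ^ m * (\<integral>z. exp (g z) \<partial>\<mu>) + C" by (rule integral_bounded_le[OF C gm g01(2)])
  also have "\<dots> \<le> 2 ^ m * 3 + C" using E by (intro add_right_mono mult_left_mono) auto
  finally have "(\<integral>t. (1 - cos t) ^ m * v t \<partial>angle_measure) \<le> 2 ^ m * 3 + C" .
  moreover have "AE t in angle_measure. 0 \<le> (1 - cos t) ^ m * v t"
    by (intro AE_I2 mult_nonneg_nonneg one_minus_cos_power_bounds v0)
  ultimately show ?thesis using nn_integral_eq_integral[OF int] by (simp add: ennreal_leI)
qed

text \<open>Monotone convergence in K, which needs the truncated bound to be uniform in K.\<close>

lemma negative_entropy_finite:
  assumes C: "\<And>N. szego_entropy m \<alpha> N \<le> C"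
  shows "(\<integral>\<^sup>+t. negative_entropy m w t \<partial>angle_measure) \<noteq> \<infinity>"
proof -
  define v where "v K t = (if w t = 0 then real K else min (real K) (max 0 (- ln (w t))))" for K :: nat and t
  have [measurable]: "v K \<in> borel_measurable angle_measure" for K unfolding v_def[abs_def] by measurable
  define f where "f K t = ennreal ((1 - cos t) ^ m * v K t)" for K :: nat and t
  have fm: "f K \<in> borel_measurable angle_measure" for K unfolding f_def[abs_def] by measurable
  have inc: "incseq f"
    unfolding f_def by (intro incseq_SucI le_funI ennreal_leI mult_left_mono one_minus_cos_power_bounds) (auto simp: v_def)
  have fC: "(\<integral>\<^sup>+t. f K t \<partial>angle_measure) \<le> ennreal (2 ^ m * 3 + C)" for K
    unfolding f_def v_def by (rule truncated_entropy_le[OF C])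
  have le: "negative_entropy m w t \<le> (SUP K. f K t)" if "t \<in> space angle_measure" for t
  proof (cases "w t = 0")
    case False
    then have w: "w t > 0" using w_nonneg[of t] that by simp
    obtain K :: nat where K: "max 0 (- ln (w t)) \<le> real K" using real_arch_simple by blast
    have "negative_entropy m w t \<le> f K t"
      unfolding negative_entropy_pos[where w = w and t = t, OF w] f_def
    proof (rule ennreal_leI)
      have "(1 - cos t) ^ m * (- ln (w t)) \<le> (1 - cos t) ^ m * v K t"
        using K False by (intro mult_left_mono one_minus_cos_power_bounds) (simp add: v_def)
      then show "- ((1 - cos t) ^ m * ln (w t)) \<le> (1 - cos t) ^ m * v K t" by simp
    qed
    then show ?thesis by (rule SUP_upper2[OF UNIV_I])
  next
    case True
    show ?thesis
    proof (cases "(1 - cos t) ^ m = 0")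
      case True
      then show ?thesis unfolding negative_entropy_zero[where w = w and t = t, OF \<open>w t = 0\<close>] by (simp only: if_True) simp
    next
      case False
      define p where "p = (1 - cos t) ^ m"
      have p: "p > 0" using False one_minus_cos_power_bounds(1)[of t m] by (metis p_def less_le)
      \<comment> \<open>Where w = 0 and the weight p is positive, the truncation is p K and exceeds
        every natural number.\<close>
      have "(SUP K. f K t) = \<top>"
      proof (rule ennreal_SUP_eq_top)
        fix n :: nat
        obtain K :: nat where K: "real n / p \<le> real K" using real_arch_simple by blast
        then have "real n \<le> p * real K" using p by (simp add: pos_divide_le_eq mult.commute)
        then have "ennreal (real n) \<le> f K t"
          unfolding f_def p_def[symmetric] using \<open>w t = 0\<close> by (intro ennreal_leI) (simp add: v_def)
        then show "\<exists>i\<in>UNIV. of_nat n \<le> f i t" by (auto simp: ennreal_of_nat_eq_real_of_nat)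
      qed
      from ord_le_eq_trans[OF top_greatest this[symmetric]] show ?thesis .
    qed
  qed
  have "(\<integral>\<^sup>+t. negative_entropy m w t \<partial>angle_measure) \<le> (\<integral>\<^sup>+t. (SUP K. f K t) \<partial>angle_measure)"
    by (rule nn_integral_mono) (rule le)
  also have "\<dots> = (SUP K. \<integral>\<^sup>+t. f K t \<partial>angle_measure)"
    by (rule nn_integral_monotone_convergence_SUP[OF inc fm])
  also have "\<dots> \<le> ennreal (2 ^ m * 3 + C)" by (rule SUP_least) (rule fC)
  finally show ?thesis by (auto simp: top_unique)
qed

text \<open>From ln w <= w, the positive part is at most 2^m w and has a finite integral. So the
  difference is never of the form \<infinity> - \<infinity>, and only the negative part
  decides.\<close>

lemma ereal_integral_finite_iff:
  "ereal_integral angle_measure (\<lambda>\<theta>. ereal ((1 - cos \<theta>) ^ m) * log_ereal (w \<theta>)) > -\<infinity>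
    \<longleftrightarrow> (\<integral>\<^sup>+t. negative_entropy m w t \<partial>angle_measure) \<noteq> \<infinity>"
proof -
  let ?a = "\<integral>\<^sup>+t. e2ennreal (ereal ((1 - cos t) ^ m) * log_ereal (w t)) \<partial>angle_measure"
  let ?b = "\<integral>\<^sup>+t. negative_entropy m w t \<partial>angle_measure"
  have "?a \<le> (\<integral>\<^sup>+t. ennreal (2 ^ m) * ennreal (w t) \<partial>angle_measure)"
  proof (rule nn_integral_mono)
    fix t assume "t \<in> space angle_measure"
    then have w0: "w t \<ge> 0" using w_nonneg by simp
    show "e2ennreal (ereal ((1 - cos t) ^ m) * log_ereal (w t)) \<le> ennreal (2 ^ m) * ennreal (w t)"
    proof (cases "w t = 0")
      case True
      have "ereal p * -\<infinity> \<le> 0" if "p \<ge> 0" for p :: real using that by (cases "p = 0") auto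
      then have "ereal ((1 - cos t) ^ m) * log_ereal (w t) \<le> 0"
        using True one_minus_cos_power_bounds(1)[of t m] by (simp only: log_ereal_def order_refl if_True)
      then show ?thesis by (simp add: e2ennreal_neg)
    next
      case False
      then have w: "w t > 0" using w0 by simp
      have "(1 - cos t) ^ m * ln (w t) \<le> (1 - cos t) ^ m * w t"
        using ln_bound[OF w] by (intro mult_left_mono one_minus_cos_power_bounds) auto
      also have "\<dots> \<le> 2 ^ m * w t" using w by (intro mult_right_mono one_minus_cos_power_bounds) auto
      finally have "ennreal ((1 - cos t) ^ m * ln (w t)) \<le> ennreal (2 ^ m * w t)" by (rule ennreal_leI)
      then show ?thesis using w by (simp add: log_ereal_def e2ennreal_ereal ennreal_mult)
    qed
  qed
  also have "\<dots> = ennreal (2 ^ m) * (\<integral>\<^sup>+t. ennreal (w t) \<partial>angle_measure)"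
    by (rule nn_integral_cmult) measurable
  also have "\<dots> \<le> ennreal (2 ^ m) * 1" by (intro mult_left_mono nn_integral_w) simp
  finally have "?a < \<top>" by (auto simp: less_top[symmetric] top_unique)
  then obtain r where "?a = ennreal r" "r \<ge> 0" by (cases ?a) auto
  then have a: "enn2ereal ?a = ereal r" by (simp add: enn2ereal_ennreal)
  have "ereal_integral angle_measure (\<lambda>\<theta>. ereal ((1 - cos \<theta>) ^ m) * log_ereal (w \<theta>)) = ereal r - enn2ereal ?b"
    unfolding ereal_integral_def negative_entropy_def a ..
  also have "\<dots> > -\<infinity> \<longleftrightarrow> ?b \<noteq> \<infinity>"
    by (cases ?b) (auto simp: enn2ereal_ennreal)
  finally show ?thesis .
qed

end

theorem theorem1p1:
  fixes \<mu> \<mu>s :: "complex measure" and w :: "real \<Rightarrow> real" and \<alpha> :: "nat \<Rightarrow> complex" and m :: nat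
  assumes "nontrivial_circle_prob \<mu>"
    and "verblunsky_coefficients \<mu> \<alpha>"
    and "lebesgue_decomposition \<mu> w \<mu>s"
    and "forward_diff \<alpha> \<in> little_l 2"
  shows "ereal_integral angle_measure (\<lambda>\<theta>. ereal ((1 - cos \<theta>) ^ m) * log_ereal (w \<theta>)) > -\<infinity>
         \<longleftrightarrow> \<alpha> \<in> little_l (2 * m + 2)"
proof -
  interpret circle_decomposition \<mu> \<mu>s w \<alpha>
    using assms by (simp add: circle_decomposition_def nontrivial_circle_prob_def)
  have "(\<integral>\<^sup>+t. negative_entropy m w t \<partial>angle_measure) \<noteq> \<infinity> \<longleftrightarrow> (\<exists>C. \<forall>N. szego_entropy m \<alpha> N \<le> C)"
    using szego_entropy_bounded negative_entropy_finite by blast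
  also have "\<dots> \<longleftrightarrow> \<alpha> \<in> little_l (2 * m + 2)"
    by (rule szego_entropy_bounded_iff[OF norm_verblunsky assms(4)])
  finally show ?thesis unfolding ereal_integral_finite_iff .
qed

end
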